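(* Let $k$ be a field of characteristic $0$ and let $A$ be a reduced commutative $k$-algebra (not assumed to be noetherian). If $\mathrm{HH}_1(A/k)=0$, then $\mathrm{HH}_i(A/k)=0$ for all $i\geq 1$.
   Context: For a commutative algebra $A$ over a field $k$, the $n$-th Hochschild homology is $\mathrm{HH}_n(A/k):=\mathrm{Tor}_n^{A\otimes_k A}(A,A)$, where $A$ is an $A\otimes_k A$-module via the multiplication map $A\otimes_k A\to A$. *)

theory Defs
  imports "HOL-Algebra.Module" "HOL-Algebra.QuotRing"
begin

section \<open>Definitions\<close>

definition char_zero :: "('a, 'b) ring_scheme \<Rightarrow> bool" where
  "char_zero R \<longleftrightarrow> (\<forall>n::nat. n > 0 \<longrightarrow> [n] \<cdot>\<^bsub>R\<^esub> \<one>\<^bsub>R\<^esub> \<noteq> \<zero>\<^bsub>R\<^esub>)"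

definition reduced_ring :: "('a, 'b) ring_scheme \<Rightarrow> bool" where
  "reduced_ring R \<longleftrightarrow> (\<forall>x\<in>carrier R. \<forall>n::nat. x [^]\<^bsub>R\<^esub> n = \<zero>\<^bsub>R\<^esub> \<longrightarrow> x = \<zero>\<^bsub>R\<^esub>)"

text \<open>Modules are records of type \<open>module\<close>, which extends \<open>ring\<close>; the fields \<open>mult\<close> and
  \<open>one\<close> of a mere module carry no meaning.\<close>

subsection \<open>Free modules and quotient modules\<close>

definition single :: "('r, 'p) ring_scheme \<Rightarrow> 's \<Rightarrow> 'r \<Rightarrow> ('s \<Rightarrow> 'r)" where
  "single R s r = (\<lambda>t. if t = s then r else \<zero>\<^bsub>R\<^esub>)"

definition supp :: "('r, 'p) ring_scheme \<Rightarrow> ('s \<Rightarrow> 'r) \<Rightarrow> 's set" where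
  "supp R u = {s. u s \<noteq> \<zero>\<^bsub>R\<^esub>}"

definition free_module :: "('r, 'p) ring_scheme \<Rightarrow> 's set \<Rightarrow> ('r, 's \<Rightarrow> 'r) module" where
  "free_module R S =
    \<lparr>carrier = {u. range u \<subseteq> carrier R \<and> finite (supp R u) \<and> supp R u \<subseteq> S},
     mult = undefined, one = undefined,
     zero = (\<lambda>s. \<zero>\<^bsub>R\<^esub>), add = (\<lambda>u v s. u s \<oplus>\<^bsub>R\<^esub> v s),
     smult = (\<lambda>r u s. r \<otimes>\<^bsub>R\<^esub> u s)\<rparr>"

definition lin_ext ::
  "('r, 'p) ring_scheme \<Rightarrow> ('r, 'm, 'q) module_scheme \<Rightarrow> ('s \<Rightarrow> 'm) \<Rightarrow> ('s \<Rightarrow> 'r) \<Rightarrow> 'm" where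
  "lin_ext R M \<phi> u = (\<Oplus>\<^bsub>M\<^esub>s\<in>supp R u. u s \<odot>\<^bsub>M\<^esub> \<phi> s)"

definition submodule_span ::
  "('r, 'p) ring_scheme \<Rightarrow> ('r, 'm, 'q) module_scheme \<Rightarrow> 'm set \<Rightarrow> 'm set" where
  "submodule_span R M X = \<Inter>{H. submodule H R M \<and> X \<subseteq> H}"

definition quot_module ::
  "('r, 'm, 'q) module_scheme \<Rightarrow> 'm set \<Rightarrow> ('r, 'm set) module" where
  "quot_module M N =
    \<lparr>carrier = a_rcosets\<^bsub>M\<^esub> N, mult = undefined, one = undefined,
     zero = N, add = set_add M,
     smult = (\<lambda>r X. \<Union>x\<in>X. N +>\<^bsub>M\<^esub> (r \<odot>\<^bsub>M\<^esub> x))\<rparr>"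

subsection \<open>Tensor products\<close>

definition tensor_rels ::
  "('r, 'p) ring_scheme \<Rightarrow> ('r, 'm, 'q) module_scheme \<Rightarrow> ('r, 'n, 'u) module_scheme \<Rightarrow>
    ('m \<times> 'n \<Rightarrow> 'r) set" where
  "tensor_rels R M N =
    (let F = free_module R (carrier M \<times> carrier N); e = (\<lambda>m n. single R (m, n) \<one>\<^bsub>R\<^esub>) in
      {e (m \<oplus>\<^bsub>M\<^esub> m') n \<ominus>\<^bsub>F\<^esub> (e m n \<oplus>\<^bsub>F\<^esub> e m' n) | m m' n.
        m \<in> carrier M \<and> m' \<in> carrier M \<and> n \<in> carrier N} \<union>
      {e m (n \<oplus>\<^bsub>N\<^esub> n') \<ominus>\<^bsub>F\<^esub> (e m n \<oplus>\<^bsub>F\<^esub> e m n') | m n n'.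
        m \<in> carrier M \<and> n \<in> carrier N \<and> n' \<in> carrier N} \<union>
      {e (r \<odot>\<^bsub>M\<^esub> m) n \<ominus>\<^bsub>F\<^esub> r \<odot>\<^bsub>F\<^esub> e m n | r m n.
        r \<in> carrier R \<and> m \<in> carrier M \<and> n \<in> carrier N} \<union>
      {e m (r \<odot>\<^bsub>N\<^esub> n) \<ominus>\<^bsub>F\<^esub> r \<odot>\<^bsub>F\<^esub> e m n | r m n.
        r \<in> carrier R \<and> m \<in> carrier M \<and> n \<in> carrier N})"

definition tensor_ker ::
  "('r, 'p) ring_scheme \<Rightarrow> ('r, 'm, 'q) module_scheme \<Rightarrow> ('r, 'n, 'u) module_scheme \<Rightarrow>
    ('m \<times> 'n \<Rightarrow> 'r) set" where
  "tensor_ker R M N =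
    submodule_span R (free_module R (carrier M \<times> carrier N)) (tensor_rels R M N)"

definition tensor ::
  "('r, 'p) ring_scheme \<Rightarrow> ('r, 'm, 'q) module_scheme \<Rightarrow> ('r, 'n, 'u) module_scheme \<Rightarrow>
    ('r, ('m \<times> 'n \<Rightarrow> 'r) set) module" where
  "tensor R M N = quot_module (free_module R (carrier M \<times> carrier N)) (tensor_ker R M N)"

definition pure_tensor ::
  "('r, 'p) ring_scheme \<Rightarrow> ('r, 'm, 'q) module_scheme \<Rightarrow> ('r, 'n, 'u) module_scheme \<Rightarrow>
    'm \<Rightarrow> 'n \<Rightarrow> ('m \<times> 'n \<Rightarrow> 'r) set" where
  "pure_tensor R M N m n =
    tensor_ker R M N +>\<^bsub>free_module R (carrier M \<times> carrier N)\<^esub> single R (m, n) \<one>\<^bsub>R\<^esub>"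

text \<open>The linear map into \<open>P\<close> induced by a bilinear map \<open>\<phi>\<close>: the linear extension of \<open>\<phi>\<close> to
  the free module is constant on each coset (\<open>tensor_lift_coset\<close> below), and its value is
  the value of the induced map.\<close>

definition tensor_lift ::
  "('r, 'p) ring_scheme \<Rightarrow> ('r, 'l, 'q) module_scheme \<Rightarrow> ('m \<Rightarrow> 'n \<Rightarrow> 'l) \<Rightarrow>
    ('m \<times> 'n \<Rightarrow> 'r) set \<Rightarrow> 'l" where
  "tensor_lift R P \<phi> X = the_elem (lin_ext R P (\<lambda>(m, n). \<phi> m n) ` X)"

definition tensor_map ::
  "('r, 'p) ring_scheme \<Rightarrow> ('r, 'm, 'q) module_scheme \<Rightarrow> ('r, 'n, 'u) module_scheme \<Rightarrow>
    ('l \<Rightarrow> 'm) \<Rightarrow> ('k \<Rightarrow> 'n) \<Rightarrow> ('l \<times> 'k \<Rightarrow> 'r) set \<Rightarrow> ('m \<times> 'n \<Rightarrow> 'r) set" where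
  "tensor_map R M N f g =
    tensor_lift R (tensor R M N) (\<lambda>x y. pure_tensor R M N (f x) (g y))"

text \<open>For algebras \<open>A\<close> and \<open>B\<close>, the product on the tensor product is determined by
  \<open>(a \<otimes> b) (c \<otimes> d) = a c \<otimes> b d\<close>.\<close>

definition tensor_algebra ::
  "('r, 'p) ring_scheme \<Rightarrow> ('r, 'a, 'q) module_scheme \<Rightarrow> ('r, 'b, 'u) module_scheme \<Rightarrow>
    ('r, ('a \<times> 'b \<Rightarrow> 'r) set) module" where
  "tensor_algebra R A B =
    (let T = tensor R A B in
      T\<lparr>mult := (\<lambda>X Y. tensor_lift R T (\<lambda>a b. tensor_lift R T
                   (\<lambda>c d. pure_tensor R A B (a \<otimes>\<^bsub>A\<^esub> c) (b \<otimes>\<^bsub>B\<^esub> d)) Y) X),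
        one := pure_tensor R A B \<one>\<^bsub>A\<^esub> \<one>\<^bsub>B\<^esub>\<rparr>)"

subsection \<open>Tor\<close>

text \<open>\<open>Tor\<close> is computed from one fixed free resolution of \<open>M\<close>, which exists for every module and
  involves no choices: the generators in degree \<open>0\<close> are the elements of \<open>M\<close>, and the
  generators in degree \<open>n + 1\<close> are all formal linear combinations (written as lists) of
  generators in degree \<open>n\<close> that are cycles.  Using lists keeps all degrees in a single type.\<close>

datatype ('r, 'm) gen = Elt 'm | Syz "('r \<times> ('r, 'm) gen) list"

definition lin_comb :: "('r, 'p) ring_scheme \<Rightarrow> ('r \<times> 's) list \<Rightarrow> ('s \<Rightarrow> 'r)" where
  "lin_comb R l = foldr (\<lambda>(r, s) u. single R s r \<oplus>\<^bsub>free_module R UNIV\<^esub> u) l (\<lambda>s. \<zero>\<^bsub>R\<^esub>)"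

text \<open>Only the values of \<open>gen_elt\<close> on generators \<open>Elt m\<close> and those of \<open>gen_bdry\<close> on
  generators \<open>Syz l\<close> matter.\<close>

fun gen_elt :: "('r, 'm) gen \<Rightarrow> 'm" where
  "gen_elt (Elt m) = m"
| "gen_elt (Syz l) = undefined"

fun gen_bdry :: "('r, 'p) ring_scheme \<Rightarrow> ('r, 'm) gen \<Rightarrow> (('r, 'm) gen \<Rightarrow> 'r)" where
  "gen_bdry R (Elt m) = undefined"
| "gen_bdry R (Syz l) = lin_comb R l"

fun gens ::
  "('r, 'p) ring_scheme \<Rightarrow> ('r, 'm, 'q) module_scheme \<Rightarrow> nat \<Rightarrow> ('r, 'm) gen set" where
  "gens R M 0 = Elt ` carrier M"
| "gens R M (Suc 0) =
    {Syz l | l. set l \<subseteq> carrier R \<times> gens R M 0 \<and>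
      lin_ext R M gen_elt (lin_comb R l) = \<zero>\<^bsub>M\<^esub>}"
| "gens R M (Suc (Suc n)) =
    {Syz l | l. set l \<subseteq> carrier R \<times> gens R M (Suc n) \<and>
      lin_ext R (free_module R (gens R M n)) (gen_bdry R) (lin_comb R l) =
        \<zero>\<^bsub>free_module R (gens R M n)\<^esub>}"

definition res ::
  "('r, 'p) ring_scheme \<Rightarrow> ('r, 'm, 'q) module_scheme \<Rightarrow> nat \<Rightarrow>
    ('r, ('r, 'm) gen \<Rightarrow> 'r) module" where
  "res R M n = free_module R (gens R M n)"

text \<open>In this and all other complexes below, \<open>d n\<close> is the differential from degree \<open>n + 1\<close> to
  degree \<open>n\<close>.\<close>

definition res_d ::
  "('r, 'p) ring_scheme \<Rightarrow> ('r, 'm, 'q) module_scheme \<Rightarrow> nat \<Rightarrow>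
    (('r, 'm) gen \<Rightarrow> 'r) \<Rightarrow> (('r, 'm) gen \<Rightarrow> 'r)" where
  "res_d R M n = lin_ext R (res R M n) (gen_bdry R)"

definition res_aug ::
  "('r, 'p) ring_scheme \<Rightarrow> ('r, 'm, 'q) module_scheme \<Rightarrow> (('r, 'm) gen \<Rightarrow> 'r) \<Rightarrow> 'm" where
  "res_aug R M = lin_ext R M gen_elt"

definition cycles ::
  "(nat \<Rightarrow> ('r, 'm, 'q) module_scheme) \<Rightarrow> (nat \<Rightarrow> 'm \<Rightarrow> 'm) \<Rightarrow> nat \<Rightarrow> 'm set" where
  "cycles C d n =
    (case n of 0 \<Rightarrow> carrier (C 0)
     | Suc m \<Rightarrow> {x \<in> carrier (C (Suc m)). d m x = \<zero>\<^bsub>C m\<^esub>})"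

definition homology ::
  "(nat \<Rightarrow> ('r, 'm, 'q) module_scheme) \<Rightarrow> (nat \<Rightarrow> 'm \<Rightarrow> 'm) \<Rightarrow> nat \<Rightarrow> ('r, 'm set) module" where
  "homology C d n =
    quot_module ((C n)\<lparr>carrier := cycles C d n\<rparr>) (d n ` carrier (C (Suc n)))"

definition Tor ::
  "('r, 'p) ring_scheme \<Rightarrow> nat \<Rightarrow> ('r, 'm, 'q) module_scheme \<Rightarrow> ('r, 'n, 'u) module_scheme \<Rightarrow>
    ('r, ((('r, 'm) gen \<Rightarrow> 'r) \<times> 'n \<Rightarrow> 'r) set set) module" where
  "Tor R n M N =
    homology (\<lambda>i. tensor R (res R M i) N)
      (\<lambda>i. tensor_map R (res R M i) N (res_d R M i) id) n"

subsection \<open>Hochschild homology\<close>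

definition mult_map :: "('k, 'p) ring_scheme \<Rightarrow> ('k, 'a, 'q) module_scheme \<Rightarrow>
    ('a \<times> 'a \<Rightarrow> 'k) set \<Rightarrow> 'a" where
  "mult_map k A = tensor_lift k A (\<lambda>a b. a \<otimes>\<^bsub>A\<^esub> b)"

text \<open>A ring \<open>B\<close> as a module along a ring homomorphism \<open>h\<close> into \<open>B\<close>.\<close>

definition module_via :: "('r \<Rightarrow> 'b) \<Rightarrow> ('b, 'q) ring_scheme \<Rightarrow> ('r, 'b) module" where
  "module_via h B =
    \<lparr>carrier = carrier B, mult = mult B, one = one B, zero = zero B, add = add B,
     smult = (\<lambda>r b. h r \<otimes>\<^bsub>B\<^esub> b)\<rparr>"

definition HH :: "('k, 'p) ring_scheme \<Rightarrow> ('k, 'a, 'q) module_scheme \<Rightarrow> nat \<Rightarrow>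
    (('a \<times> 'a \<Rightarrow> 'k) set,
     (((('a \<times> 'a \<Rightarrow> 'k) set, 'a) gen \<Rightarrow> ('a \<times> 'a \<Rightarrow> 'k) set) \<times> 'a \<Rightarrow>
       ('a \<times> 'a \<Rightarrow> 'k) set) set set) module" where
  "HH k A n =
    Tor (tensor_algebra k A A) n
      (module_via (mult_map k A) A) (module_via (mult_map k A) A)"

section \<open>Well-definedness\<close>

text \<open>The facts below justify the definitions: quotients and tensor products are modules,
  \<open>tensor_lift\<close> realises the universal property of the tensor product, the tensor product
  of two algebras is an algebra, the multiplication map is a ring homomorphism, and \<open>res\<close> is an
  exact resolution by free modules.\<close>

subsection \<open>Free modules and quotient modules\<close>

lemma fm_simps:
  "\<zero>\<^bsub>free_module R S\<^esub> = (\<lambda>s. \<zero>\<^bsub>R\<^esub>)"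
  "u \<oplus>\<^bsub>free_module R S\<^esub> v = (\<lambda>s. u s \<oplus>\<^bsub>R\<^esub> v s)"
  "r \<odot>\<^bsub>free_module R S\<^esub> u = (\<lambda>s. r \<otimes>\<^bsub>R\<^esub> u s)"
  by (simp_all add: free_module_def)

lemma fm_carrier: "u \<in> carrier (free_module R S) \<longleftrightarrow>
   (\<forall>s. u s \<in> carrier R) \<and> finite (supp R u) \<and> supp R u \<subseteq> S"
  by (auto simp: free_module_def)

lemma (in cring) free_module_module: "module R (free_module R S)"
proof (rule moduleI)
  have supp_add: "finite (supp R (\<lambda>s. u s \<oplus> v s)) \<and> supp R (\<lambda>s. u s \<oplus> v s) \<subseteq> S"
    if "u \<in> carrier (free_module R S)" "v \<in> carrier (free_module R S)" for u v
  proof -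
    have "supp R (\<lambda>s. u s \<oplus> v s) \<subseteq> supp R u \<union> supp R v"
      by (auto simp: supp_def)
    then show ?thesis using that by (meson finite_subset finite_UnI fm_carrier order_trans Un_least)
  qed
  have supp_sm: "finite (supp R (\<lambda>s. r \<otimes> u s)) \<and> supp R (\<lambda>s. r \<otimes> u s) \<subseteq> S"
    if "r \<in> carrier R" "u \<in> carrier (free_module R S)" for r u
  proof -
    have "supp R (\<lambda>s. r \<otimes> u s) \<subseteq> supp R u"
      using that by (auto simp: supp_def)
    then show ?thesis using that by (meson finite_subset fm_carrier order_trans)
  qed
  show "cring R" by (rule is_cring)
  show "abelian_group (free_module R S)"
  proof (rule abelian_groupI)
    fix x y z
    assume x: "x \<in> carrier (free_module R S)" and y: "y \<in> carrier (free_module R S)"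
    show "x \<oplus>\<^bsub>free_module R S\<^esub> y \<in> carrier (free_module R S)"
      using x y supp_add[OF x y] by (simp add: fm_carrier fm_simps)
    show "x \<oplus>\<^bsub>free_module R S\<^esub> y = y \<oplus>\<^bsub>free_module R S\<^esub> x"
      using x y by (simp add: fm_carrier fm_simps a_comm)
    assume z: "z \<in> carrier (free_module R S)"
    show "x \<oplus>\<^bsub>free_module R S\<^esub> y \<oplus>\<^bsub>free_module R S\<^esub> z =
       x \<oplus>\<^bsub>free_module R S\<^esub> (y \<oplus>\<^bsub>free_module R S\<^esub> z)"
      using x y z by (simp add: fm_carrier fm_simps a_assoc)
  next
    show "\<zero>\<^bsub>free_module R S\<^esub> \<in> carrier (free_module R S)"
      by (simp add: fm_carrier fm_simps supp_def)
    fix x assume x: "x \<in> carrier (free_module R S)"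
    show "\<zero>\<^bsub>free_module R S\<^esub> \<oplus>\<^bsub>free_module R S\<^esub> x = x"
      using x by (simp add: fm_carrier fm_simps)
    have "(\<lambda>s. \<ominus> \<one> \<otimes> x s) \<in> carrier (free_module R S)"
      using x supp_sm[of "\<ominus> \<one>" x] by (simp add: fm_carrier)
    moreover have "(\<lambda>s. \<ominus> \<one> \<otimes> x s) \<oplus>\<^bsub>free_module R S\<^esub> x = \<zero>\<^bsub>free_module R S\<^esub>"
      using x by (simp add: fm_carrier fm_simps l_minus l_neg)
    ultimately show "\<exists>y\<in>carrier (free_module R S). y \<oplus>\<^bsub>free_module R S\<^esub> x = \<zero>\<^bsub>free_module R S\<^esub>"
      by blast
  qed
  fix a x assume a: "a \<in> carrier R" and x: "x \<in> carrier (free_module R S)"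
  show "a \<odot>\<^bsub>free_module R S\<^esub> x \<in> carrier (free_module R S)"
    using a x supp_sm[OF a x] by (simp add: fm_carrier fm_simps)
next
  fix x assume x: "x \<in> carrier (free_module R S)"
  show "\<one> \<odot>\<^bsub>free_module R S\<^esub> x = x" using x by (simp add: fm_carrier fm_simps)
next
  fix a b x assume a: "a \<in> carrier R" and x: "x \<in> carrier (free_module R S)" and b: "b \<in> carrier R"
    show "(a \<oplus> b) \<odot>\<^bsub>free_module R S\<^esub> x = a \<odot>\<^bsub>free_module R S\<^esub> x \<oplus>\<^bsub>free_module R S\<^esub> b \<odot>\<^bsub>free_module R S\<^esub> x"
      using a b x by (simp add: fm_carrier fm_simps l_distr)
    show "(a \<otimes> b) \<odot>\<^bsub>free_module R S\<^esub> x = a \<odot>\<^bsub>free_module R S\<^esub> (b \<odot>\<^bsub>free_module R S\<^esub> x)"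
      using a b x by (simp add: fm_carrier fm_simps m_assoc)
next
  fix a x y assume a: "a \<in> carrier R" and x: "x \<in> carrier (free_module R S)" and y: "y \<in> carrier (free_module R S)"
    show "a \<odot>\<^bsub>free_module R S\<^esub> (x \<oplus>\<^bsub>free_module R S\<^esub> y) = a \<odot>\<^bsub>free_module R S\<^esub> x \<oplus>\<^bsub>free_module R S\<^esub> a \<odot>\<^bsub>free_module R S\<^esub> y"
      using a y x by (simp add: fm_carrier fm_simps r_distr)
qed

lemma (in module) submodule_span:
  assumes "X \<subseteq> carrier M"
  shows "submodule (submodule_span R M X) R M"
proof (rule submoduleI)
  have *: "submodule (carrier M) R M" by (rule carrier_is_submodule)
  show "submodule_span R M X \<subseteq> carrier M"
    using assms * by (auto simp: submodule_span_def)
  show "\<zero>\<^bsub>M\<^esub> \<in> submodule_span R M X"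
    unfolding submodule_span_def
    by (auto simp: submodule_def subgroup_def)
qed (simp_all add: submodule_span_def submoduleE(3-5))

lemma submodule_span_superset: "X \<subseteq> submodule_span R M X"
  by (auto simp: submodule_span_def)

lemma submodule_span_least: "submodule H R M \<Longrightarrow> X \<subseteq> H \<Longrightarrow> submodule_span R M X \<subseteq> H"
  by (auto simp: submodule_span_def)

lemma (in module) submodule_abelian_subgroup:
  assumes "submodule N R M" shows "abelian_subgroup N M"
proof -
  have "additive_subgroup N M"
    using assms by (simp add: additive_subgroup_def submodule_def)
  then show ?thesis
    by (rule abelian_subgroupI3) (rule M.abelian_group_axioms)
qed

lemma (in module) quot_smult:
  assumes N: "submodule N R M" and r: "r \<in> carrier R" and x: "x \<in> carrier M"
  shows "r \<odot>\<^bsub>quot_module M N\<^esub> (N +>\<^bsub>M\<^esub> x) = N +>\<^bsub>M\<^esub> (r \<odot>\<^bsub>M\<^esub> x)"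
proof -
  interpret N: abelian_subgroup N M by (rule submodule_abelian_subgroup[OF N])
  have "N +>\<^bsub>M\<^esub> (r \<odot>\<^bsub>M\<^esub> y) = N +>\<^bsub>M\<^esub> (r \<odot>\<^bsub>M\<^esub> x)" if y: "y \<in> N +>\<^bsub>M\<^esub> x" for y
  proof -
    obtain h where h: "h \<in> N" "y = h \<oplus>\<^bsub>M\<^esub> x" using y by (auto simp: a_r_coset_def')
    have hM: "h \<in> carrier M" using h(1) N.a_subset by blast
    have "r \<odot>\<^bsub>M\<^esub> y = r \<odot>\<^bsub>M\<^esub> h \<oplus>\<^bsub>M\<^esub> r \<odot>\<^bsub>M\<^esub> x"
      using h hM r x by (simp add: smult_r_distr)
    moreover have "r \<odot>\<^bsub>M\<^esub> h \<in> N" using submoduleE(4)[OF N] r h by blast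
    ultimately have "r \<odot>\<^bsub>M\<^esub> y \<in> N +>\<^bsub>M\<^esub> (r \<odot>\<^bsub>M\<^esub> x)" by (auto simp: a_r_coset_def')
    then show ?thesis
      using N.a_repr_independence' r x by (metis smult_closed)
  qed
  moreover have "x \<in> N +>\<^bsub>M\<^esub> x" using N.a_rcos_self[OF x] .
  ultimately have "(\<Union>y\<in>N +>\<^bsub>M\<^esub> x. N +>\<^bsub>M\<^esub> (r \<odot>\<^bsub>M\<^esub> y)) = N +>\<^bsub>M\<^esub> (r \<odot>\<^bsub>M\<^esub> x)"
    by blast
  then show ?thesis by (simp add: quot_module_def)
qed

lemma (in module) quot_add:
  assumes N: "submodule N R M" and x: "x \<in> carrier M" and y: "y \<in> carrier M"
  shows "(N +>\<^bsub>M\<^esub> x) \<oplus>\<^bsub>quot_module M N\<^esub> (N +>\<^bsub>M\<^esub> y) = N +>\<^bsub>M\<^esub> (x \<oplus>\<^bsub>M\<^esub> y)"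
proof -
  interpret N: abelian_subgroup N M by (rule submodule_abelian_subgroup[OF N])
  show ?thesis using N.a_rcos_sum[OF x y] by (simp add: quot_module_def)
qed

lemma quot_carrier: "carrier (quot_module M N) = (\<lambda>x. N +>\<^bsub>M\<^esub> x) ` carrier M"
  by (auto simp: quot_module_def A_RCOSETS_def')

lemma (in module) quot_module_module:
  assumes N: "submodule N R M"
  shows "module R (quot_module M N)"
proof -
  interpret N: abelian_subgroup N M by (rule submodule_abelian_subgroup[OF N])
  have zero: "\<zero>\<^bsub>quot_module M N\<^esub> = N +>\<^bsub>M\<^esub> \<zero>\<^bsub>M\<^esub>"
    using N.a_subset by (simp add: quot_module_def)
  let ?Q = "quot_module M N"
  note s = quot_add[OF N] quot_smult[OF N]
  have c: "N +>\<^bsub>M\<^esub> a \<in> carrier ?Q" if "a \<in> carrier M" for a using that by (auto simp: quot_carrier)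
  show ?thesis
  proof (rule moduleI)
    show "cring R" by (rule R.is_cring)
    show "abelian_group (quot_module M N)"
    proof (rule abelian_groupI)
      show "\<zero>\<^bsub>?Q\<^esub> \<in> carrier ?Q" by (simp add: zero c)
    next
      fix x y assume "x \<in> carrier ?Q" "y \<in> carrier ?Q"
      then obtain a b where ab: "a \<in> carrier M" "x = N +>\<^bsub>M\<^esub> a" "b \<in> carrier M" "y = N +>\<^bsub>M\<^esub> b"
        by (auto simp: quot_carrier)
      then show "x \<oplus>\<^bsub>?Q\<^esub> y \<in> carrier ?Q" by (simp add: s c)
      show "x \<oplus>\<^bsub>?Q\<^esub> y = y \<oplus>\<^bsub>?Q\<^esub> x" using ab by (simp add: s M.a_comm)
    next
      fix x y z assume "x \<in> carrier ?Q" "y \<in> carrier ?Q" "z \<in> carrier ?Q"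
      then obtain a b d where ab: "a \<in> carrier M" "x = N +>\<^bsub>M\<^esub> a" "b \<in> carrier M" "y = N +>\<^bsub>M\<^esub> b"
          "d \<in> carrier M" "z = N +>\<^bsub>M\<^esub> d"
        by (auto simp: quot_carrier)
      then show "x \<oplus>\<^bsub>?Q\<^esub> y \<oplus>\<^bsub>?Q\<^esub> z = x \<oplus>\<^bsub>?Q\<^esub> (y \<oplus>\<^bsub>?Q\<^esub> z)"
        by (simp add: s M.a_assoc)
    next
      fix x assume "x \<in> carrier ?Q"
      then obtain a where a: "a \<in> carrier M" "x = N +>\<^bsub>M\<^esub> a" by (auto simp: quot_carrier)
      then show "\<zero>\<^bsub>?Q\<^esub> \<oplus>\<^bsub>?Q\<^esub> x = x" by (simp add: s zero)
      show "\<exists>y\<in>carrier ?Q. y \<oplus>\<^bsub>?Q\<^esub> x = \<zero>\<^bsub>?Q\<^esub>"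
        by (rule bexI[of _ "N +>\<^bsub>M\<^esub> (\<ominus>\<^bsub>M\<^esub> a)"]) (use a in \<open>simp_all add: s c zero M.l_neg\<close>)
    qed
  next
    fix r x assume r: "r \<in> carrier R" and "x \<in> carrier ?Q"
    then obtain a where a: "a \<in> carrier M" "x = N +>\<^bsub>M\<^esub> a" by (auto simp: quot_carrier)
    then show "r \<odot>\<^bsub>?Q\<^esub> x \<in> carrier ?Q" using r by (simp add: s c)
  next
    fix r t x assume r: "r \<in> carrier R" "t \<in> carrier R" and "x \<in> carrier ?Q"
    then obtain a where a: "a \<in> carrier M" "x = N +>\<^bsub>M\<^esub> a" by (auto simp: quot_carrier)
    then show "(r \<oplus> t) \<odot>\<^bsub>?Q\<^esub> x = r \<odot>\<^bsub>?Q\<^esub> x \<oplus>\<^bsub>?Q\<^esub> t \<odot>\<^bsub>?Q\<^esub> x"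
      using r by (simp add: s smult_l_distr)
    show "(r \<otimes> t) \<odot>\<^bsub>?Q\<^esub> x = r \<odot>\<^bsub>?Q\<^esub> (t \<odot>\<^bsub>?Q\<^esub> x)"
      using r a by (simp add: s smult_assoc1)
  next
    fix r x y assume r: "r \<in> carrier R" and "x \<in> carrier ?Q" "y \<in> carrier ?Q"
    then obtain a b where ab: "a \<in> carrier M" "x = N +>\<^bsub>M\<^esub> a" "b \<in> carrier M" "y = N +>\<^bsub>M\<^esub> b"
      by (auto simp: quot_carrier)
    then show "r \<odot>\<^bsub>?Q\<^esub> (x \<oplus>\<^bsub>?Q\<^esub> y) = r \<odot>\<^bsub>?Q\<^esub> x \<oplus>\<^bsub>?Q\<^esub> r \<odot>\<^bsub>?Q\<^esub> y"
      using r by (simp add: s smult_r_distr)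
  next
    fix x assume "x \<in> carrier ?Q"
    then obtain a where a: "a \<in> carrier M" "x = N +>\<^bsub>M\<^esub> a" by (auto simp: quot_carrier)
    then show "\<one> \<odot>\<^bsub>?Q\<^esub> x = x" by (simp add: s)
  qed
qed

lemma (in cring) single_closed: "s \<in> S \<Longrightarrow> r \<in> carrier R \<Longrightarrow> single R s r \<in> carrier (free_module R S)"
  by (auto simp: fm_carrier single_def supp_def intro: finite_subset[of _ "{s}"])

lemma (in module) tensor_rels_subset:
  assumes "module R N"
  shows "tensor_rels R M N \<subseteq> carrier (free_module R (carrier M \<times> carrier N))"
proof -
  interpret N: module R N by fact
  interpret F: module R "free_module R (carrier M \<times> carrier N)" by (rule R.free_module_module)
  show ?thesis
    unfolding tensor_rels_def Let_def
    by (auto intro!: F.M.minus_closed F.M.a_closed F.smult_closed R.single_closed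
         M.a_closed N.M.a_closed smult_closed N.smult_closed R.one_closed)
qed

lemma (in module) tensor_ker_submodule:
  assumes "module R N"
  shows "submodule (tensor_ker R M N) R (free_module R (carrier M \<times> carrier N))"
proof -
  interpret F: module R "free_module R (carrier M \<times> carrier N)" by (rule R.free_module_module)
  show ?thesis unfolding tensor_ker_def
    by (rule F.submodule_span) (rule tensor_rels_subset[OF assms])
qed

lemma (in module) tensor_module:
  assumes "module R N"
  shows "module R (tensor R M N)"
proof -
  interpret F: module R "free_module R (carrier M \<times> carrier N)" by (rule R.free_module_module)
  show ?thesis unfolding tensor_def
    by (rule F.quot_module_module) (rule tensor_ker_submodule[OF assms])
qed

subsection \<open>Linear extension\<close>

lemma (in module) lin_ext_superset:
  assumes "\<phi> \<in> S \<rightarrow> carrier M" "u \<in> carrier (free_module R S)" "finite F" "supp R u \<subseteq> F" "F \<subseteq> S"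
  shows "lin_ext R M \<phi> u = (\<Oplus>\<^bsub>M\<^esub>s\<in>F. u s \<odot>\<^bsub>M\<^esub> \<phi> s)"
  unfolding lin_ext_def
proof (rule M.add.finprod_mono_neutral_cong_left)
  show "\<And>i. i \<in> F - supp R u \<Longrightarrow> u i \<odot>\<^bsub>M\<^esub> \<phi> i = \<zero>\<^bsub>M\<^esub>"
    using assms by (auto simp: supp_def intro!: smult_l_null)
  show "(\<lambda>s. u s \<odot>\<^bsub>M\<^esub> \<phi> s) \<in> F \<rightarrow> carrier M"
    using assms(1,2,5) by (auto simp: fm_carrier Pi_iff subset_iff)
qed (use assms in auto)

lemma (in module) lin_ext_closed:
  assumes "\<phi> \<in> S \<rightarrow> carrier M" "u \<in> carrier (free_module R S)"
  shows "lin_ext R M \<phi> u \<in> carrier M"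
  unfolding lin_ext_def
  by (rule M.finsum_closed) (use assms in \<open>auto simp: fm_carrier\<close>)

lemma (in module) lin_ext_add:
  assumes "\<phi> \<in> S \<rightarrow> carrier M" "u \<in> carrier (free_module R S)" "v \<in> carrier (free_module R S)"
  shows "lin_ext R M \<phi> (u \<oplus>\<^bsub>free_module R S\<^esub> v) = lin_ext R M \<phi> u \<oplus>\<^bsub>M\<^esub> lin_ext R M \<phi> v"
proof -
  interpret F: module R "free_module R S" by (rule R.free_module_module)
  let ?F = "supp R u \<union> supp R v"
  have F: "finite ?F" "?F \<subseteq> S" using assms by (auto simp: fm_carrier)
  have uv: "u \<oplus>\<^bsub>free_module R S\<^esub> v \<in> carrier (free_module R S)" using assms by simp
  have c: "u s \<in> carrier R" "v s \<in> carrier R" for s using assms by (auto simp: fm_carrier)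
  have sub: "supp R (u \<oplus>\<^bsub>free_module R S\<^esub> v) \<subseteq> ?F" by (auto simp: fm_simps supp_def)
  have phi: "s \<in> ?F \<Longrightarrow> \<phi> s \<in> carrier M" for s using F assms(1) by blast
  have "lin_ext R M \<phi> (u \<oplus>\<^bsub>free_module R S\<^esub> v) = (\<Oplus>\<^bsub>M\<^esub>s\<in>?F. (u s \<oplus> v s) \<odot>\<^bsub>M\<^esub> \<phi> s)"
    using lin_ext_superset[OF assms(1) uv F(1) sub F(2)] by (simp add: fm_simps)
  also have "\<dots> = (\<Oplus>\<^bsub>M\<^esub>s\<in>?F. u s \<odot>\<^bsub>M\<^esub> \<phi> s \<oplus>\<^bsub>M\<^esub> v s \<odot>\<^bsub>M\<^esub> \<phi> s)"
    by (rule M.finsum_cong') (use c phi in \<open>auto simp: smult_l_distr\<close>)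
  also have "\<dots> = (\<Oplus>\<^bsub>M\<^esub>s\<in>?F. u s \<odot>\<^bsub>M\<^esub> \<phi> s) \<oplus>\<^bsub>M\<^esub> (\<Oplus>\<^bsub>M\<^esub>s\<in>?F. v s \<odot>\<^bsub>M\<^esub> \<phi> s)"
    by (rule M.finsum_addf) (use c phi in auto)
  finally show ?thesis
    using lin_ext_superset[OF assms(1,2) F(1) _ F(2)] lin_ext_superset[OF assms(1,3) F(1) _ F(2)] by simp
qed

lemma (in module) lin_ext_smult:
  assumes "\<phi> \<in> S \<rightarrow> carrier M" "u \<in> carrier (free_module R S)" "r \<in> carrier R"
  shows "lin_ext R M \<phi> (r \<odot>\<^bsub>free_module R S\<^esub> u) = r \<odot>\<^bsub>M\<^esub> lin_ext R M \<phi> u"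
proof -
  interpret F: module R "free_module R S" by (rule R.free_module_module)
  have F: "finite (supp R u)" "supp R u \<subseteq> S" using assms by (auto simp: fm_carrier)
  have ru: "r \<odot>\<^bsub>free_module R S\<^esub> u \<in> carrier (free_module R S)" using assms by simp
  have c: "u s \<in> carrier R" for s using assms by (auto simp: fm_carrier)
  have sub: "supp R (r \<odot>\<^bsub>free_module R S\<^esub> u) \<subseteq> supp R u" using assms by (auto simp: fm_simps supp_def)
  have phi: "s \<in> supp R u \<Longrightarrow> \<phi> s \<in> carrier M" for s using F assms(1) by blast
  have "lin_ext R M \<phi> (r \<odot>\<^bsub>free_module R S\<^esub> u) = (\<Oplus>\<^bsub>M\<^esub>s\<in>supp R u. (r \<otimes> u s) \<odot>\<^bsub>M\<^esub> \<phi> s)"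
    using lin_ext_superset[OF assms(1) ru F(1) sub F(2)] by (simp add: fm_simps)
  also have "\<dots> = (\<Oplus>\<^bsub>M\<^esub>s\<in>supp R u. r \<odot>\<^bsub>M\<^esub> (u s \<odot>\<^bsub>M\<^esub> \<phi> s))"
    by (rule M.finsum_cong') (use c phi assms in \<open>auto simp: smult_assoc1\<close>)
  also have "\<dots> = r \<odot>\<^bsub>M\<^esub> (\<Oplus>\<^bsub>M\<^esub>s\<in>supp R u. u s \<odot>\<^bsub>M\<^esub> \<phi> s)"
    by (rule finsum_smult_ldistr[symmetric]) (use c phi assms F in auto)
  finally show ?thesis by (simp add: lin_ext_def)
qed

lemma (in module) lin_ext_single:
  assumes "\<phi> \<in> S \<rightarrow> carrier M" "s \<in> S" "r \<in> carrier R"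
  shows "lin_ext R M \<phi> (single R s r) = r \<odot>\<^bsub>M\<^esub> \<phi> s"
proof -
  have "lin_ext R M \<phi> (single R s r) = (\<Oplus>\<^bsub>M\<^esub>t\<in>{s}. single R s r t \<odot>\<^bsub>M\<^esub> \<phi> t)"
    by (rule lin_ext_superset[OF assms(1)]) (use assms R.single_closed in \<open>auto simp: supp_def single_def\<close>)
  also have "\<dots> = r \<odot>\<^bsub>M\<^esub> \<phi> s"
    using assms by (subst M.finsum_insert) (auto simp: single_def Pi_iff)
  finally show ?thesis .
qed

locale lin_map = M: module R M + N: module R N for R (structure) and M and N and f +
  assumes closed: "x \<in> carrier M \<Longrightarrow> f x \<in> carrier N"
    and add: "x \<in> carrier M \<Longrightarrow> y \<in> carrier M \<Longrightarrow> f (x \<oplus>\<^bsub>M\<^esub> y) = f x \<oplus>\<^bsub>N\<^esub> f y"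
    and smult: "r \<in> carrier R \<Longrightarrow> x \<in> carrier M \<Longrightarrow> f (r \<odot>\<^bsub>M\<^esub> x) = r \<odot>\<^bsub>N\<^esub> f x"
begin
lemma zero: "f \<zero>\<^bsub>M\<^esub> = \<zero>\<^bsub>N\<^esub>"
  using smult[of "\<zero>" "\<zero>\<^bsub>M\<^esub>"] closed by simp
lemma minus: "x \<in> carrier M \<Longrightarrow> f (\<ominus>\<^bsub>M\<^esub> x) = \<ominus>\<^bsub>N\<^esub> f x"
  using smult[of "\<ominus>\<one>" "x"] closed
  by (simp add: M.smult_l_minus N.smult_l_minus)
lemma diff: "x \<in> carrier M \<Longrightarrow> y \<in> carrier M \<Longrightarrow> f (x \<ominus>\<^bsub>M\<^esub> y) = f x \<ominus>\<^bsub>N\<^esub> f y"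
  by (simp add: a_minus_def add minus)
lemma ker: "submodule {x \<in> carrier M. f x = \<zero>\<^bsub>N\<^esub>} R M"
  by (rule M.submoduleI) (auto simp: zero add minus smult)
lemma im: assumes "submodule H R M" shows "submodule (f ` H) R N"
proof (rule N.submoduleI)
  note H = M.submoduleE[OF assms]
  show "\<zero>\<^bsub>N\<^esub> \<in> f ` H"
  proof -
    obtain h where h: "h \<in> H" using H(2) by blast
    then have "\<zero> \<odot>\<^bsub>M\<^esub> h \<in> H" using H(4) by simp
    with h H(1) have "\<zero>\<^bsub>M\<^esub> \<in> H" by (metis M.smult_l_null subsetD)
    then show ?thesis using zero by (metis imageI)
  qed
  show "f ` H \<subseteq> carrier N" using H(1) closed by blast
next
  note H = M.submoduleE[OF assms]
  fix a assume "a \<in> f ` H"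
  then obtain x where x: "x \<in> H" "a = f x" by blast
  then have "f (\<ominus>\<^bsub>M\<^esub> x) = \<ominus>\<^bsub>N\<^esub> a" using H(1) minus by blast
  then show "\<ominus>\<^bsub>N\<^esub> a \<in> f ` H" using H(3)[OF x(1)] by (metis imageI)
next
  note H = M.submoduleE[OF assms]
  fix a b assume "a \<in> f ` H" "b \<in> f ` H"
  then obtain x y where x: "x \<in> H" "a = f x" "y \<in> H" "b = f y" by blast
  then have "f (x \<oplus>\<^bsub>M\<^esub> y) = a \<oplus>\<^bsub>N\<^esub> b" using H(1) add by blast
  then show "a \<oplus>\<^bsub>N\<^esub> b \<in> f ` H" using H(5)[OF x(1,3)] by (metis imageI)
next
  note H = M.submoduleE[OF assms]
  fix r a assume r: "r \<in> carrier R" and "a \<in> f ` H"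
  then obtain x where x: "x \<in> H" "a = f x" by blast
  then have "f (r \<odot>\<^bsub>M\<^esub> x) = r \<odot>\<^bsub>N\<^esub> a" using H(1) smult r by blast
  then show "r \<odot>\<^bsub>N\<^esub> a \<in> f ` H" using H(4)[OF r x(1)] by (metis imageI)
qed
end

lemma (in module) lin_ext_lin:
  assumes "\<phi> \<in> S \<rightarrow> carrier M"
  shows "lin_map R (free_module R S) M (lin_ext R M \<phi>)"
  by (intro lin_map.intro lin_map_axioms.intro R.free_module_module module_axioms)
     (use assms lin_ext_closed lin_ext_add lin_ext_smult in auto)

lemma (in cring) free_module_induct [consumes 1, case_names zero add]:
  assumes u: "u \<in> carrier (free_module R S)"
    and z: "P \<zero>\<^bsub>free_module R S\<^esub>"
    and a: "\<And>r s v. r \<in> carrier R \<Longrightarrow> s \<in> S \<Longrightarrow> v \<in> carrier (free_module R S) \<Longrightarrow> P v \<Longrightarrow>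
       P (single R s r \<oplus>\<^bsub>free_module R S\<^esub> v)"
  shows "P u"
proof -
  have "finite (supp R u)" using u by (simp add: fm_carrier)
  then show ?thesis using u
  proof (induction "supp R u" arbitrary: u rule: finite_induct)
    case empty
    then have "u = \<zero>\<^bsub>free_module R S\<^esub>" by (auto simp: supp_def fm_simps)
    then show ?case using z by simp
  next
    case (insert s A)
    let ?v = "u(s := \<zero>)"
    have A: "A = supp R ?v" using insert.hyps(2,4) by (auto simp: supp_def)
    have v: "?v \<in> carrier (free_module R S)"
      using insert.prems insert.hyps(1,4) A by (auto simp: fm_carrier)
    have "u = single R s (u s) \<oplus>\<^bsub>free_module R S\<^esub> ?v"
      using insert.prems by (auto simp: fm_simps single_def fm_carrier)
    moreover have "s \<in> S" using insert.prems insert.hyps(4) by (auto simp: fm_carrier)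
    ultimately show ?case using a[of "u s" s ?v] insert.hyps(3)[OF A v] v insert.prems
      by (auto simp: fm_carrier)
  qed
qed

subsection \<open>The resolution is exact\<close>

lemma (in cring) lin_comb_closed: "set l \<subseteq> carrier R \<times> S \<Longrightarrow> lin_comb R l \<in> carrier (free_module R S)"
proof (induction l)
  case Nil
  then show ?case by (simp add: lin_comb_def fm_carrier supp_def)
next
  case (Cons a l)
  interpret F: module R "free_module R S" by (rule free_module_module)
  obtain r s where a: "a = (r, s)" by force
  then have "r \<in> carrier R" "s \<in> S" using Cons.prems by auto
  then have "single R s r \<oplus>\<^bsub>free_module R S\<^esub> lin_comb R l \<in> carrier (free_module R S)"
    using single_closed[of s S r] Cons F.M.a_closed by auto
  then show ?case by (simp add: a lin_comb_def fm_simps)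
qed

lemma (in cring) lin_comb_surj: 
  assumes "u \<in> carrier (free_module R S)"
  shows "\<exists>l. set l \<subseteq> carrier R \<times> S \<and> lin_comb R l = u"
  using assms
proof (induction rule: free_module_induct)
  case zero
  show ?case by (rule exI[of _ "[]"]) (simp add: lin_comb_def fm_simps)
next
  case (add r s v)
  then obtain l where "set l \<subseteq> carrier R \<times> S" "lin_comb R l = v" by blast
  with add show ?case by (intro exI[of _ "(r, s) # l"]) (auto simp: lin_comb_def fm_simps)
qed

lemma (in module) free_map_onto:
  assumes phi: "\<phi> \<in> S \<rightarrow> carrier M" and H: "submodule H R M" and im: "\<phi> ` S = H"
  shows "lin_ext R M \<phi> ` carrier (free_module R S) = H"
proof
  interpret F: module R "free_module R S" by (rule R.free_module_module)
  interpret L: lin_map R "free_module R S" M "lin_ext R M \<phi>" by (rule lin_ext_lin[OF phi])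
  note HE = submoduleE[OF H]
  show "lin_ext R M \<phi> ` carrier (free_module R S) \<subseteq> H"
  proof safe
    fix u assume "u \<in> carrier (free_module R S)"
    then show "lin_ext R M \<phi> u \<in> H"
    proof (induction rule: R.free_module_induct)
      case zero
      show ?case using H L.zero by (auto simp: submodule_def dest: subgroup.one_closed)
    next
      case (add r s v)
      then show ?case using im HE(4,5) lin_ext_single[OF phi]
        by (auto simp: L.add R.single_closed)
    qed
  qed
  show "H \<subseteq> lin_ext R M \<phi> ` carrier (free_module R S)"
  proof
    fix h assume "h \<in> H"
    then obtain s where s: "s \<in> S" "h = \<phi> s" using im by blast
    then have "lin_ext R M \<phi> (single R s \<one>) = h" using phi lin_ext_single[OF phi s(1), of \<one>] smult_one[of "\<phi> s"] by (simp add: Pi_iff)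
    then show "h \<in> lin_ext R M \<phi> ` carrier (free_module R S)"
      using R.single_closed[OF s(1), of \<one>] by blast
  qed
qed

context module begin

lemma res_module: "module R (res R M n)"
  unfolding res_def by (rule R.free_module_module)

lemma aug_lin: "lin_map R (res R M 0) M (res_aug R M)"
  unfolding res_def res_aug_def by (rule lin_ext_lin) auto

lemma res_aug_onto: "res_aug R M ` carrier (res R M 0) = carrier M"
  unfolding res_def res_aug_def
  by (rule free_map_onto) (auto intro: carrier_is_submodule simp: image_image)

lemma bdry_fun: "gen_bdry R \<in> gens R M (Suc n) \<rightarrow> carrier (res R M n)"
  by (cases n) (auto simp: res_def intro!: R.lin_comb_closed)

lemma d_lin: "lin_map R (res R M (Suc n)) (res R M n) (res_d R M n)"
  unfolding res_d_def
  using module.lin_ext_lin[OF res_module bdry_fun] by (simp add: res_def)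

lemma res_exact0:
  "res_d R M 0 ` carrier (res R M 1) = {x \<in> carrier (res R M 0). res_aug R M x = \<zero>\<^bsub>M\<^esub>}"
proof -
  interpret F: module R "res R M 0" by (rule res_module)
  have "gen_bdry R ` gens R M (Suc 0) = {x \<in> carrier (res R M 0). res_aug R M x = \<zero>\<^bsub>M\<^esub>}" (is "?L = ?R")
  proof
    show "?L \<subseteq> ?R" by (auto simp: res_def res_aug_def intro!: R.lin_comb_closed)
    show "?R \<subseteq> ?L"
    proof
      fix x assume x: "x \<in> ?R"
      then obtain l where l: "set l \<subseteq> carrier R \<times> gens R M 0" "lin_comb R l = x"
        using R.lin_comb_surj by (auto simp: res_def)
      then have "Syz l \<in> gens R M (Suc 0)" using x by (auto simp: res_aug_def)
      with l show "x \<in> ?L" by (metis gen_bdry.simps(2) imageI)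
    qed
  qed
  with F.free_map_onto[OF bdry_fun lin_map.ker[OF aug_lin]] show ?thesis
    unfolding res_d_def by (simp add: res_def)
qed

lemma res_exact:
  "res_d R M (Suc n) ` carrier (res R M (Suc (Suc n))) =
    {x \<in> carrier (res R M (Suc n)). res_d R M n x = \<zero>\<^bsub>res R M n\<^esub>}"
proof -
  interpret F: module R "res R M (Suc n)" by (rule res_module)
  have "gen_bdry R ` gens R M (Suc (Suc n)) = {x \<in> carrier (res R M (Suc n)). res_d R M n x = \<zero>\<^bsub>res R M n\<^esub>}" (is "?L = ?R")
  proof
    show "?L \<subseteq> ?R" by (auto simp: res_def res_d_def intro!: R.lin_comb_closed)
    show "?R \<subseteq> ?L"
    proof
      fix x assume x: "x \<in> ?R"
      then obtain l where l: "set l \<subseteq> carrier R \<times> gens R M (Suc n)" "lin_comb R l = x"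
        using R.lin_comb_surj[of x "gens R M (Suc n)"] by (auto simp: res_def)
      then have "Syz l \<in> gens R M (Suc (Suc n))" using x by (auto simp: res_d_def res_def)
      with l show "x \<in> ?L" by (metis gen_bdry.simps(2) imageI)
    qed
  qed
  with F.free_map_onto[OF bdry_fun lin_map.ker[OF d_lin]] show ?thesis
    unfolding res_d_def by (simp add: res_def)
qed

end

subsection \<open>The universal property of the tensor product\<close>

locale bilin = M: module R M + N: module R N + P: module R P for R (structure) and M and N and P and f +
  assumes closed: "x \<in> carrier M \<Longrightarrow> y \<in> carrier N \<Longrightarrow> f x y \<in> carrier P"
    and add1: "x \<in> carrier M \<Longrightarrow> x' \<in> carrier M \<Longrightarrow> y \<in> carrier N \<Longrightarrow> f (x \<oplus>\<^bsub>M\<^esub> x') y = f x y \<oplus>\<^bsub>P\<^esub> f x' y"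
    and add2: "x \<in> carrier M \<Longrightarrow> y \<in> carrier N \<Longrightarrow> y' \<in> carrier N \<Longrightarrow> f x (y \<oplus>\<^bsub>N\<^esub> y') = f x y \<oplus>\<^bsub>P\<^esub> f x y'"
    and smult1: "r \<in> carrier R \<Longrightarrow> x \<in> carrier M \<Longrightarrow> y \<in> carrier N \<Longrightarrow> f (r \<odot>\<^bsub>M\<^esub> x) y = r \<odot>\<^bsub>P\<^esub> f x y"
    and smult2: "r \<in> carrier R \<Longrightarrow> x \<in> carrier M \<Longrightarrow> y \<in> carrier N \<Longrightarrow> f x (r \<odot>\<^bsub>N\<^esub> y) = r \<odot>\<^bsub>P\<^esub> f x y"

lemma (in cring) submodule_mem_cong:
  assumes "module R M" "submodule H R M" "x \<in> carrier M" "y \<in> carrier M" "x \<ominus>\<^bsub>M\<^esub> y \<in> H"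
  shows "H +>\<^bsub>M\<^esub> x = H +>\<^bsub>M\<^esub> y"
proof -
  interpret M: module R M by fact
  interpret H: abelian_subgroup H M by (rule M.submodule_abelian_subgroup) fact
  have "x \<in> H +>\<^bsub>M\<^esub> y" 
  proof -
    have "(x \<ominus>\<^bsub>M\<^esub> y) \<oplus>\<^bsub>M\<^esub> y = x" using assms by (simp add: a_minus_def M.M.a_assoc M.M.l_neg)
    then show ?thesis using assms(5) by (auto simp: a_r_coset_def' intro!: bexI[of _ "x \<ominus>\<^bsub>M\<^esub> y"])
  qed
  then show ?thesis using H.a_repr_independence' assms by metis
qed

context bilin
begin

abbreviation "F \<equiv> free_module R (carrier M \<times> carrier N)"
abbreviation "L \<equiv> lin_ext R P (\<lambda>(m, n). f m n)"
abbreviation "K \<equiv> tensor_ker R M N"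

lemma funf: "(\<lambda>(m, n). f m n) \<in> carrier M \<times> carrier N \<rightarrow> carrier P"
  using closed by auto

lemma L_lin: "lin_map R F P L"
  by (rule P.lin_ext_lin[OF funf])

lemma L_e: "m \<in> carrier M \<Longrightarrow> n \<in> carrier N \<Longrightarrow> L (single R (m, n) \<one>) = f m n"
  using P.lin_ext_single[OF funf, of "(m, n)" \<one>] closed by auto

lemma K_sub: "submodule K R F"
  by (rule M.tensor_ker_submodule) (rule N.module_axioms)

lemma K_ker: "K \<subseteq> {u \<in> carrier F. L u = \<zero>\<^bsub>P\<^esub>}"
  unfolding tensor_ker_def
proof (rule submodule_span_least)
  interpret L: lin_map R F P L by (rule L_lin)
  show "submodule {u \<in> carrier F. L u = \<zero>\<^bsub>P\<^esub>} R F" by (rule L.ker)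
  have e: "single R (m, n) \<one> \<in> carrier F" if "m \<in> carrier M" "n \<in> carrier N" for m n
    using that by (simp add: M.R.single_closed)
  have "L u = \<zero>\<^bsub>P\<^esub>" if "u \<in> tensor_rels R M N" for u
    using that unfolding tensor_rels_def Let_def
    by (auto simp: e L_e L.diff L.add L.smult add1 add2 smult1 smult2 closed P.M.r_neg[folded a_minus_def])
  with M.tensor_rels_subset[OF N.module_axioms]
  show "tensor_rels R M N \<subseteq> {u \<in> carrier F. L u = \<zero>\<^bsub>P\<^esub>}" by blast
qed

lemma tensor_lift_coset:
  assumes u: "u \<in> carrier F"
  shows "tensor_lift R P f (K +>\<^bsub>F\<^esub> u) = L u"
proof -
  interpret L: lin_map R F P L by (rule L_lin)
  interpret K: abelian_subgroup K F by (rule L.M.submodule_abelian_subgroup[OF K_sub])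
  have "L v = L u" if v: "v \<in> K +>\<^bsub>F\<^esub> u" for v
  proof -
    obtain h where h: "h \<in> K" "v = h \<oplus>\<^bsub>F\<^esub> u" using v by (auto simp: a_r_coset_def')
    then have "h \<in> carrier F" "L h = \<zero>\<^bsub>P\<^esub>" using K_ker by auto
    then show ?thesis using h u L.add[of h u] L.closed[of u] by simp
  qed
  moreover have "u \<in> K +>\<^bsub>F\<^esub> u" by (rule K.a_rcos_self[OF u])
  ultimately have "L ` (K +>\<^bsub>F\<^esub> u) = {L u}" by blast
  then show ?thesis by (simp add: tensor_lift_def)
qed

lemma tensor_lift_lin: "lin_map R (tensor R M N) P (tensor_lift R P f)"
proof -
  interpret L: lin_map R F P L by (rule L_lin)
  have T: "module R (tensor R M N)" by (rule M.tensor_module[OF N.module_axioms])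
  show ?thesis
  proof (intro lin_map.intro lin_map_axioms.intro T P.module_axioms)
    fix x assume "x \<in> carrier (tensor R M N)"
    then obtain u where u: "u \<in> carrier F" "x = K +>\<^bsub>F\<^esub> u" by (auto simp: tensor_def quot_carrier)
    show "tensor_lift R P f x \<in> carrier P" using u L.closed by (simp add: tensor_lift_coset)
    { fix y assume "y \<in> carrier (tensor R M N)"
      then obtain v where v: "v \<in> carrier F" "y = K +>\<^bsub>F\<^esub> v" by (auto simp: tensor_def quot_carrier)
      show "tensor_lift R P f (x \<oplus>\<^bsub>tensor R M N\<^esub> y) = tensor_lift R P f x \<oplus>\<^bsub>P\<^esub> tensor_lift R P f y"
        using u v L.add by (simp add: tensor_lift_coset tensor_def L.M.quot_add[OF K_sub]) }
  next
    fix r x assume r: "r \<in> carrier R" and "x \<in> carrier (tensor R M N)"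
    then obtain u where u: "u \<in> carrier F" "x = K +>\<^bsub>F\<^esub> u" by (auto simp: tensor_def quot_carrier)
    show "tensor_lift R P f (r \<odot>\<^bsub>tensor R M N\<^esub> x) = r \<odot>\<^bsub>P\<^esub> tensor_lift R P f x"
      using u r L.smult by (simp add: tensor_lift_coset tensor_def L.M.quot_smult[OF K_sub])
  qed
qed

lemma tensor_lift_pure:
  assumes "m \<in> carrier M" "n \<in> carrier N"
  shows "tensor_lift R P f (pure_tensor R M N m n) = f m n"
  unfolding pure_tensor_def
  using assms by (simp add: tensor_lift_coset M.R.single_closed L_e)

end

context module
begin

lemma tensor_induct [consumes 2, case_names zero add]:
  assumes N: "module R N" and x: "x \<in> carrier (tensor R M N)"
    and z: "Q \<zero>\<^bsub>tensor R M N\<^esub>"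
    and a: "\<And>r m n v. r \<in> carrier R \<Longrightarrow> m \<in> carrier M \<Longrightarrow> n \<in> carrier N \<Longrightarrow> v \<in> carrier (tensor R M N) \<Longrightarrow> Q v \<Longrightarrow>
       Q (r \<odot>\<^bsub>tensor R M N\<^esub> pure_tensor R M N m n \<oplus>\<^bsub>tensor R M N\<^esub> v)"
  shows "Q x"
proof -
  let ?F = "free_module R (carrier M \<times> carrier N)" and ?K = "tensor_ker R M N"
  interpret N: module R N by fact
  interpret F: module R ?F by (rule R.free_module_module)
  have K: "submodule ?K R ?F" by (rule tensor_ker_submodule[OF N])
  interpret K: abelian_subgroup ?K ?F by (rule F.submodule_abelian_subgroup[OF K])
  obtain u where u: "u \<in> carrier ?F" "x = ?K +>\<^bsub>?F\<^esub> u" using x by (auto simp: tensor_def quot_carrier)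
  from u(1) have "Q (?K +>\<^bsub>?F\<^esub> u)"
  proof (induction rule: R.free_module_induct)
    case zero
    have "\<zero>\<^bsub>tensor R M N\<^esub> = ?K +>\<^bsub>?F\<^esub> \<zero>\<^bsub>?F\<^esub>"
      using K.a_subset by (simp add: tensor_def quot_module_def)
    then show ?case using z by simp
  next
    case (add r s v)
    obtain m n where s: "s = (m, n)" "m \<in> carrier M" "n \<in> carrier N" using add by auto
    have e: "single R s \<one> \<in> carrier ?F" using add by (simp add: R.single_closed)
    have 1: "single R s r = r \<odot>\<^bsub>?F\<^esub> single R s \<one>" using add(1) by (auto simp: fm_simps single_def)
    have "?K +>\<^bsub>?F\<^esub> (single R s r \<oplus>\<^bsub>?F\<^esub> v) =
       r \<odot>\<^bsub>tensor R M N\<^esub> pure_tensor R M N m n \<oplus>\<^bsub>tensor R M N\<^esub> (?K +>\<^bsub>?F\<^esub> v)"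
      unfolding 1 tensor_def pure_tensor_def s(1)[symmetric]
      using add e by (simp add: F.quot_smult[OF K] F.quot_add[OF K])
    moreover have "?K +>\<^bsub>?F\<^esub> v \<in> carrier (tensor R M N)"
      using add by (auto simp: tensor_def quot_carrier)
    ultimately show ?case using a[OF add(1) s(2,3)] add by simp
  qed
  then show ?thesis using u by simp
qed

lemma pure_bilin:
  assumes N: "module R N"
  shows "bilin R M N (tensor R M N) (pure_tensor R M N)"
proof -
  let ?F = "free_module R (carrier M \<times> carrier N)" and ?K = "tensor_ker R M N"
  interpret N: module R N by fact
  interpret F: module R ?F by (rule R.free_module_module)
  have K: "submodule ?K R ?F" by (rule tensor_ker_submodule[OF N])
  have r: "u \<in> ?K" if "u \<in> tensor_rels R M N" for u
    unfolding tensor_ker_def using that by (rule subsetD[OF submodule_span_superset])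
  have e: "single R (m, n) \<one> \<in> carrier ?F" if "m \<in> carrier M" "n \<in> carrier N" for m n
    using that by (simp add: R.single_closed)
  let ?e = "\<lambda>m n. single R (m, n) \<one>"
  have rel1: "?e (m \<oplus>\<^bsub>M\<^esub> m') n \<ominus>\<^bsub>?F\<^esub> (?e m n \<oplus>\<^bsub>?F\<^esub> ?e m' n) \<in> tensor_rels R M N"
    if "m \<in> carrier M" "m' \<in> carrier M" "n \<in> carrier N" for m m' n
    unfolding tensor_rels_def Let_def using that by blast
  have rel2: "?e m (n \<oplus>\<^bsub>N\<^esub> n') \<ominus>\<^bsub>?F\<^esub> (?e m n \<oplus>\<^bsub>?F\<^esub> ?e m n') \<in> tensor_rels R M N"
    if "m \<in> carrier M" "n \<in> carrier N" "n' \<in> carrier N" for m n n'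
    unfolding tensor_rels_def Let_def using that by blast
  have rel3: "?e (t \<odot>\<^bsub>M\<^esub> m) n \<ominus>\<^bsub>?F\<^esub> t \<odot>\<^bsub>?F\<^esub> ?e m n \<in> tensor_rels R M N"
    if "t \<in> carrier R" "m \<in> carrier M" "n \<in> carrier N" for m n t
    unfolding tensor_rels_def Let_def using that by blast
  have rel4: "?e m (t \<odot>\<^bsub>N\<^esub> n) \<ominus>\<^bsub>?F\<^esub> t \<odot>\<^bsub>?F\<^esub> ?e m n \<in> tensor_rels R M N"
    if "t \<in> carrier R" "m \<in> carrier M" "n \<in> carrier N" for m n t
    unfolding tensor_rels_def Let_def using that by blast
  note cong = R.submodule_mem_cong[OF F.module_axioms K]
  show ?thesis
  proof (intro bilin.intro bilin_axioms.intro module_axioms N tensor_module)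
    show "pure_tensor R M N x y \<in> carrier (tensor R M N)" if "x \<in> carrier M" "y \<in> carrier N" for x y
      using that e by (auto simp: tensor_def pure_tensor_def quot_carrier)
    fix x y assume x: "x \<in> carrier M" and y: "y \<in> carrier N"
    { fix x' assume x': "x' \<in> carrier M"
      show "pure_tensor R M N (x \<oplus>\<^bsub>M\<^esub> x') y = pure_tensor R M N x y \<oplus>\<^bsub>tensor R M N\<^esub> pure_tensor R M N x' y"
        unfolding pure_tensor_def tensor_def F.quot_add[OF K e[OF x y] e[OF x' y]]
        by (rule cong) (use x x' y e r[OF rel1[OF x x' y]] in simp_all) }
  next
    fix x y assume x: "x \<in> carrier M" and y: "y \<in> carrier N"
    { fix y' assume y': "y' \<in> carrier N"
      show "pure_tensor R M N x (y \<oplus>\<^bsub>N\<^esub> y') = pure_tensor R M N x y \<oplus>\<^bsub>tensor R M N\<^esub> pure_tensor R M N x y'"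
        unfolding pure_tensor_def tensor_def F.quot_add[OF K e[OF x y] e[OF x y']]
        by (rule cong) (use x y' y e r[OF rel2[OF x y y']] in simp_all) }
  next
    fix t x y assume x: "x \<in> carrier M" and y: "y \<in> carrier N" and t: "t \<in> carrier R"
    show "pure_tensor R M N (t \<odot>\<^bsub>M\<^esub> x) y = t \<odot>\<^bsub>tensor R M N\<^esub> pure_tensor R M N x y"
        unfolding pure_tensor_def tensor_def F.quot_smult[OF K t e[OF x y]]
        by (rule cong) (use x t y e r[OF rel3[OF t x y]] in simp_all)
    show "pure_tensor R M N x (t \<odot>\<^bsub>N\<^esub> y) = t \<odot>\<^bsub>tensor R M N\<^esub> pure_tensor R M N x y"
        unfolding pure_tensor_def tensor_def F.quot_smult[OF K t e[OF x y]]
        by (rule cong) (use x t y e r[OF rel4[OF t x y]] in simp_all)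
  qed
qed

lemma tensor_eqI:
  assumes N: "module R N" and f: "lin_map R (tensor R M N) P f" and g: "lin_map R (tensor R M N) P g"
    and eq: "\<And>m n. m \<in> carrier M \<Longrightarrow> n \<in> carrier N \<Longrightarrow> f (pure_tensor R M N m n) = g (pure_tensor R M N m n)"
    and x: "x \<in> carrier (tensor R M N)"
  shows "f x = g x"
proof -
  interpret f: lin_map R "tensor R M N" P f by fact
  interpret g: lin_map R "tensor R M N" P g by fact
  interpret p: bilin R M N "tensor R M N" "pure_tensor R M N" by (rule pure_bilin[OF N])
  from N x show ?thesis
    by (induction rule: tensor_induct) (simp_all add: f.zero g.zero f.add g.add f.smult g.smult p.closed eq)
qed

end

lemma lin_mapI':
  assumes "module R M" "module R N" "\<And>x. x \<in> carrier M \<Longrightarrow> f x \<in> carrier N"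
    "\<And>x y. x \<in> carrier M \<Longrightarrow> y \<in> carrier M \<Longrightarrow> f (x \<oplus>\<^bsub>M\<^esub> y) = f x \<oplus>\<^bsub>N\<^esub> f y"
    "\<And>r x. r \<in> carrier R \<Longrightarrow> x \<in> carrier M \<Longrightarrow> f (r \<odot>\<^bsub>M\<^esub> x) = r \<odot>\<^bsub>N\<^esub> f x"
  shows "lin_map R M N f"
  using assms by (simp add: lin_map_def lin_map_axioms_def)

subsection \<open>The tensor product of algebras\<close>

locale two_alg = A: algebra R A + B: algebra R B for R (structure) and A and B
begin

abbreviation "T \<equiv> tensor R A B"
abbreviation "TA \<equiv> tensor_algebra R A B"
abbreviation "pt \<equiv> pure_tensor R A B"
abbreviation "inner a b \<equiv> tensor_lift R T (\<lambda>c d. pt (a \<otimes>\<^bsub>A\<^esub> c) (b \<otimes>\<^bsub>B\<^esub> d))"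

lemma Tmod: "module R T"
  by (rule A.tensor_module) (rule B.module_axioms)

sublocale p: bilin R A B T pt
  by (rule A.pure_bilin) (rule B.module_axioms)

lemma a2: "r \<in> carrier R \<Longrightarrow> x \<in> carrier A \<Longrightarrow> y \<in> carrier A \<Longrightarrow> x \<otimes>\<^bsub>A\<^esub> (r \<odot>\<^bsub>A\<^esub> y) = r \<odot>\<^bsub>A\<^esub> (x \<otimes>\<^bsub>A\<^esub> y)"
  by (metis A.m_comm A.smult_assoc2 A.smult_closed)
lemma b2: "r \<in> carrier R \<Longrightarrow> x \<in> carrier B \<Longrightarrow> y \<in> carrier B \<Longrightarrow> x \<otimes>\<^bsub>B\<^esub> (r \<odot>\<^bsub>B\<^esub> y) = r \<odot>\<^bsub>B\<^esub> (x \<otimes>\<^bsub>B\<^esub> y)"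
  by (metis B.m_comm B.smult_assoc2 B.smult_closed)

lemma inner_bilin: "a \<in> carrier A \<Longrightarrow> b \<in> carrier B \<Longrightarrow>
    bilin R A B T (\<lambda>c d. pt (a \<otimes>\<^bsub>A\<^esub> c) (b \<otimes>\<^bsub>B\<^esub> d))"
  by (intro bilin.intro bilin_axioms.intro A.module_axioms B.module_axioms Tmod)
    (auto simp: p.closed p.add1 p.add2 p.smult1 p.smult2 A.r_distr B.r_distr a2 b2)

lemma inner_lin: "a \<in> carrier A \<Longrightarrow> b \<in> carrier B \<Longrightarrow> lin_map R T T (inner a b)"
  by (rule bilin.tensor_lift_lin[OF inner_bilin])

lemma inner_pure: "a \<in> carrier A \<Longrightarrow> b \<in> carrier B \<Longrightarrow> c \<in> carrier A \<Longrightarrow> d \<in> carrier B \<Longrightarrow>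
    inner a b (pt c d) = pt (a \<otimes>\<^bsub>A\<^esub> c) (b \<otimes>\<^bsub>B\<^esub> d)"
  by (rule bilin.tensor_lift_pure[OF inner_bilin])

lemma outer_bilin: assumes Y: "Y \<in> carrier T" shows "bilin R A B T (\<lambda>a b. inner a b Y)"
proof (intro bilin.intro bilin_axioms.intro A.module_axioms B.module_axioms Tmod)
  show "inner x y Y \<in> carrier T" if "x \<in> carrier A" "y \<in> carrier B" for x y
    using lin_map.closed[OF inner_lin[OF that] Y] .
  note cl = lin_map.closed[OF inner_lin]
  note z = lin_map.zero[OF inner_lin]
  note ad = lin_map.add[OF inner_lin]
  note sm = lin_map.smult[OF inner_lin]
  have ac: "(r \<odot>\<^bsub>T\<^esub> (u \<oplus>\<^bsub>T\<^esub> v)) \<oplus>\<^bsub>T\<^esub> (u' \<oplus>\<^bsub>T\<^esub> v') = (r \<odot>\<^bsub>T\<^esub> u \<oplus>\<^bsub>T\<^esub> u') \<oplus>\<^bsub>T\<^esub> (r \<odot>\<^bsub>T\<^esub> v \<oplus>\<^bsub>T\<^esub> v')"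
    if "r \<in> carrier R" "u \<in> carrier T" "v \<in> carrier T" "u' \<in> carrier T" "v' \<in> carrier T" for r u v u' v'
    using that by (simp add: p.P.smult_r_distr p.P.M.a_ac)
  have sc: "r \<odot>\<^bsub>T\<^esub> (t \<odot>\<^bsub>T\<^esub> u) = t \<odot>\<^bsub>T\<^esub> (r \<odot>\<^bsub>T\<^esub> u)" if "r \<in> carrier R" "t \<in> carrier R" "u \<in> carrier T" for r t u
    using that by (metis p.P.smult_assoc1 A.R.m_comm)
  show "inner (x \<oplus>\<^bsub>A\<^esub> x') y Y = inner x y Y \<oplus>\<^bsub>T\<^esub> inner x' y Y"
    if h: "x \<in> carrier A" "x' \<in> carrier A" "y \<in> carrier B" for x x' y
  proof (rule A.tensor_eqI[OF B.module_axioms _ _ _ Y])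
    show "lin_map R T T (inner (x \<oplus>\<^bsub>A\<^esub> x') y)" using h by (intro inner_lin) auto
    show "lin_map R T T (\<lambda>Y. inner x y Y \<oplus>\<^bsub>T\<^esub> inner x' y Y)"
      by (rule lin_mapI'[OF Tmod Tmod])
         (use h in \<open>auto simp: cl ad sm p.P.smult_r_distr p.P.M.a_ac\<close>)
  qed (use h in \<open>auto simp: inner_pure A.l_distr p.add1\<close>)
  show "inner x (y \<oplus>\<^bsub>B\<^esub> y') Y = inner x y Y \<oplus>\<^bsub>T\<^esub> inner x y' Y"
    if h: "x \<in> carrier A" "y \<in> carrier B" "y' \<in> carrier B" for x y y'
  proof (rule A.tensor_eqI[OF B.module_axioms _ _ _ Y])
    show "lin_map R T T (inner x (y \<oplus>\<^bsub>B\<^esub> y'))" using h by (intro inner_lin) auto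
    show "lin_map R T T (\<lambda>Y. inner x y Y \<oplus>\<^bsub>T\<^esub> inner x y' Y)"
      by (rule lin_mapI'[OF Tmod Tmod])
         (use h in \<open>auto simp: cl ad sm p.P.smult_r_distr p.P.M.a_ac\<close>)
  qed (use h in \<open>auto simp: inner_pure B.l_distr p.add2\<close>)
  have r_lin: "lin_map R T T (\<lambda>Y. r \<odot>\<^bsub>T\<^esub> inner x y Y)" if h: "r \<in> carrier R" "x \<in> carrier A" "y \<in> carrier B" for r x y
    by (rule lin_mapI'[OF Tmod Tmod])
       (use h in \<open>auto simp: cl ad sm p.P.smult_r_distr sc\<close>)
  show "inner (r \<odot>\<^bsub>A\<^esub> x) y Y = r \<odot>\<^bsub>T\<^esub> inner x y Y"
    if h: "r \<in> carrier R" "x \<in> carrier A" "y \<in> carrier B" for r x y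
  proof (rule A.tensor_eqI[OF B.module_axioms _ _ _ Y])
    show "lin_map R T T (inner (r \<odot>\<^bsub>A\<^esub> x) y)" using h by (intro inner_lin) auto
    show "lin_map R T T (\<lambda>Y. r \<odot>\<^bsub>T\<^esub> inner x y Y)" by (rule r_lin[OF h])
  qed (use h in \<open>auto simp: inner_pure A.smult_assoc2 p.smult1\<close>)
  show "inner x (r \<odot>\<^bsub>B\<^esub> y) Y = r \<odot>\<^bsub>T\<^esub> inner x y Y"
    if h: "r \<in> carrier R" "x \<in> carrier A" "y \<in> carrier B" for r x y
  proof (rule A.tensor_eqI[OF B.module_axioms _ _ _ Y])
    show "lin_map R T T (inner x (r \<odot>\<^bsub>B\<^esub> y))" using h by (intro inner_lin) auto
    show "lin_map R T T (\<lambda>Y. r \<odot>\<^bsub>T\<^esub> inner x y Y)" by (rule r_lin[OF h])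
  qed (use h in \<open>auto simp: inner_pure B.smult_assoc2 p.smult2\<close>)
qed

abbreviation "tm X Y \<equiv> tensor_lift R T (\<lambda>a b. inner a b Y) X"

lemma TA_simps: "carrier TA = carrier T" "\<zero>\<^bsub>TA\<^esub> = \<zero>\<^bsub>T\<^esub>" "X \<oplus>\<^bsub>TA\<^esub> Y = X \<oplus>\<^bsub>T\<^esub> Y" "r \<odot>\<^bsub>TA\<^esub> X = r \<odot>\<^bsub>T\<^esub> X"
   "X \<otimes>\<^bsub>TA\<^esub> Y = tm X Y" "\<one>\<^bsub>TA\<^esub> = pt \<one>\<^bsub>A\<^esub> \<one>\<^bsub>B\<^esub>"
  by (simp_all add: tensor_algebra_def Let_def)

lemma tm_lin1: "Y \<in> carrier T \<Longrightarrow> lin_map R T T (\<lambda>X. tm X Y)"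
  by (rule bilin.tensor_lift_lin[OF outer_bilin])

lemma tm_pure1: "Y \<in> carrier T \<Longrightarrow> a \<in> carrier A \<Longrightarrow> b \<in> carrier B \<Longrightarrow> tm (pt a b) Y = inner a b Y"
  by (rule bilin.tensor_lift_pure[OF outer_bilin])

lemma tm_pure: "a \<in> carrier A \<Longrightarrow> b \<in> carrier B \<Longrightarrow> c \<in> carrier A \<Longrightarrow> d \<in> carrier B \<Longrightarrow>
    tm (pt a b) (pt c d) = pt (a \<otimes>\<^bsub>A\<^esub> c) (b \<otimes>\<^bsub>B\<^esub> d)"
  by (simp add: tm_pure1 inner_pure p.closed)

lemma tm_closed: "X \<in> carrier T \<Longrightarrow> Y \<in> carrier T \<Longrightarrow> tm X Y \<in> carrier T"
  by (rule lin_map.closed[OF tm_lin1])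

lemma tm_pure_comm:
  assumes "a \<in> carrier A" "b \<in> carrier B" "Y \<in> carrier T"
  shows "tm (pt a b) Y = tm Y (pt a b)"
proof -
  have "inner a b Y = tm Y (pt a b)"
    by (rule A.tensor_eqI[OF B.module_axioms inner_lin[OF assms(1,2)] tm_lin1 _ assms(3)])
       (use assms in \<open>auto simp: p.closed inner_pure tm_pure A.m_comm B.m_comm\<close>)
  then show ?thesis using assms by (simp add: tm_pure1)
qed

lemma tm_lin2p: "a \<in> carrier A \<Longrightarrow> b \<in> carrier B \<Longrightarrow> lin_map R T T (\<lambda>Y. tm (pt a b) Y)"
  using inner_lin[of a b] by (simp add: lin_map_def lin_map_axioms_def tm_pure1)

lemma tm_lin2: assumes "X \<in> carrier T" shows "lin_map R T T (tm X)"
proof -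
  from B.module_axioms assms have "(\<forall>y\<in>carrier T. \<forall>z\<in>carrier T. tm X (y \<oplus>\<^bsub>T\<^esub> z) = tm X y \<oplus>\<^bsub>T\<^esub> tm X z) \<and>
     (\<forall>r\<in>carrier R. \<forall>y\<in>carrier T. tm X (r \<odot>\<^bsub>T\<^esub> y) = r \<odot>\<^bsub>T\<^esub> tm X y)"
  proof (induction rule: A.tensor_induct)
    case zero
    then show ?case by (simp add: lin_map.zero[OF tm_lin1])
  next
    case (add r m n v)
    have sc: "r \<odot>\<^bsub>T\<^esub> (t \<odot>\<^bsub>T\<^esub> u) = t \<odot>\<^bsub>T\<^esub> (r \<odot>\<^bsub>T\<^esub> u)" if "r \<in> carrier R" "t \<in> carrier R" "u \<in> carrier T" for r t u
      using that by (metis p.P.smult_assoc1 A.R.m_comm)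
    from add show ?case
      by (simp add: lin_map.add[OF tm_lin1] lin_map.smult[OF tm_lin1] p.closed tm_closed
         lin_map.add[OF tm_lin2p] lin_map.smult[OF tm_lin2p] p.P.smult_r_distr p.P.M.a_ac sc)
  qed
  then show ?thesis using assms tm_closed by (intro lin_mapI'[OF Tmod Tmod]) auto
qed

lemma tm_comm: assumes X: "X \<in> carrier T" and Y: "Y \<in> carrier T" shows "tm X Y = tm Y X"
  by (rule A.tensor_eqI[OF B.module_axioms tm_lin1 tm_lin2 _ X]) (use assms tm_pure_comm in auto)

lemma lin_comp: "lin_map R T T f \<Longrightarrow> lin_map R T T g \<Longrightarrow> lin_map R T T (\<lambda>x. f (g x))"
  by (rule lin_mapI'[OF Tmod Tmod]) (simp_all add: lin_map.closed lin_map.add lin_map.smult)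

lemma tm_assoc: assumes X: "X \<in> carrier T" and Y: "Y \<in> carrier T" and Z: "Z \<in> carrier T"
  shows "tm (tm X Y) Z = tm X (tm Y Z)"
proof -
  have 1: "tm (tm (pt a b) (pt c d)) Z = tm (pt a b) (tm (pt c d) Z)"
    if h: "a \<in> carrier A" "b \<in> carrier B" "c \<in> carrier A" "d \<in> carrier B" for a b c d
    by (rule A.tensor_eqI[OF B.module_axioms tm_lin2 lin_comp[OF tm_lin2 tm_lin2] _ Z])
       (use h in \<open>auto simp: p.closed tm_closed tm_pure A.m_assoc B.m_assoc\<close>)
  have 2: "tm (tm (pt a b) Y) Z = tm (pt a b) (tm Y Z)"
    if h: "a \<in> carrier A" "b \<in> carrier B" for a b
    by (rule A.tensor_eqI[OF B.module_axioms lin_comp[OF tm_lin1 tm_lin2] lin_comp[OF tm_lin2 tm_lin1] _ Y])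
       (use h Z 1 in \<open>auto simp: p.closed\<close>)
  show ?thesis
    by (rule A.tensor_eqI[OF B.module_axioms lin_comp[OF tm_lin1 tm_lin1] tm_lin1 _ X])
       (use Y Z 2 tm_closed in auto)
qed

lemma lin_id: "lin_map R T T (\<lambda>x. x)"
  by (rule lin_mapI'[OF Tmod Tmod]) auto

lemma tm_one: assumes X: "X \<in> carrier T" shows "tm (pt \<one>\<^bsub>A\<^esub> \<one>\<^bsub>B\<^esub>) X = X"
  by (rule A.tensor_eqI[OF B.module_axioms tm_lin2 lin_id _ X]) (auto simp: p.closed tm_pure)

lemma tensor_algebra_algebra: "algebra R TA"
proof (rule algebraI)
  show "cring R" by (rule A.R_cring)
  show "cring TA"
  proof (rule cringI)
    show "abelian_group TA"
      by (rule abelian_groupI) (auto simp: TA_simps p.P.M.a_ac intro: p.P.M.l_neg)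
    show "comm_monoid TA"
      apply (rule comm_monoidI; unfold TA_simps)
          apply (erule (1) tm_closed)
         apply (simp add: p.closed)
        apply (erule (2) tm_assoc)
       apply (erule tm_one)
      apply (erule (1) tm_comm)
      done
    show "(x \<oplus>\<^bsub>TA\<^esub> y) \<otimes>\<^bsub>TA\<^esub> z = x \<otimes>\<^bsub>TA\<^esub> z \<oplus>\<^bsub>TA\<^esub> y \<otimes>\<^bsub>TA\<^esub> z"
      if "x \<in> carrier TA" "y \<in> carrier TA" "z \<in> carrier TA" for x y z
      using that by (simp add: TA_simps lin_map.add[OF tm_lin1])
  qed
qed (simp_all add: TA_simps p.P.smult_l_distr p.P.smult_r_distr p.P.smult_assoc1 lin_map.smult[OF tm_lin1])

end

context algebra
begin

lemma mult_bilin: "bilin R M M M (\<lambda>a b. a \<otimes>\<^bsub>M\<^esub> b)"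
proof -
  interpret AA: two_alg R M M by (intro two_alg.intro algebra_axioms)
  show ?thesis
  by (intro bilin.intro bilin_axioms.intro module_axioms)
    (simp_all add: l_distr r_distr smult_assoc2 AA.a2)
qed

lemma mult_map_hom: "mult_map R M \<in> ring_hom (tensor_algebra R M M) M"
proof -
  interpret AA: two_alg R M M by (intro two_alg.intro algebra_axioms)
  interpret b: bilin R M M M "\<lambda>a b. a \<otimes>\<^bsub>M\<^esub> b" by (rule mult_bilin)
  interpret l: lin_map R AA.T M "mult_map R M" unfolding mult_map_def by (rule b.tensor_lift_lin)
  have pure: "mult_map R M (AA.pt a b) = a \<otimes>\<^bsub>M\<^esub> b" if "a \<in> carrier M" "b \<in> carrier M" for a b
    unfolding mult_map_def using that by (rule b.tensor_lift_pure)
  have comp: "lin_map R AA.T M (\<lambda>x. mult_map R M (f x))" if f: "lin_map R AA.T AA.T f" for f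
    by (rule lin_mapI'[OF AA.Tmod module_axioms])
       (simp_all add: l.closed l.add l.smult lin_map.closed[OF f] lin_map.add[OF f] lin_map.smult[OF f])
  have m1: "lin_map R AA.T M (\<lambda>x. mult_map R M x \<otimes>\<^bsub>M\<^esub> y)" if "y \<in> carrier M" for y
    by (rule lin_mapI'[OF AA.Tmod module_axioms]) (use that in \<open>simp_all add: l.closed l.add l.smult l_distr smult_assoc2\<close>)
  have m2: "lin_map R AA.T M (\<lambda>x. y \<otimes>\<^bsub>M\<^esub> mult_map R M x)" if "y \<in> carrier M" for y
    by (rule lin_mapI'[OF AA.Tmod module_axioms]) (use that in \<open>simp_all add: l.closed l.add l.smult r_distr AA.a2\<close>)
  have 1: "mult_map R M (AA.tm (AA.pt a b) Y) = mult_map R M (AA.pt a b) \<otimes>\<^bsub>M\<^esub> mult_map R M Y"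
    if h: "a \<in> carrier M" "b \<in> carrier M" and Y: "Y \<in> carrier AA.T" for a b Y
    by (rule tensor_eqI[OF module_axioms comp[OF AA.tm_lin2] m2 _ Y])
       (use h in \<open>auto simp: AA.p.closed AA.tm_pure pure l.closed m_ac\<close>)
  have 2: "mult_map R M (AA.tm X Y) = mult_map R M X \<otimes>\<^bsub>M\<^esub> mult_map R M Y"
    if X: "X \<in> carrier AA.T" and Y: "Y \<in> carrier AA.T" for X Y
    by (rule tensor_eqI[OF module_axioms comp[OF AA.tm_lin1] m1 _ X])
       (use Y 1 l.closed in auto)
  show ?thesis
    by (rule ring_hom_memI) (simp_all add: AA.TA_simps l.closed l.add 2 pure)
qed

end

lemma module_via_module:
  assumes R: "cring R" and B: "cring B" and h: "h \<in> ring_hom R B"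
  shows "module R (module_via h B)"
proof -
  interpret R: cring R by fact
  interpret B: cring B by fact
  show ?thesis
  proof (rule moduleI)
    show "abelian_group (module_via h B)"
      by (rule abelian_groupI) (auto simp: module_via_def B.a_ac intro: B.l_neg)
  qed (use h in \<open>auto simp: module_via_def R ring_hom_closed ring_hom_add ring_hom_mult ring_hom_one B.l_distr B.r_distr B.m_assoc\<close>)
qed

lemma (in algebra) HH_base_module:
  "cring (tensor_algebra R M M)"
  "module (tensor_algebra R M M) (module_via (mult_map R M) M)"
proof -
  interpret AA: two_alg R M M by (intro two_alg.intro algebra_axioms)
  show 1: "cring (tensor_algebra R M M)"
    by (rule algebra.M_cring[OF AA.tensor_algebra_algebra])
  show "module (tensor_algebra R M M) (module_via (mult_map R M) M)"
    by (rule module_via_module[OF 1 M_cring mult_map_hom])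
qed

end

(* Let R = A \<otimes> A, let I be the kernel of the multiplication map and x_a = a \<otimes> 1 - 1 \<otimes> a.
   The vanishing of Tor_1(R/I, R/I) = I/I^2 means that every x_a lies in I^2.  A transcendental a would
   stay transcendental in some domain A/P, whose fraction field has, in characteristic 0, a derivation
   not vanishing at a; this is impossible, since derivations kill I^2.  (An element of I^2 involves only
   finitely many instances of the Leibniz rule, so denominators can be cleared and no fraction
   field is needed.)  So A is algebraic over k, and being reduced it is von Neumann regular.
   If f(a) = 0, then x_a is killed by a divided difference of f, which is
   congruent to f'(a) modulo I; splitting A by the idempotent generating (f'(a)) and inducting on the
   degree of f gives y in I with y x_a = x_a.  The elements with this property form an ideal, so every x in I
   satisfies x = y x for some y in I, that is, R/I is flat over R. *)
theory Submission
  imports "HOL-Algebra.Ring_Divisibility" "HOL-Algebra.Subrings" "HOL-Algebra.Ideal_Product" Defs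
begin

section \<open>Tor over a quotient ring\<close>

text \<open>Both halves work with elements rather than with differentials or flat modules. The
  pairing that takes \<open>u \<otimes> v\<close> to \<open>u \<delta>(v)\<close> exists on the
  whole tensor square only if \<delta> is defined on the whole domain; but without a fraction field,
  a derivation is only constructed on a ring generated by finitely many elements over the scalars,
  and only up to a factor. The way out is a hybrid: \<delta> obeys the Leibniz rule on a prescribed
  finite set and is merely linear over the scalars elsewhere. Linearity is enough for the pairing to
  exist. The ring on which \<delta> is already defined is not a field, so there is no Euclidean
  division by a minimal polynomial of the next element. Consistency of the extension is obtained by
  cross-multiplying constant terms and cancelling in the domain. Characteristic 0 serves the same
  fact in both halves: a nonconstant polynomial has a nonzero derivative. It makes
  \<open>p'(b)\<close> nonzero for a shortest \<open>p\<close> with root \<open>b\<close>, and it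
  lets \<open>f'\<close> replace \<open>f\<close> on the part of the algebra where
  \<open>f'(a)\<close> vanishes.\<close>

lemma homology_trivial_iff:
  assumes d1: "lin_map R (C (Suc (Suc n))) (C (Suc n)) (d (Suc n))"
    and d0: "lin_map R (C (Suc n)) (C n) (d n)"
    and dd: "\<And>x. x \<in> carrier (C (Suc (Suc n))) \<Longrightarrow> d n (d (Suc n) x) = \<zero>\<^bsub>C n\<^esub>"
  shows "carrier (homology C d (Suc n)) = {\<zero>\<^bsub>homology C d (Suc n)\<^esub>} \<longleftrightarrow>
    (\<forall>z\<in>carrier (C (Suc n)). d n z = \<zero>\<^bsub>C n\<^esub> \<longrightarrow> z \<in> d (Suc n) ` carrier (C (Suc (Suc n))))"
proof -
  interpret d1: lin_map R "C (Suc (Suc n))" "C (Suc n)" "d (Suc n)" by fact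
  interpret d0: lin_map R "C (Suc n)" "C n" "d n" by fact
  define N where "N = d (Suc n) ` carrier (C (Suc (Suc n)))"
  define Z where "Z = {x \<in> carrier (C (Suc n)). d n x = \<zero>\<^bsub>C n\<^esub>}"
  have NS: "submodule N R (C (Suc n))"
    unfolding N_def by (rule d1.im) (rule d1.M.carrier_is_submodule)
  interpret N: abelian_subgroup N "C (Suc n)" by (rule d1.N.submodule_abelian_subgroup[OF NS])
  have NZ: "N \<subseteq> Z" using dd d1.closed by (auto simp: N_def Z_def)
  have zero: "\<zero>\<^bsub>homology C d (Suc n)\<^esub> = N"
    by (simp add: homology_def quot_module_def N_def)
  have car: "carrier (homology C d (Suc n)) = (\<lambda>x. N +>\<^bsub>C (Suc n)\<^esub> x) ` Z"
    by (auto simp: homology_def quot_module_def A_RCOSETS_def' a_r_coset_def' cycles_def N_def Z_def)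
  have "\<zero>\<^bsub>C (Suc n)\<^esub> \<in> Z" using NZ N.zero_closed by blast
  moreover have "N +>\<^bsub>C (Suc n)\<^esub> x = N \<longleftrightarrow> x \<in> N" if "x \<in> Z" for x
    using that N.a_rcos_self[of x] N.a_rcos_const[of x] by (auto simp: Z_def)
  ultimately have "carrier (homology C d (Suc n)) = {N} \<longleftrightarrow> Z \<subseteq> N"
    unfolding car by blast
  then show ?thesis by (auto simp: zero Z_def N_def)
qed

section \<open>Functoriality of the tensor product and a criterion for the vanishing of Tor\<close>

context
  fixes R (structure) and M M' N N' f g
  assumes f: "lin_map R M M' f" and g: "lin_map R N N' g"
begin

interpretation f: lin_map R M M' f by (rule f)
interpretation g: lin_map R N N' g by (rule g)
interpretation p: bilin R M' N' "tensor R M' N'" "pure_tensor R M' N'"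
  by (rule f.N.pure_bilin) (rule g.N.module_axioms)

lemma tensor_map_bilin: "bilin R M N (tensor R M' N') (\<lambda>x y. pure_tensor R M' N' (f x) (g y))"
  by (intro bilin.intro bilin_axioms.intro f.M.module_axioms g.M.module_axioms p.P.module_axioms)
    (simp_all add: f.closed g.closed f.add g.add f.smult g.smult p.closed p.add1 p.add2 p.smult1 p.smult2)

lemma tensor_map_lin: "lin_map R (tensor R M N) (tensor R M' N') (tensor_map R M' N' f g)"
  unfolding tensor_map_def by (rule bilin.tensor_lift_lin[OF tensor_map_bilin])

lemma tensor_map_pure: "m \<in> carrier M \<Longrightarrow> n \<in> carrier N \<Longrightarrow>
    tensor_map R M' N' f g (pure_tensor R M N m n) = pure_tensor R M' N' (f m) (g n)"
  unfolding tensor_map_def by (rule bilin.tensor_lift_pure[OF tensor_map_bilin])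

end

lemma (in module) lin_map_id: "lin_map R M M id"
  by (rule lin_mapI'[OF module_axioms module_axioms]) auto

lemma lin_map_comp:
  assumes "lin_map R M N f" "lin_map R N P g"
  shows "lin_map R M P (\<lambda>x. g (f x))"
proof -
  interpret f: lin_map R M N f by fact
  interpret g: lin_map R N P g by fact
  show ?thesis
    by (rule lin_mapI'[OF f.M.module_axioms g.N.module_axioms])
      (simp_all add: f.closed g.closed f.add g.add f.smult g.smult)
qed

lemma (in module) res_dd:
  assumes "u \<in> carrier (res R M (Suc (Suc n)))"
  shows "res_d R M n (res_d R M (Suc n) u) = \<zero>\<^bsub>res R M n\<^esub>"
  using res_exact[of n] assms by blast

text \<open>The hypothesis in degree one and the conclusion in all positive degrees are both used in
  this form, so that cosets of boundaries do not appear again.\<close>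

lemma (in module) Tor_trivial_iff:
  assumes N: "module R N"
  shows "carrier (Tor R (Suc n) M N) = {\<zero>\<^bsub>Tor R (Suc n) M N\<^esub>} \<longleftrightarrow>
    (\<forall>z\<in>carrier (tensor R (res R M (Suc n)) N).
      tensor_map R (res R M n) N (res_d R M n) id z = \<zero>\<^bsub>tensor R (res R M n) N\<^esub> \<longrightarrow>
      z \<in> tensor_map R (res R M (Suc n)) N (res_d R M (Suc n)) id `
        carrier (tensor R (res R M (Suc (Suc n))) N))"
proof -
  note id = module.lin_map_id[OF N]
  note t = tensor_map_lin[OF d_lin id]
  interpret P2: module R "res R M (Suc (Suc n))" by (rule res_module)
  interpret P1: module R "res R M (Suc n)" by (rule res_module)
  interpret P0: module R "res R M n" by (rule res_module)
  interpret p: bilin R "res R M n" N "tensor R (res R M n) N" "pure_tensor R (res R M n) N"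
    by (rule P0.pure_bilin[OF N])
  let ?d = "\<lambda>i. tensor_map R (res R M i) N (res_d R M i) id"
  have "?d n (?d (Suc n) x) = \<zero>\<^bsub>tensor R (res R M n) N\<^esub>"
    if "x \<in> carrier (tensor R (res R M (Suc (Suc n))) N)" for x
  proof (rule P2.tensor_eqI[OF N lin_map_comp[OF t t] _ _ that])
    show "lin_map R (tensor R (res R M (Suc (Suc n))) N) (tensor R (res R M n) N)
        (\<lambda>x. \<zero>\<^bsub>tensor R (res R M n) N\<^esub>)"
      by (rule lin_mapI'[OF P2.tensor_module[OF N] p.P.module_axioms]) simp_all
    fix m b assume m: "m \<in> carrier (res R M (Suc (Suc n)))" and b: "b \<in> carrier N"
    have "pure_tensor R (res R M n) N \<zero>\<^bsub>res R M n\<^esub> b = \<zero>\<^bsub>tensor R (res R M n) N\<^esub>"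
      using p.smult1[of \<zero> "\<zero>\<^bsub>res R M n\<^esub>" b] b p.closed by simp
    then show "?d n (?d (Suc n) (pure_tensor R (res R M (Suc (Suc n))) N m b)) =
        \<zero>\<^bsub>tensor R (res R M n) N\<^esub>"
      using m b lin_map.closed[OF d_lin] by (simp add: tensor_map_pure[OF d_lin id] res_dd)
  qed
  note dd = this
  show ?thesis unfolding Tor_def
    by (rule homology_trivial_iff[where R = R]) (rule t, rule t, rule dd)
qed

context cring
begin

lemma one_minus_combine:
  "x \<in> carrier R \<Longrightarrow> y \<in> carrier R \<Longrightarrow> \<one> \<ominus> (x \<oplus> y \<ominus> x \<otimes> y) = (\<one> \<ominus> x) \<otimes> (\<one> \<ominus> y)"
  by algebra

lemma one_minus_mult: "x \<in> carrier R \<Longrightarrow> y \<in> carrier R \<Longrightarrow> (\<one> \<ominus> y) \<otimes> x = x \<ominus> y \<otimes> x"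
  by algebra

text \<open>Applied to \<open>l\<close> with \<open>h l = 1\<close>: then \<open>1 - l l\<close>
  lies in the kernel, so for \<open>x\<close> in the kernel \<open>x\<close> and
  \<open>l (x l)\<close> differ by a product of two kernel elements.\<close>

lemma decomp_idem:
  "x \<in> carrier R \<Longrightarrow> l \<in> carrier R \<Longrightarrow> l \<otimes> (x \<otimes> l) \<oplus> (\<one> \<ominus> l \<otimes> l) \<otimes> x = x"
  by algebra

end

section \<open>Tensoring with a quotient ring \<open>R / I\<close>\<close>

locale surj_hom = R: cring R + B: cring B for R (structure) and B and h +
  assumes hom: "h \<in> ring_hom R B" and onto: "h ` carrier R = carrier B"
begin

text \<open>Since \<open>h\<close> is onto, \<open>N\<close> is \<open>R / I\<close> up to
  isomorphism, with elements of \<open>B\<close> in place of cosets.\<close>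

abbreviation "N \<equiv> module_via h B"
abbreviation "I \<equiv> a_kernel R B h"

sublocale N: module R N
  by (rule module_via_module[OF R.is_cring B.is_cring hom])

sublocale h: ring_hom_ring R B h
  by (intro ring_hom_ringI2 R.ring_axioms B.ring_axioms hom)

sublocale I: ideal I R
  by (rule h.kernel_is_ideal)

lemma N_simps: "carrier N = carrier B" "\<zero>\<^bsub>N\<^esub> = \<zero>\<^bsub>B\<^esub>" "b \<oplus>\<^bsub>N\<^esub> c = b \<oplus>\<^bsub>B\<^esub> c"
    "r \<odot>\<^bsub>N\<^esub> b = h r \<otimes>\<^bsub>B\<^esub> b"
  by (simp_all add: module_via_def)

lemma I_iff: "x \<in> I \<longleftrightarrow> x \<in> carrier R \<and> h x = \<zero>\<^bsub>B\<^esub>"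
  unfolding a_kernel_def' by blast

text \<open>An arbitrary section of \<open>h\<close>, in general neither additive nor multiplicative
  and not sending one to one; each use is compatible only modulo \<open>I\<close>.\<close>

definition lift where "lift b = (SOME r. r \<in> carrier R \<and> h r = b)"

lemma lift:
  assumes "b \<in> carrier B"
  shows "lift b \<in> carrier R" "h (lift b) = b"
proof -
  have "b \<in> h ` carrier R" using assms onto by simp
  then have "\<exists>r. r \<in> carrier R \<and> h r = b" by blast
  from someI_ex[OF this] show "lift b \<in> carrier R" "h (lift b) = b" unfolding lift_def by blast+
qed

text \<open>Surjectivity of \<open>h\<close> moves the second factor across:
  \<open>m \<otimes> n = s m \<otimes> 1\<close> for any lift \<open>s\<close> of \<open>n\<close>,
  and such tensors add up in the first factor.\<close>

lemma tensor_N_elt: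
  assumes P: "module R P" and z: "z \<in> carrier (tensor R P N)"
  obtains u where "u \<in> carrier P" "z = pure_tensor R P N u \<one>\<^bsub>B\<^esub>"
proof -
  interpret P: module R P by fact
  interpret p: bilin R P N "tensor R P N" "pure_tensor R P N"
    by (rule P.pure_bilin) (rule N.module_axioms)
  have one: "\<one>\<^bsub>B\<^esub> \<in> carrier N" by (simp add: N_simps)
  from N.module_axioms z have "\<exists>u\<in>carrier P. z = pure_tensor R P N u \<one>\<^bsub>B\<^esub>"
  proof (induction rule: P.tensor_induct)
    case zero
    have "pure_tensor R P N \<zero>\<^bsub>P\<^esub> \<one>\<^bsub>B\<^esub> = \<zero>\<^bsub>tensor R P N\<^esub>"
      using p.smult1[of \<zero> "\<zero>\<^bsub>P\<^esub>" "\<one>\<^bsub>B\<^esub>"] one p.closed by simp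
    from this[symmetric] show ?case by (rule bexI) simp
  next
    case (add r m n v)
    then obtain u where u: "u \<in> carrier P" "v = pure_tensor R P N u \<one>\<^bsub>B\<^esub>" by blast
    define s where "s = lift n"
    have s: "s \<in> carrier R" "h s = n" using lift add(3) by (auto simp: s_def N_simps)
    have "n = s \<odot>\<^bsub>N\<^esub> \<one>\<^bsub>B\<^esub>" using s add(3) by (simp add: N_simps)
    then have "pure_tensor R P N m n = pure_tensor R P N (s \<odot>\<^bsub>P\<^esub> m) \<one>\<^bsub>B\<^esub>"
      using s add(2) one p.smult1[of s m "\<one>\<^bsub>B\<^esub>"] p.smult2[of s m "\<one>\<^bsub>B\<^esub>"] by simp
    then have "r \<odot>\<^bsub>tensor R P N\<^esub> pure_tensor R P N m n \<oplus>\<^bsub>tensor R P N\<^esub> v =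
       pure_tensor R P N (r \<odot>\<^bsub>P\<^esub> (s \<odot>\<^bsub>P\<^esub> m) \<oplus>\<^bsub>P\<^esub> u) \<one>\<^bsub>B\<^esub>"
      using add(1,2) s u one by (simp add: p.add1 p.smult1)
    moreover have "r \<odot>\<^bsub>P\<^esub> (s \<odot>\<^bsub>P\<^esub> m) \<oplus>\<^bsub>P\<^esub> u \<in> carrier P" using add s u by simp
    ultimately show ?case by blast
  qed
  then show ?thesis using that by (elim bexE)
qed

text \<open>Since \<open>N\<close> is \<open>R / I\<close>, this is the map \<open>P \<otimes> R / I \<rightarrow> W / H\<close> induced by \<open>f\<close>.\<close>

lemma quot_bilin:
  assumes f: "lin_map R P W f" and H: "submodule H R W"
    and IH: "\<And>x u. x \<in> I \<Longrightarrow> u \<in> carrier P \<Longrightarrow> x \<odot>\<^bsub>W\<^esub> f u \<in> H"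
  shows "bilin R P N (quot_module W H) (\<lambda>u b. H +>\<^bsub>W\<^esub> (lift b \<odot>\<^bsub>W\<^esub> f u))"
proof -
  interpret f: lin_map R P W f by fact
  have cong: "H +>\<^bsub>W\<^esub> (r \<odot>\<^bsub>W\<^esub> f u) = H +>\<^bsub>W\<^esub> (s \<odot>\<^bsub>W\<^esub> f u)"
    if "r \<in> carrier R" "s \<in> carrier R" "h r = h s" "u \<in> carrier P" for r s u
  proof (rule R.submodule_mem_cong[OF f.N.module_axioms H])
    have "h (r \<ominus> s) = \<zero>\<^bsub>B\<^esub>" using that by (simp add: a_minus_def B.r_neg)
    then have "r \<ominus> s \<in> I" using that by (simp add: I_iff)
    then have "(r \<ominus> s) \<odot>\<^bsub>W\<^esub> f u \<in> H" using that by (simp add: IH)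
    then show "r \<odot>\<^bsub>W\<^esub> f u \<ominus>\<^bsub>W\<^esub> s \<odot>\<^bsub>W\<^esub> f u \<in> H"
      using that f.closed by (simp add: a_minus_def f.N.smult_l_distr f.N.smult_l_minus)
  qed (use that f.closed in auto)
  have sc: "s \<odot>\<^bsub>W\<^esub> (r \<odot>\<^bsub>W\<^esub> w) = r \<odot>\<^bsub>W\<^esub> (s \<odot>\<^bsub>W\<^esub> w)"
    if "r \<in> carrier R" "s \<in> carrier R" "w \<in> carrier W" for r s w
    using that by (metis f.N.smult_assoc1 R.m_comm)
  show ?thesis
  proof (intro bilin.intro bilin_axioms.intro f.M.module_axioms N.module_axioms
      f.N.quot_module_module[OF H])
    fix u b assume u: "u \<in> carrier P" and "b \<in> carrier N"
    then have b: "b \<in> carrier B" by (simp add: N_simps)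
    show "H +>\<^bsub>W\<^esub> (lift b \<odot>\<^bsub>W\<^esub> f u) \<in> carrier (quot_module W H)"
      using u b lift f.closed by (auto simp: quot_carrier)
    show "H +>\<^bsub>W\<^esub> (lift b \<odot>\<^bsub>W\<^esub> f (u \<oplus>\<^bsub>P\<^esub> u')) =
        (H +>\<^bsub>W\<^esub> (lift b \<odot>\<^bsub>W\<^esub> f u)) \<oplus>\<^bsub>quot_module W H\<^esub> (H +>\<^bsub>W\<^esub> (lift b \<odot>\<^bsub>W\<^esub> f u'))"
      if "u' \<in> carrier P" for u'
      using u b lift f.closed that
      by (simp add: f.N.quot_add[OF H] f.add f.N.smult_r_distr)
    show "H +>\<^bsub>W\<^esub> (lift (b \<oplus>\<^bsub>N\<^esub> b') \<odot>\<^bsub>W\<^esub> f u) =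
        (H +>\<^bsub>W\<^esub> (lift b \<odot>\<^bsub>W\<^esub> f u)) \<oplus>\<^bsub>quot_module W H\<^esub> (H +>\<^bsub>W\<^esub> (lift b' \<odot>\<^bsub>W\<^esub> f u))"
      if "b' \<in> carrier N" for b'
    proof -
      have b': "b' \<in> carrier B" using that by (simp add: N_simps)
      have "H +>\<^bsub>W\<^esub> (lift (b \<oplus>\<^bsub>N\<^esub> b') \<odot>\<^bsub>W\<^esub> f u) = H +>\<^bsub>W\<^esub> ((lift b \<oplus> lift b') \<odot>\<^bsub>W\<^esub> f u)"
        using u b b' lift by (intro cong) (simp_all add: N_simps)
      then show ?thesis using u b b' lift f.closed
        by (simp add: f.N.quot_add[OF H] f.N.smult_l_distr)
    qed
    fix r assume r: "r \<in> carrier R"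
    show "H +>\<^bsub>W\<^esub> (lift b \<odot>\<^bsub>W\<^esub> f (r \<odot>\<^bsub>P\<^esub> u)) =
        r \<odot>\<^bsub>quot_module W H\<^esub> (H +>\<^bsub>W\<^esub> (lift b \<odot>\<^bsub>W\<^esub> f u))"
      using u b r lift f.closed by (simp add: f.N.quot_smult[OF H] f.smult sc)
    have "H +>\<^bsub>W\<^esub> (lift (r \<odot>\<^bsub>N\<^esub> b) \<odot>\<^bsub>W\<^esub> f u) = H +>\<^bsub>W\<^esub> ((r \<otimes> lift b) \<odot>\<^bsub>W\<^esub> f u)"
      using u b r lift by (intro cong) (simp_all add: N_simps)
    then show "H +>\<^bsub>W\<^esub> (lift (r \<odot>\<^bsub>N\<^esub> b) \<odot>\<^bsub>W\<^esub> f u) =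
        r \<odot>\<^bsub>quot_module W H\<^esub> (H +>\<^bsub>W\<^esub> (lift b \<odot>\<^bsub>W\<^esub> f u))"
      using u b r lift f.closed by (simp add: f.N.quot_smult[OF H] f.N.smult_assoc1)
  qed
qed

text \<open>If \<open>1 - y1\<close> kills one element and \<open>1 - y2\<close> another, their
  product kills both and is again one minus an element of \<open>I\<close>. Hence the elements
  killed by some \<open>1 - y\<close> are closed under addition.\<close>

lemma pure_combine:
  assumes "y1 \<in> I" "y2 \<in> I"
  obtains y where "y \<in> I" "\<one> \<ominus> y = (\<one> \<ominus> y1) \<otimes> (\<one> \<ominus> y2)"
proof (rule that)
  show "y1 \<oplus> y2 \<ominus> y1 \<otimes> y2 \<in> I"
    unfolding a_minus_def
    by (intro I.a_closed I.a_inv_closed I.I_r_closed assms I.Icarr[OF assms(2)])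
  show "\<one> \<ominus> (y1 \<oplus> y2 \<ominus> y1 \<otimes> y2) = (\<one> \<ominus> y1) \<otimes> (\<one> \<ominus> y2)"
    by (rule R.one_minus_combine) (simp_all add: I.Icarr assms)
qed

lemma fixed_submodule:
  assumes P: "module R P"
  shows "submodule {u \<in> carrier P. \<exists>y\<in>I. (\<one> \<ominus> y) \<odot>\<^bsub>P\<^esub> u = \<zero>\<^bsub>P\<^esub>} R P" (is "submodule ?H R P")
proof -
  interpret P: module R P by fact
  note cI = I.Icarr
  show ?thesis
  proof (rule P.submoduleI)
    have "\<exists>y. y \<in> I" using I.zero_closed by blast
    then show "\<zero>\<^bsub>P\<^esub> \<in> ?H" using cI by auto
    show "\<ominus>\<^bsub>P\<^esub> u \<in> ?H" if "u \<in> ?H" for u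
      using that cI by (auto simp: P.smult_r_minus)
    show "r \<odot>\<^bsub>P\<^esub> u \<in> ?H" if u: "u \<in> ?H" and r: "r \<in> carrier R" for u r
    proof -
      obtain y where y: "u \<in> carrier P" "y \<in> I" "(\<one> \<ominus> y) \<odot>\<^bsub>P\<^esub> u = \<zero>\<^bsub>P\<^esub>" using u by auto
      have "(\<one> \<ominus> y) \<odot>\<^bsub>P\<^esub> (r \<odot>\<^bsub>P\<^esub> u) = r \<odot>\<^bsub>P\<^esub> ((\<one> \<ominus> y) \<odot>\<^bsub>P\<^esub> u)"
        using y(1,2) r cI by (simp add: P.smult_assoc1[symmetric] R.m_comm)
      then show ?thesis using y r by auto
    qed
    fix u v assume "u \<in> ?H" "v \<in> ?H"
    then obtain y1 y2 where y: "y1 \<in> I" "(\<one> \<ominus> y1) \<odot>\<^bsub>P\<^esub> u = \<zero>\<^bsub>P\<^esub>" "y2 \<in> I" "(\<one> \<ominus> y2) \<odot>\<^bsub>P\<^esub> v = \<zero>\<^bsub>P\<^esub>"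
      and uv: "u \<in> carrier P" "v \<in> carrier P" by auto
    obtain y where y': "y \<in> I" "\<one> \<ominus> y = (\<one> \<ominus> y1) \<otimes> (\<one> \<ominus> y2)" using pure_combine y by metis
    have 1: "(\<one> \<ominus> y) \<odot>\<^bsub>P\<^esub> u = (\<one> \<ominus> y2) \<odot>\<^bsub>P\<^esub> ((\<one> \<ominus> y1) \<odot>\<^bsub>P\<^esub> u)"
      unfolding y'(2) using uv cI[OF y(1)] cI[OF y(3)] R.m_comm[of "\<one> \<ominus> y1" "\<one> \<ominus> y2"]
        P.smult_assoc1[of "\<one> \<ominus> y2" "\<one> \<ominus> y1" u] by simp
    have 2: "(\<one> \<ominus> y) \<odot>\<^bsub>P\<^esub> v = (\<one> \<ominus> y1) \<odot>\<^bsub>P\<^esub> ((\<one> \<ominus> y2) \<odot>\<^bsub>P\<^esub> v)"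
      unfolding y'(2) using uv cI[OF y(1)] cI[OF y(3)] by (intro P.smult_assoc1) simp_all
    have "(\<one> \<ominus> y) \<odot>\<^bsub>P\<^esub> (u \<oplus>\<^bsub>P\<^esub> v) = \<zero>\<^bsub>P\<^esub>"
      using y(2,4) 1 2 uv cI[OF y(1)] cI[OF y(3)] cI[OF y'(1)] by (simp add: P.smult_r_distr)
    then show "u \<oplus>\<^bsub>P\<^esub> v \<in> ?H" using y'(1) uv by auto
  qed auto
qed

text \<open>Purity puts \<open>I P\<close> inside the submodule \<open>H\<close> of elements killed
  by some \<open>1 - y\<close>. So the projection of \<open>P\<close> to \<open>P / H\<close>
  factors through the tensor product with \<open>R / I\<close>, and \<open>u \<otimes> 1 = 0\<close>
  forces \<open>u\<close> into \<open>H\<close>.\<close>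

lemma pure_tensor_eq_zero:
  assumes P: "module R P" and pure: "\<And>x. x \<in> I \<Longrightarrow> \<exists>y\<in>I. y \<otimes> x = x"
    and u: "u \<in> carrier P" and z: "pure_tensor R P N u \<one>\<^bsub>B\<^esub> = \<zero>\<^bsub>tensor R P N\<^esub>"
  obtains y where "y \<in> I" "(\<one> \<ominus> y) \<odot>\<^bsub>P\<^esub> u = \<zero>\<^bsub>P\<^esub>"
proof -
  interpret P: module R P by fact
  define H where "H = {u \<in> carrier P. \<exists>y\<in>I. (\<one> \<ominus> y) \<odot>\<^bsub>P\<^esub> u = \<zero>\<^bsub>P\<^esub>}"
  have H: "submodule H R P" unfolding H_def by (rule fixed_submodule[OF P])
  interpret H: abelian_subgroup H P by (rule P.submodule_abelian_subgroup[OF H])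
  have IH: "x \<odot>\<^bsub>P\<^esub> v \<in> H" if x: "x \<in> I" and v: "v \<in> carrier P" for x v
  proof -
    obtain y where y: "y \<in> I" "y \<otimes> x = x" using pure[OF x] by blast
    have c: "x \<in> carrier R" "y \<in> carrier R" using x y(1) by (simp_all add: I_iff)
    have "(\<one> \<ominus> y) \<otimes> x = x \<ominus> y \<otimes> x" using c by (intro R.one_minus_mult)
    then have "(\<one> \<ominus> y) \<otimes> x = \<zero>" using y(2) c by (simp add: a_minus_def R.r_neg)
    then have "(\<one> \<ominus> y) \<odot>\<^bsub>P\<^esub> (x \<odot>\<^bsub>P\<^esub> v) = \<zero>\<^bsub>P\<^esub>"
      using c v P.smult_assoc1[of "\<one> \<ominus> y" x v] by simp
    then show ?thesis unfolding H_def using y(1) P.smult_closed[OF c(1) v] by blast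
  qed
  interpret b: bilin R P N "quot_module P H" "\<lambda>u b. H +>\<^bsub>P\<^esub> (lift b \<odot>\<^bsub>P\<^esub> id u)"
    by (rule quot_bilin[OF P.lin_map_id H]) (simp add: IH)
  have "H +>\<^bsub>P\<^esub> (lift \<one>\<^bsub>B\<^esub> \<odot>\<^bsub>P\<^esub> id u) = \<zero>\<^bsub>quot_module P H\<^esub>"
    using b.tensor_lift_pure[OF u, of "\<one>\<^bsub>B\<^esub>"] lin_map.zero[OF b.tensor_lift_lin] z
    by (simp add: N_simps)
  then have "H +>\<^bsub>P\<^esub> (lift \<one>\<^bsub>B\<^esub> \<odot>\<^bsub>P\<^esub> u) = H" by (simp add: quot_module_def)
  then have "lift \<one>\<^bsub>B\<^esub> \<odot>\<^bsub>P\<^esub> u \<in> H"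
    using H.a_rcos_self[of "lift \<one>\<^bsub>B\<^esub> \<odot>\<^bsub>P\<^esub> u"] lift u by simp
  \<comment> \<open>The chosen lift of one need not be one, but it differs from one by an element of
    \<open>I\<close>, and \<open>I P\<close> lies in \<open>H\<close>.\<close>
  moreover have "(\<one> \<ominus> lift \<one>\<^bsub>B\<^esub>) \<odot>\<^bsub>P\<^esub> u \<in> H"
    using lift u by (intro IH) (simp_all add: I_iff a_minus_def B.r_neg)
  ultimately have "(\<one> \<ominus> lift \<one>\<^bsub>B\<^esub>) \<odot>\<^bsub>P\<^esub> u \<oplus>\<^bsub>P\<^esub> lift \<one>\<^bsub>B\<^esub> \<odot>\<^bsub>P\<^esub> u \<in> H" by simp
  moreover have "(\<one> \<ominus> lift \<one>\<^bsub>B\<^esub>) \<odot>\<^bsub>P\<^esub> u \<oplus>\<^bsub>P\<^esub> lift \<one>\<^bsub>B\<^esub> \<odot>\<^bsub>P\<^esub> u = u"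
  proof -
    have "(\<one> \<ominus> lift \<one>\<^bsub>B\<^esub>) \<oplus> lift \<one>\<^bsub>B\<^esub> = \<one>"
      using lift by (simp add: a_minus_def R.a_assoc R.l_neg)
    then show ?thesis using lift u by (simp add: P.smult_l_distr[symmetric])
  qed
  ultimately have "u \<in> H" by simp
  then show ?thesis using that unfolding H_def by blast
qed

text \<open>If a cycle is written as \<open>u \<otimes> 1\<close>, then \<open>(1 - y) d u = 0\<close> for some \<open>y \<in> I\<close>, and replacing
  \<open>u\<close> by \<open>(1 - y) u\<close> does not change \<open>u \<otimes> 1\<close>.\<close>

lemma Tor_trivial_of_pure:
  assumes M: "module R M" and pure: "\<And>x. x \<in> I \<Longrightarrow> \<exists>y\<in>I. y \<otimes> x = x"
  shows "carrier (Tor R (Suc n) M N) = {\<zero>\<^bsub>Tor R (Suc n) M N\<^esub>}"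
proof -
  interpret M: module R M by fact
  let ?P = "res R M"
  note id = N.lin_map_id
  interpret P0: module R "?P n" by (rule M.res_module)
  interpret P1: module R "?P (Suc n)" by (rule M.res_module)
  interpret d: lin_map R "?P (Suc n)" "?P n" "res_d R M n" by (rule M.d_lin)
  interpret p: bilin R "?P (Suc n)" N "tensor R (?P (Suc n)) N" "pure_tensor R (?P (Suc n)) N"
    by (rule P1.pure_bilin) (rule N.module_axioms)
  have one: "\<one>\<^bsub>B\<^esub> \<in> carrier N" by (simp add: N_simps)
  show ?thesis
    unfolding M.Tor_trivial_iff[OF N.module_axioms]
  proof (intro ballI impI)
    fix z assume z: "z \<in> carrier (tensor R (?P (Suc n)) N)"
      and dz: "tensor_map R (?P n) N (res_d R M n) id z = \<zero>\<^bsub>tensor R (?P n) N\<^esub>"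
    obtain u where u: "u \<in> carrier (?P (Suc n))" "z = pure_tensor R (?P (Suc n)) N u \<one>\<^bsub>B\<^esub>"
      by (rule tensor_N_elt[OF P1.module_axioms z])
    have "pure_tensor R (?P n) N (res_d R M n u) \<one>\<^bsub>B\<^esub> = \<zero>\<^bsub>tensor R (?P n) N\<^esub>"
      using dz u by (simp add: tensor_map_pure[OF M.d_lin id] one)
    then obtain y where y: "y \<in> I" "(\<one> \<ominus> y) \<odot>\<^bsub>?P n\<^esub> res_d R M n u = \<zero>\<^bsub>?P n\<^esub>"
      using pure_tensor_eq_zero[OF P0.module_axioms pure d.closed[OF u(1)]] by blast
    have yR: "y \<in> carrier R" "h y = \<zero>\<^bsub>B\<^esub>" using y(1) by (simp_all add: I_iff)
    have du: "res_d R M n ((\<one> \<ominus> y) \<odot>\<^bsub>?P (Suc n)\<^esub> u) = \<zero>\<^bsub>?P n\<^esub>"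
      using y yR u by (simp add: d.smult)
    have "(\<one> \<ominus> y) \<odot>\<^bsub>?P (Suc n)\<^esub> u \<in> res_d R M (Suc n) ` carrier (?P (Suc (Suc n)))"
      unfolding M.res_exact using du yR(1) u(1) by simp
    then obtain w where wd: "(\<one> \<ominus> y) \<odot>\<^bsub>?P (Suc n)\<^esub> u = res_d R M (Suc n) w"
        and wP: "w \<in> carrier (?P (Suc (Suc n)))"
      by (rule imageE)
    note w = wP wd[symmetric]
    have "tensor_map R (?P (Suc n)) N (res_d R M (Suc n)) id
        (pure_tensor R (?P (Suc (Suc n))) N w \<one>\<^bsub>B\<^esub>) = z"
    proof -
      have "tensor_map R (?P (Suc n)) N (res_d R M (Suc n)) id
        (pure_tensor R (?P (Suc (Suc n))) N w \<one>\<^bsub>B\<^esub>) =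
        pure_tensor R (?P (Suc n)) N ((\<one> \<ominus> y) \<odot>\<^bsub>?P (Suc n)\<^esub> u) \<one>\<^bsub>B\<^esub>"
        using w by (simp add: tensor_map_pure[OF M.d_lin id] one)
      also have "\<dots> = pure_tensor R (?P (Suc n)) N u ((\<one> \<ominus> y) \<odot>\<^bsub>N\<^esub> \<one>\<^bsub>B\<^esub>)"
        using u yR one by (simp add: p.smult1 p.smult2)
      also have "(\<one> \<ominus> y) \<odot>\<^bsub>N\<^esub> \<one>\<^bsub>B\<^esub> = \<one>\<^bsub>B\<^esub>" using yR by (simp add: N_simps a_minus_def)
      finally show ?thesis unfolding u(2) .
    qed
    moreover have "pure_tensor R (?P (Suc (Suc n))) N w \<one>\<^bsub>B\<^esub> \<in> carrier (tensor R (?P (Suc (Suc n))) N)"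
      by (rule bilin.closed[OF module.pure_bilin[OF M.res_module N.module_axioms] w(1) one])
    ultimately show "z \<in> tensor_map R (?P (Suc n)) N (res_d R M (Suc n)) id `
        carrier (tensor R (?P (Suc (Suc n))) N)" by blast
  qed
qed

text \<open>\<open>Tor\<^sub>1(R / I, R / I) = I / I\<^sup>2\<close>: the comparison of the resolution with
  \<open>I \<rightarrow> R \<rightarrow> R / I\<close> induces \<open>Tor\<^sub>1 \<rightarrow> I / I\<^sup>2\<close>.\<close>

lemma kernel_idempotent_of_Tor:
  assumes T: "carrier (Tor R (Suc 0) N N) = {\<zero>\<^bsub>Tor R (Suc 0) N N\<^esub>}"
  shows "I \<subseteq> ideal_prod R I I"
proof
  fix x assume x: "x \<in> I"
  then have xR: "x \<in> carrier R" "h x = \<zero>\<^bsub>B\<^esub>" by (simp_all add: I_iff)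
  \<comment> \<open>\<open>?W\<close> is \<open>R\<close> as a module over itself: a quotient module
    needs a scalar multiplication, which the ring record \<open>R\<close> does not carry.\<close>
  let ?P = "res R N" and ?J = "ideal_prod R I I" and ?W = "module_via id R"
  have idR: "id \<in> ring_hom R R" by (rule ring_hom_memI) auto
  interpret W: module R ?W by (rule module_via_module[OF R.is_cring R.is_cring idR])
  interpret P0: module R "?P 0" by (rule N.res_module)
  interpret P1: module R "?P (Suc 0)" by (rule N.res_module)
  interpret P2: module R "?P (Suc (Suc 0))" by (rule N.res_module)
  have Ws: "carrier ?W = carrier R" "\<zero>\<^bsub>?W\<^esub> = \<zero>" "r \<odot>\<^bsub>?W\<^esub> s = r \<otimes> s" "r \<oplus>\<^bsub>?W\<^esub> s = r \<oplus> s" for r s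
    by (simp_all add: module_via_def)
  have one: "\<one>\<^bsub>B\<^esub> \<in> carrier N" by (simp add: N_simps)
  note id = N.lin_map_id
  have J: "ideal ?J R" by (rule R.ideal_prod_is_ideal[OF I.is_ideal I.is_ideal])
  interpret J: ideal ?J R by fact
  have JW: "submodule ?J R ?W"
  proof (rule W.submoduleI)
    fix a assume a: "a \<in> ?J"
    have "\<ominus>\<^bsub>?W\<^esub> a = (\<ominus> \<one>) \<otimes> a"
      using W.smult_l_minus[of \<one> a] W.smult_one[of a] J.Icarr[OF a] by (simp add: Ws)
    then show "\<ominus>\<^bsub>?W\<^esub> a \<in> ?J" using a J.I_l_closed by simp
  qed (use J.Icarr J.I_l_closed J.zero_closed J.a_closed in \<open>auto simp: Ws\<close>)
  \<comment> \<open>Comparison map in degree 0: every generator goes to a lift of the element it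
    stands for. Thus \<open>h\<close> after \<open>\<psi>0\<close> is the augmentation, and
    \<open>\<psi>0\<close> maps boundaries into \<open>I\<close>.\<close>
  define c where "c = (\<lambda>g :: ('a, 'c) gen. lift (gen_elt g))"
  have gf: "gen_elt \<in> gens R N 0 \<rightarrow> carrier N" by (auto simp: N_simps)
  have cf: "c \<in> gens R N 0 \<rightarrow> carrier ?W" by (auto simp: c_def N_simps Ws lift)
  define \<psi>0 where "\<psi>0 = lin_ext R ?W c"
  have p0: "lin_map R (?P 0) ?W \<psi>0"
    unfolding \<psi>0_def res_def by (rule W.lin_ext_lin[OF cf])
  interpret p0: lin_map R "?P 0" ?W \<psi>0 by (rule p0)
  interpret d: lin_map R "?P (Suc 0)" "?P 0" "res_d R N 0" by (rule N.d_lin)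
  interpret aug: lin_map R "?P 0" N "res_aug R N" by (rule N.aug_lin)
  have hp0: "h (\<psi>0 u) = res_aug R N u" if "u \<in> carrier (?P 0)" for u
    using that unfolding res_def
  proof (induction rule: R.free_module_induct)
    case zero
    then show ?case using p0.zero aug.zero by (simp add: res_def Ws N_simps)
  next
    case (add r s v)
    have rs: "single R s r \<in> carrier (?P 0)" using add by (simp add: res_def R.single_closed)
    have "\<psi>0 (single R s r) = r \<otimes> c s"
      unfolding \<psi>0_def using W.lin_ext_single[OF cf add(2,1)] by (simp add: Ws)
    moreover have "res_aug R N (single R s r) = h r \<otimes>\<^bsub>B\<^esub> gen_elt s"
      unfolding res_aug_def using N.lin_ext_single[OF gf add(2,1)] by (simp add: N_simps)
    moreover have "h (c s) = gen_elt s" "c s \<in> carrier R" using add(2) lift by (auto simp: c_def N_simps)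
    ultimately have "h (\<psi>0 (single R s r)) = res_aug R N (single R s r)" using add(1) by simp
    moreover have v: "v \<in> carrier (?P 0)" using add(3) by (simp add: res_def)
    ultimately have "h (\<psi>0 (single R s r \<oplus>\<^bsub>?P 0\<^esub> v)) = res_aug R N (single R s r \<oplus>\<^bsub>?P 0\<^esub> v)"
      using add(4) p0.add[OF rs v] aug.add[OF rs v] p0.closed[OF rs] p0.closed[OF v]
      by (simp add: Ws N_simps)
    then show ?case by (simp add: res_def)
  qed
  define \<psi> where "\<psi> = (\<lambda>u. \<psi>0 (res_d R N 0 u))"
  have p: "lin_map R (?P (Suc 0)) ?W \<psi>"
    unfolding \<psi>_def by (rule lin_map_comp[OF N.d_lin p0])
  have pI: "\<psi> u \<in> I" if "u \<in> carrier (?P (Suc 0))" for u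
  proof -
    have "res_aug R N (res_d R N 0 u) = \<zero>\<^bsub>N\<^esub>" "res_d R N 0 u \<in> carrier (?P 0)"
      using N.res_exact0 that by auto
    then show ?thesis using p0.closed hp0 by (simp add: \<psi>_def I_iff Ws N_simps)
  qed
  have b: "bilin R (?P (Suc 0)) N (quot_module ?W ?J) (\<lambda>u b. ?J +>\<^bsub>?W\<^esub> (lift b \<odot>\<^bsub>?W\<^esub> \<psi> u))"
    by (rule quot_bilin[OF p JW]) (simp add: Ws ideal_prod.prod pI)
  interpret b: bilin R "?P (Suc 0)" N "quot_module ?W ?J" "\<lambda>u b. ?J +>\<^bsub>?W\<^esub> (lift b \<odot>\<^bsub>?W\<^esub> \<psi> u)"
    by (rule b)
  define \<Lambda> where "\<Lambda> = tensor_lift R (quot_module ?W ?J) (\<lambda>u b. ?J +>\<^bsub>?W\<^esub> (lift b \<odot>\<^bsub>?W\<^esub> \<psi> u))"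
  interpret L: lin_map R "tensor R (?P (Suc 0)) N" "quot_module ?W ?J" \<Lambda>
    unfolding \<Lambda>_def by (rule b.tensor_lift_lin)
  interpret JS: abelian_subgroup ?J ?W by (rule W.submodule_abelian_subgroup[OF JW])

  \<comment> \<open>\<open>e\<close> is the generator over one. As \<open>x e\<close> has
    augmentation zero, it is the boundary of some \<open>v\<close>, and \<open>v \<otimes> 1\<close>
    is the cycle that represents \<open>x\<close>: its boundary is
    \<open>e \<otimes> x 1 = 0\<close>.\<close>
  define e where "e = single R (Elt \<one>\<^bsub>B\<^esub> :: ('a, 'c) gen) \<one>"
  have Elt: "Elt \<one>\<^bsub>B\<^esub> \<in> gens R N 0" by (simp add: N_simps)
  have e: "e \<in> carrier (?P 0)" using R.single_closed[OF Elt] by (simp add: e_def res_def)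
  have "res_aug R N e = \<one>\<^bsub>B\<^esub>"
    unfolding res_aug_def e_def using N.lin_ext_single[OF gf Elt, of \<one>] by (simp add: N_simps)
  then have "res_aug R N (x \<odot>\<^bsub>?P 0\<^esub> e) = \<zero>\<^bsub>N\<^esub>"
    using xR e by (simp add: aug.smult N_simps)
  then have "x \<odot>\<^bsub>?P 0\<^esub> e \<in> res_d R N 0 ` carrier (?P (Suc 0))"
    using N.res_exact0 xR e by simp
  then obtain v where v: "v \<in> carrier (?P (Suc 0))" "res_d R N 0 v = x \<odot>\<^bsub>?P 0\<^esub> e" by auto
  let ?z = "pure_tensor R (?P (Suc 0)) N v \<one>\<^bsub>B\<^esub>"
  interpret q0: bilin R "?P 0" N "tensor R (?P 0) N" "pure_tensor R (?P 0) N"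
    by (rule P0.pure_bilin) (rule N.module_axioms)
  interpret q1: bilin R "?P (Suc 0)" N "tensor R (?P (Suc 0)) N" "pure_tensor R (?P (Suc 0)) N"
    by (rule P1.pure_bilin) (rule N.module_axioms)
  have "tensor_map R (?P 0) N (res_d R N 0) id ?z = pure_tensor R (?P 0) N e (x \<odot>\<^bsub>N\<^esub> \<one>\<^bsub>B\<^esub>)"
    using v one e xR q0.smult1[of x e "\<one>\<^bsub>B\<^esub>"] q0.smult2[of x e "\<one>\<^bsub>B\<^esub>"]
    by (simp add: tensor_map_pure[OF N.d_lin id])
  also have "x \<odot>\<^bsub>N\<^esub> \<one>\<^bsub>B\<^esub> = \<zero>\<^bsub>N\<^esub>" using xR by (simp add: N_simps)
  also have "pure_tensor R (?P 0) N e \<zero>\<^bsub>N\<^esub> = \<zero>\<^bsub>tensor R (?P 0) N\<^esub>"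
    using q0.smult2[of \<zero> e "\<zero>\<^bsub>N\<^esub>"] e q0.closed by simp
  finally have "?z \<in> tensor_map R (?P (Suc 0)) N (res_d R N (Suc 0)) id `
        carrier (tensor R (?P (Suc (Suc 0))) N)"
    using T[unfolded N.Tor_trivial_iff[OF N.module_axioms]] q1.closed[OF v(1) one] by blast
  then obtain w where w: "w \<in> carrier (tensor R (?P (Suc (Suc 0))) N)"
      "?z = tensor_map R (?P (Suc 0)) N (res_d R N (Suc 0)) id w" by blast
  \<comment> \<open>\<open>\<psi>\<close> already contains one differential, so on boundaries two
    consecutive differentials meet.\<close>
  have "\<Lambda> (tensor_map R (?P (Suc 0)) N (res_d R N (Suc 0)) id w) = \<zero>\<^bsub>quot_module ?W ?J\<^esub>"
  proof (rule P2.tensor_eqI[OF N.module_axioms lin_map_comp[OF tensor_map_lin[OF N.d_lin id] L.lin_map_axioms] _ _ w(1)])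
    show "lin_map R (tensor R (?P (Suc (Suc 0))) N) (quot_module ?W ?J) (\<lambda>_. \<zero>\<^bsub>quot_module ?W ?J\<^esub>)"
      by (rule lin_mapI'[OF P2.tensor_module[OF N.module_axioms] b.P.module_axioms]) simp_all
    fix m b assume m: "m \<in> carrier (?P (Suc (Suc 0)))" and bN: "b \<in> carrier N"
    have dm: "res_d R N (Suc 0) m \<in> carrier (?P (Suc 0))" by (rule lin_map.closed[OF N.d_lin m])
    have "\<psi> (res_d R N (Suc 0) m) = \<zero>"
      unfolding \<psi>_def using N.res_dd[OF m] p0.zero by (simp add: Ws)
    then have "lift b \<odot>\<^bsub>?W\<^esub> \<psi> (res_d R N (Suc 0) m) = \<zero>\<^bsub>?W\<^esub>" using lift bN by (simp add: Ws N_simps)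
    then show "\<Lambda> (tensor_map R (?P (Suc 0)) N (res_d R N (Suc 0)) id
        (pure_tensor R (?P (Suc (Suc 0))) N m b)) = \<zero>\<^bsub>quot_module ?W ?J\<^esub>"
      using m bN dm JS.a_rcos_const[OF JS.zero_closed]
      by (simp add: tensor_map_pure[OF N.d_lin id] \<Lambda>_def b.tensor_lift_pure)
        (simp add: quot_module_def)
  qed
  moreover have "\<Lambda> ?z = ?J +>\<^bsub>?W\<^esub> (lift \<one>\<^bsub>B\<^esub> \<odot>\<^bsub>?W\<^esub> \<psi> v)"
    unfolding \<Lambda>_def by (rule b.tensor_lift_pure[OF v(1) one])
  ultimately have *: "?J +>\<^bsub>?W\<^esub> (lift \<one>\<^bsub>B\<^esub> \<odot>\<^bsub>?W\<^esub> \<psi> v) = ?J"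
    unfolding w(2) by (simp add: quot_module_def)
  \<comment> \<open>The lift of one enters twice, through \<open>quot_bilin\<close> and through
    \<open>c\<close>. The class that vanishes is therefore that of \<open>l (x l)\<close>, from
    which \<open>x\<close> still has to be recovered.\<close>
  define l where "l = lift \<one>\<^bsub>B\<^esub>"
  have l: "l \<in> carrier R" "h l = \<one>\<^bsub>B\<^esub>" using lift by (simp_all add: l_def)
  have "\<psi> v = x \<otimes> lift \<one>\<^bsub>B\<^esub>"
  proof -
    have "\<psi>0 e = \<one> \<otimes> c (Elt \<one>\<^bsub>B\<^esub>)"
      unfolding \<psi>0_def e_def using W.lin_ext_single[OF cf Elt, of \<one>] by (simp add: Ws)
    then show ?thesis using v e xR lift by (simp add: \<psi>_def p0.smult Ws c_def)
  qed
  with * have "lift \<one>\<^bsub>B\<^esub> \<otimes> (x \<otimes> lift \<one>\<^bsub>B\<^esub>) \<in> ?J"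
    using JS.a_rcos_self[of "lift \<one>\<^bsub>B\<^esub> \<otimes> (x \<otimes> lift \<one>\<^bsub>B\<^esub>)"] lift xR by (simp add: Ws)
  moreover have "(\<one> \<ominus> l \<otimes> l) \<otimes> x \<in> ?J"
  proof (rule ideal_prod.prod[OF _ x])
    show "\<one> \<ominus> l \<otimes> l \<in> I" using l by (simp add: I_iff a_minus_def B.r_neg)
  qed
  ultimately have "l \<otimes> (x \<otimes> l) \<oplus> (\<one> \<ominus> l \<otimes> l) \<otimes> x \<in> ?J"
    unfolding l_def[symmetric] by (rule J.a_closed)
  then show "x \<in> ?J" unfolding R.decomp_idem[OF xR(1) l(1)] .
qed

end

section \<open>Partial derivations of domains\<close>

text \<open>Krull's argument: take an ideal \<open>P\<close> maximal among those that miss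
  \<open>S\<close>. If \<open>x\<close> and \<open>y\<close> lie outside \<open>P\<close>, enlarging
  \<open>P\<close> by each of them meets \<open>S\<close>, and the product of the two elements found
  would lie in \<open>P\<close> if \<open>x y\<close> did.\<close>

lemma (in cring) exists_prime_ideal_disjoint:
  assumes S: "S \<subseteq> carrier R" "\<one> \<in> S" "\<zero> \<notin> S" and mult: "\<And>s t. s \<in> S \<Longrightarrow> t \<in> S \<Longrightarrow> s \<otimes> t \<in> S"
  obtains P where "primeideal P R" "P \<inter> S = {}"
proof -
  let ?F = "{J. ideal J R \<and> J \<inter> S = {}}"
  have "\<exists>P\<in>?F. \<forall>J\<in>?F. P \<subseteq> J \<longrightarrow> J = P"
  proof (rule subset_Zorn_nonempty)
    have "{\<zero>} \<in> ?F" using S(3) zeroideal by simp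
    then show "?F \<noteq> {}" by blast
    fix C assume C: "C \<noteq> {}" "subset.chain ?F C"
    then have "subset.chain {J. ideal J R} C" unfolding pred_on.chain_def by blast
    from chain_Union_is_ideal[OF this] C show "\<Union>C \<in> ?F"
      unfolding pred_on.chain_def by auto
  qed
  then obtain P where P: "ideal P R" "P \<inter> S = {}"
    and max: "\<And>J. ideal J R \<Longrightarrow> J \<inter> S = {} \<Longrightarrow> P \<subseteq> J \<Longrightarrow> J = P" by auto
  interpret P: ideal P R by fact
  have meet: "\<exists>p\<in>P. \<exists>r\<in>carrier R. p \<oplus> r \<otimes> x \<in> S" if x: "x \<in> carrier R" "x \<notin> P" for x
  proof -
    let ?J = "set_add R P (PIdl x)"
    have J: "ideal ?J R" by (rule add_ideals[OF P(1) cgenideal_ideal[OF x(1)]])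
    have J_iff: "z \<in> ?J \<longleftrightarrow> (\<exists>p\<in>P. \<exists>r\<in>carrier R. z = p \<oplus> r \<otimes> x)" for z
      by (auto simp: set_add_def' cgenideal_def)
    have "P \<subseteq> ?J"
    proof
      fix p assume p: "p \<in> P"
      then have "p = p \<oplus> \<zero> \<otimes> x" using x P.Icarr by simp
      then show "p \<in> ?J" using p unfolding J_iff by blast
    qed
    moreover have "x \<in> ?J"
    proof -
      have "x = \<zero> \<oplus> \<one> \<otimes> x" using x by simp
      then show ?thesis unfolding J_iff using P.zero_closed by blast
    qed
    ultimately have "?J \<inter> S \<noteq> {}" using max[OF J] x(2) by blast
    then obtain z where "z \<in> ?J" "z \<in> S" by blast
    then show ?thesis using J_iff[of z] by auto
  qed
  have "primeideal P R"
  proof (rule primeidealI[OF P(1) is_cring])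
    show "carrier R \<noteq> P" using P(2) S(2) by auto
    fix x y assume xy: "x \<in> carrier R" "y \<in> carrier R" "x \<otimes> y \<in> P"
    show "x \<in> P \<or> y \<in> P"
    proof (rule ccontr)
      assume "\<not> (x \<in> P \<or> y \<in> P)"
      then obtain p r q t where
        1: "p \<in> P" "r \<in> carrier R" "p \<oplus> r \<otimes> x \<in> S" and 2: "q \<in> P" "t \<in> carrier R" "q \<oplus> t \<otimes> y \<in> S"
        using meet xy(1,2) by meson
      have c: "p \<in> carrier R" "q \<in> carrier R" using 1 2 P.Icarr by auto
      have "(p \<oplus> r \<otimes> x) \<otimes> (q \<oplus> t \<otimes> y) = (p \<otimes> (q \<oplus> t \<otimes> y) \<oplus> (r \<otimes> x) \<otimes> q) \<oplus> (r \<otimes> t) \<otimes> (x \<otimes> y)"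
        using c 1(2) 2(2) xy by algebra
      moreover have "(p \<otimes> (q \<oplus> t \<otimes> y) \<oplus> (r \<otimes> x) \<otimes> q) \<oplus> (r \<otimes> t) \<otimes> (x \<otimes> y) \<in> P"
      proof (intro P.a_closed)
        show "p \<otimes> (q \<oplus> t \<otimes> y) \<in> P" using 1(1) 2(2) c xy by (intro P.I_r_closed) auto
        show "(r \<otimes> x) \<otimes> q \<in> P" using 2(1) 1(2) xy by (intro P.I_l_closed) auto
        show "(r \<otimes> t) \<otimes> (x \<otimes> y) \<in> P" using 1(2) 2(2) by (simp add: P.I_l_closed[OF xy(3)])
      qed
      ultimately show False using mult[OF 1(3) 2(3)] P(2) by auto
    qed
  qed
  then show ?thesis using P(2) that by blast
qed

section \<open>Polynomials as coefficient lists, their derivatives, and adjunction of an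
  element\<close>

text \<open>Polynomials are coefficient lists, constant term first.\<close>

fun horner :: "('a, 'm) ring_scheme \<Rightarrow> 'a list \<Rightarrow> 'a \<Rightarrow> 'a" where
  "horner R [] x = \<zero>\<^bsub>R\<^esub>"
| "horner R (c # cs) x = c \<oplus>\<^bsub>R\<^esub> x \<otimes>\<^bsub>R\<^esub> horner R cs x"

text \<open>Two forms of the derivative are needed: this value follows the recursion of evaluation
  in dual numbers and of difference quotients, while \<open>poly_deriv\<close> yields a list to
  which arguments by length apply.\<close>

fun horner_deriv :: "('a, 'm) ring_scheme \<Rightarrow> 'a list \<Rightarrow> 'a \<Rightarrow> 'a" where
  "horner_deriv R [] x = \<zero>\<^bsub>R\<^esub>"
| "horner_deriv R (c # cs) x = horner R cs x \<oplus>\<^bsub>R\<^esub> x \<otimes>\<^bsub>R\<^esub> horner_deriv R cs x"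

fun poly_add :: "('a, 'm) ring_scheme \<Rightarrow> 'a list \<Rightarrow> 'a list \<Rightarrow> 'a list" where
  "poly_add R [] ds = ds"
| "poly_add R (c # cs) [] = c # cs"
| "poly_add R (c # cs) (d # ds) = (c \<oplus>\<^bsub>R\<^esub> d) # poly_add R cs ds"

text \<open>For \<open>p\<close> with coefficient list \<open>cs\<close>, the coefficients of \<open>(X^m p)' / X^(m - 1)\<close>.\<close>

fun poly_deriv :: "('a, 'm) ring_scheme \<Rightarrow> nat \<Rightarrow> 'a list \<Rightarrow> 'a list" where
  "poly_deriv R m [] = []"
| "poly_deriv R m (c # cs) = add_pow R m c # poly_deriv R (Suc m) cs"

lemma length_poly_add: "length (poly_add R cs ds) = max (length cs) (length ds)"
  by (induction R cs ds rule: poly_add.induct) auto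

lemma length_poly_deriv [simp]: "length (poly_deriv R m cs) = length cs"
  by (induction cs arbitrary: m) auto

lemma poly_add_subset:
  assumes "\<And>x y. x \<in> H \<Longrightarrow> y \<in> H \<Longrightarrow> x \<oplus>\<^bsub>R\<^esub> y \<in> H" "set cs \<subseteq> H" "set ds \<subseteq> H"
  shows "set (poly_add R cs ds) \<subseteq> H"
  using assms(2,3)
proof (induction cs arbitrary: ds)
  case (Cons c cs)
  then show ?case by (cases ds) (auto intro: assms(1))
qed simp

context cring
begin

lemma horner_closed: "set cs \<subseteq> carrier R \<Longrightarrow> x \<in> carrier R \<Longrightarrow> horner R cs x \<in> carrier R"
  by (induction cs) auto

lemma horner_deriv_closed: "set cs \<subseteq> carrier R \<Longrightarrow> x \<in> carrier R \<Longrightarrow> horner_deriv R cs x \<in> carrier R"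
  by (induction cs) (auto simp: horner_closed)

lemma horner_zeros: "set cs \<subseteq> {\<zero>} \<Longrightarrow> x \<in> carrier R \<Longrightarrow> horner R cs x = \<zero>"
  by (induction cs) auto

lemma horner_add:
  assumes "set cs \<subseteq> carrier R" "set ds \<subseteq> carrier R" "x \<in> carrier R"
  shows "horner R (poly_add R cs ds) x = horner R cs x \<oplus> horner R ds x"
  using assms
proof (induction cs arbitrary: ds)
  case (Cons c cs)
  then show ?case by (cases ds) (auto simp: horner_closed r_distr a_ac)
qed (simp add: horner_closed)

lemma horner_smult:
  assumes "set cs \<subseteq> carrier R" "u \<in> carrier R" "x \<in> carrier R"
  shows "horner R (map ((\<otimes>) u) cs) x = u \<otimes> horner R cs x"
  using assms by (induction cs) (auto simp: horner_closed r_distr m_lcomm)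

lemma poly_deriv_subset:
  assumes "subring H R" "set cs \<subseteq> H"
  shows "set (poly_deriv R m cs) \<subseteq> H"
proof -
  have "add_pow R n c \<in> H" if "c \<in> H" for n :: nat and c
    using that subringE(1,2,7)[OF assms(1)] by (induction n) (auto simp: subset_iff add.nat_pow_Suc)
  then show ?thesis using assms(2) by (induction cs arbitrary: m) auto
qed

text \<open>The weight \<open>m\<close> has to vary in the induction: the tail carries one more
  factor \<open>X\<close>, whose derivative contributes one more copy of the value.\<close>

lemma horner_poly_deriv:
  assumes "set cs \<subseteq> carrier R" "x \<in> carrier R"
  shows "horner R (poly_deriv R m cs) x = add_pow R m (horner R cs x) \<oplus> x \<otimes> horner_deriv R cs x"
  using assms
proof (induction cs arbitrary: m)
  case (Cons c cs)
  let ?h = "horner R cs x" and ?d = "horner_deriv R cs x"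
  have c: "c \<in> carrier R" "?h \<in> carrier R" "?d \<in> carrier R" "x \<in> carrier R"
    using Cons.prems by (simp_all add: horner_closed horner_deriv_closed)
  have "horner R (poly_deriv R m (c # cs)) x =
      add_pow R m c \<oplus> x \<otimes> ((add_pow R m ?h \<oplus> ?h) \<oplus> x \<otimes> ?d)"
    using Cons c by (simp add: add.nat_pow_Suc)
  also have "\<dots> = (add_pow R m c \<oplus> x \<otimes> add_pow R m ?h) \<oplus> x \<otimes> (?h \<oplus> x \<otimes> ?d)"
    using c by (simp add: r_distr a_ac)
  also have "x \<otimes> add_pow R m ?h = add_pow R m (x \<otimes> ?h)"
    using c by (simp add: add_pow_rdistr)
  also have "add_pow R m c \<oplus> add_pow R m (x \<otimes> ?h) = add_pow R m (c \<oplus> x \<otimes> ?h)"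
    using c by (simp add: add.nat_pow_distrib)
  finally show ?case by simp
qed simp

text \<open>Weight one belongs to \<open>X p\<close>, which has the same derivative as
  \<open>c + X p\<close>. The new list is shorter by one; minimality and induction on length both
  rely on this.\<close>

lemma horner_deriv_Cons:
  assumes "set cs \<subseteq> carrier R" "x \<in> carrier R"
  shows "horner_deriv R (c # cs) x = horner R (poly_deriv R 1 cs) x"
  using assms horner_poly_deriv[OF assms, of 1] by (simp add: horner_closed add.nat_pow_Suc)

text \<open>Elimination at the constant term: \<open>v u(X) - u v(X)\<close> has no constant term,
  so \<open>X\<close> splits off. It replaces division with remainder and works over any coefficient
  ring.\<close>

lemma horner_eliminate:
  assumes "set (u # us) \<subseteq> carrier R" "set (v # vs) \<subseteq> carrier R" "x \<in> carrier R"
    and 0: "horner R (v # vs) x = \<zero>"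
  shows "v \<otimes> horner R (u # us) x =
    x \<otimes> horner R (poly_add R (map ((\<otimes>) v) us) (map ((\<otimes>) (\<ominus> u)) vs)) x"
proof -
  let ?U = "horner R us x" and ?V = "horner R vs x"
  have c: "u \<in> carrier R" "v \<in> carrier R" "?U \<in> carrier R" "?V \<in> carrier R" "x \<in> carrier R"
    using assms(1-3) by (simp_all add: horner_closed)
  have "horner R (poly_add R (map ((\<otimes>) v) us) (map ((\<otimes>) (\<ominus> u)) vs)) x = v \<otimes> ?U \<oplus> (\<ominus> u) \<otimes> ?V"
    using assms(1-3) by (subst horner_add) (auto simp: horner_smult)
  moreover have "v \<otimes> (u \<oplus> x \<otimes> ?U) \<oplus> (\<ominus> u) \<otimes> (v \<oplus> x \<otimes> ?V) = x \<otimes> (v \<otimes> ?U \<oplus> (\<ominus> u) \<otimes> ?V)"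
    using c by algebra
  ultimately show ?thesis using 0 c by simp
qed

definition adjoin :: "'a set \<Rightarrow> 'a \<Rightarrow> 'a set" where
  "adjoin H x = {horner R cs x | cs. set cs \<subseteq> H}"

lemma adjoin_superset:
  assumes "H \<subseteq> carrier R" "x \<in> carrier R"
  shows "H \<subseteq> adjoin H x"
proof
  fix h assume h: "h \<in> H"
  then have "h = horner R [h] x" using assms by auto
  then show "h \<in> adjoin H x" using h unfolding adjoin_def by fastforce
qed

lemma adjoin_mem:
  assumes "subring H R" "x \<in> carrier R"
  shows "x \<in> adjoin H x"
proof -
  have "x = horner R [\<zero>, \<one>] x" using assms by simp
  moreover have "set [\<zero>, \<one>] \<subseteq> H" using subringE(2,3)[OF assms(1)] by simp
  ultimately show ?thesis unfolding adjoin_def by blast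
qed

lemma adjoin_subring:
  assumes H: "subring H R" and x: "x \<in> carrier R"
  shows "subring (adjoin H x) R"
proof (rule subringI)
  note HE = subringE[OF H]
  have car: "horner R cs x \<in> carrier R" if "set cs \<subseteq> H" for cs
    using that HE(1) x by (intro horner_closed) auto
  show "adjoin H x \<subseteq> carrier R" using car by (auto simp: adjoin_def)
  show "\<one> \<in> adjoin H x" using adjoin_superset[OF HE(1) x] HE(3) by blast
  have smult: "u \<otimes> h \<in> adjoin H x" if u: "u \<in> H" and h: "h \<in> adjoin H x" for u h
  proof -
    obtain cs where cs: "set cs \<subseteq> H" "h = horner R cs x" using h by (auto simp: adjoin_def)
    then have "u \<otimes> h = horner R (map ((\<otimes>) u) cs) x" using u HE(1) x by (subst horner_smult) auto
    moreover have "set (map ((\<otimes>) u) cs) \<subseteq> H" using cs u HE(6) by auto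
    ultimately show ?thesis unfolding adjoin_def by blast
  qed
  show add: "h \<oplus> h' \<in> adjoin H x" if h: "h \<in> adjoin H x" "h' \<in> adjoin H x" for h h'
  proof -
    obtain cs ds where cs: "set cs \<subseteq> H" "h = horner R cs x" "set ds \<subseteq> H" "h' = horner R ds x"
      using h unfolding adjoin_def by blast
    then have "h \<oplus> h' = horner R (poly_add R cs ds) x" using HE(1) x by (subst horner_add) auto
    moreover have "set (poly_add R cs ds) \<subseteq> H" by (rule poly_add_subset) (use HE(7) cs in auto)
    ultimately show ?thesis unfolding adjoin_def by blast
  qed
  have shift: "x \<otimes> h \<in> adjoin H x" if h: "h \<in> adjoin H x" for h
  proof -
    obtain cs where cs: "set cs \<subseteq> H" "h = horner R cs x" using h by (auto simp: adjoin_def)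
    then have "x \<otimes> h = horner R (\<zero> # cs) x" using car x by simp
    moreover have "set (\<zero> # cs) \<subseteq> H" using cs HE(2) by simp
    ultimately show ?thesis unfolding adjoin_def by blast
  qed
  show "h \<otimes> h' \<in> adjoin H x" if h: "h \<in> adjoin H x" and h': "h' \<in> adjoin H x" for h h'
  proof -
    obtain cs where cs: "set cs \<subseteq> H" "h = horner R cs x" using h by (auto simp: adjoin_def)
    have h'c: "h' \<in> carrier R" using h' car by (auto simp: adjoin_def)
    from cs(1) have "horner R cs x \<otimes> h' \<in> adjoin H x"
    proof (induction cs)
      case Nil
      show ?case using h'c adjoin_superset[OF HE(1) x] HE(2) by auto
    next
      case (Cons c cs)
      have "(c \<oplus> x \<otimes> horner R cs x) \<otimes> h' = c \<otimes> h' \<oplus> x \<otimes> (horner R cs x \<otimes> h')"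
        using Cons.prems HE(1) x car h'c by (simp add: l_distr m_assoc subset_iff)
      then show ?case using Cons by (auto intro!: add smult shift h')
    qed
    then show ?thesis using cs by simp
  qed
  show "\<ominus> h \<in> adjoin H x" if "h \<in> adjoin H x" for h
  proof -
    have "h \<in> carrier R" using that car by (auto simp: adjoin_def)
    then have "\<ominus> h = (\<ominus> \<one>) \<otimes> h" by (simp add: l_minus)
    then show ?thesis using smult[of "\<ominus> \<one>" h] HE(3,5) that by simp
  qed
qed

end

section \<open>Dual numbers and graphs of derivations\<close>

definition dual :: "('a, 'm) ring_scheme \<Rightarrow> ('a \<times> 'a) ring" where
  "dual R = \<lparr>carrier = carrier R \<times> carrier R,
     mult = (\<lambda>(a, a') (b, b'). (a \<otimes>\<^bsub>R\<^esub> b, a \<otimes>\<^bsub>R\<^esub> b' \<oplus>\<^bsub>R\<^esub> a' \<otimes>\<^bsub>R\<^esub> b)),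
     one = (\<one>\<^bsub>R\<^esub>, \<zero>\<^bsub>R\<^esub>), zero = (\<zero>\<^bsub>R\<^esub>, \<zero>\<^bsub>R\<^esub>),
     add = (\<lambda>(a, a') (b, b'). (a \<oplus>\<^bsub>R\<^esub> b, a' \<oplus>\<^bsub>R\<^esub> b'))\<rparr>"

lemma dual_simps [simp]:
  "carrier (dual R) = carrier R \<times> carrier R"
  "(a, a') \<otimes>\<^bsub>dual R\<^esub> (b, b') = (a \<otimes>\<^bsub>R\<^esub> b, a \<otimes>\<^bsub>R\<^esub> b' \<oplus>\<^bsub>R\<^esub> a' \<otimes>\<^bsub>R\<^esub> b)"
  "(a, a') \<oplus>\<^bsub>dual R\<^esub> (b, b') = (a \<oplus>\<^bsub>R\<^esub> b, a' \<oplus>\<^bsub>R\<^esub> b')"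
  "\<one>\<^bsub>dual R\<^esub> = (\<one>\<^bsub>R\<^esub>, \<zero>\<^bsub>R\<^esub>)" "\<zero>\<^bsub>dual R\<^esub> = (\<zero>\<^bsub>R\<^esub>, \<zero>\<^bsub>R\<^esub>)"
  by (simp_all add: dual_def)

context cring
begin

lemma dual_cring: "cring (dual R)"
proof (rule cringI)
  show "abelian_group (dual R)"
  proof (rule abelian_groupI)
    fix x assume "x \<in> carrier (dual R)"
    then show "\<exists>y\<in>carrier (dual R). y \<oplus>\<^bsub>dual R\<^esub> x = \<zero>\<^bsub>dual R\<^esub>"
      by (intro bexI[of _ "(\<ominus> fst x, \<ominus> snd x)"]) (auto simp: l_neg)
  qed (auto simp: a_ac)
  show "comm_monoid (dual R)"
    by (rule comm_monoidI) (auto simp: r_distr l_distr m_ac a_ac)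
qed (auto simp: l_distr a_ac)

lemma dual_minus: "a \<in> carrier R \<Longrightarrow> a' \<in> carrier R \<Longrightarrow> \<ominus>\<^bsub>dual R\<^esub> (a, a') = (\<ominus> a, \<ominus> a')"
proof -
  interpret D: cring "dual R" by (rule dual_cring)
  assume "a \<in> carrier R" "a' \<in> carrier R"
  then show ?thesis by (intro D.minus_equality) (auto simp: l_neg)
qed

text \<open>First-order Taylor expansion. With second components of the coefficients read as their
  derivatives, the second component is the usual formula for the derivative of \<open>p(b)\<close>
  when \<open>b\<close> has derivative \<open>\<beta>\<close>.\<close>

lemma horner_dual:
  assumes "set ps \<subseteq> carrier R \<times> carrier R" "b \<in> carrier R" "\<beta> \<in> carrier R"
  shows "horner (dual R) ps (b, \<beta>) =
    (horner R (map fst ps) b,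
     horner R (map snd ps) b \<oplus> horner_deriv R (map fst ps) b \<otimes> \<beta>)"
  using assms
proof (induction ps)
  case (Cons p ps)
  obtain c c' where p: "p = (c, c')" by force
  have "set (map fst ps) \<subseteq> carrier R" "set (map snd ps) \<subseteq> carrier R" using Cons.prems by auto
  then have c: "horner R (map fst ps) b \<in> carrier R" "horner R (map snd ps) b \<in> carrier R"
      "horner_deriv R (map fst ps) b \<in> carrier R" "c \<in> carrier R" "c' \<in> carrier R"
    using Cons.prems p by (auto simp: horner_closed horner_deriv_closed)
  then show ?case using Cons
    by (simp add: p r_distr l_distr a_ac m_ac)
qed auto

text \<open>A single-valued subring of the dual numbers is the graph of a derivation defined on a
  subring of \<open>R\<close>.\<close>

definition deriv_graph :: "('a \<times> 'a) set \<Rightarrow> bool" where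
  "deriv_graph G \<longleftrightarrow> subring G (dual R) \<and> (\<forall>\<gamma>. (\<zero>, \<gamma>) \<in> G \<longrightarrow> \<gamma> = \<zero>)"

lemma deriv_graph_subring: "deriv_graph G \<Longrightarrow> subring G (dual R)"
  by (simp add: deriv_graph_def)

lemma deriv_graph_fst_subring:
  assumes "deriv_graph G" shows "subring (fst ` G) R"
proof -
  note GE = subringE[OF deriv_graph_subring[OF assms]]
  show ?thesis
  proof (rule subringI)
    show "fst ` G \<subseteq> carrier R" using GE(1) by auto
    show "\<one> \<in> fst ` G" using GE(3) by force
    show "\<ominus> h \<in> fst ` G" if "h \<in> fst ` G" for h
    proof -
      obtain h' where h: "(h, h') \<in> G" using \<open>h \<in> fst ` G\<close> by auto
      then have "(\<ominus> h, \<ominus> h') \<in> G" using GE(1) GE(5)[OF h] by (auto simp: dual_minus)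
      then show ?thesis by force
    qed
    fix h k assume "h \<in> fst ` G" "k \<in> fst ` G"
    then obtain h' k' where "(h, h') \<in> G" "(k, k') \<in> G" by auto
    with GE(6)[OF this] GE(7)[OF this] show "h \<otimes> k \<in> fst ` G" "h \<oplus> k \<in> fst ` G"
      by (auto simp: image_iff Bex_def)
  qed
qed

lemma deriv_graph_adjoin:
  assumes G: "deriv_graph G" and w: "w \<in> carrier (dual R)"
    and single: "\<And>ps. set ps \<subseteq> G \<Longrightarrow> fst (horner (dual R) ps w) = \<zero> \<Longrightarrow> snd (horner (dual R) ps w) = \<zero>"
  shows "deriv_graph (cring.adjoin (dual R) G w)"
proof -
  interpret D: cring "dual R" by (rule dual_cring)
  show ?thesis
    unfolding deriv_graph_def
  proof (intro conjI allI impI)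
    show "subring (D.adjoin G w) (dual R)" by (rule D.adjoin_subring[OF deriv_graph_subring[OF G] w])
    fix \<gamma> assume "(\<zero>, \<gamma>) \<in> D.adjoin G w"
    then obtain ps where ps: "set ps \<subseteq> G" "horner (dual R) ps w = (\<zero>, \<gamma>)" by (auto simp: D.adjoin_def)
    then show "\<gamma> = \<zero>" using single[OF ps(1)] by simp
  qed
qed

text \<open>No relation constrains the value at \<open>b\<close>, so it may be prescribed freely:
  once the first components of all coefficients vanish, single-valuedness of \<open>G\<close> makes
  the second ones vanish.\<close>

lemma deriv_graph_adjoin_transcendental:
  assumes G: "deriv_graph G" and b: "b \<in> carrier R" "\<beta> \<in> carrier R"
    and tr: "\<And>cs. set cs \<subseteq> fst ` G \<Longrightarrow> horner R cs b = \<zero> \<Longrightarrow> set cs \<subseteq> {\<zero>}"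
  shows "deriv_graph (cring.adjoin (dual R) G (b, \<beta>))"
proof (rule deriv_graph_adjoin[OF G])
  interpret D: cring "dual R" by (rule dual_cring)
  fix ps assume ps: "set ps \<subseteq> G" "fst (horner (dual R) ps (b, \<beta>)) = \<zero>"
  have GR: "G \<subseteq> carrier R \<times> carrier R" using subringE(1)[OF deriv_graph_subring[OF G]] by simp
  have "horner R (map fst ps) b = \<zero>" using ps b GR by (subst (asm) horner_dual) auto
  moreover have "set (map fst ps) \<subseteq> fst ` G" using ps(1) by auto
  ultimately have "set (map fst ps) \<subseteq> {\<zero>}" by (intro tr)
  then have "p = (\<zero>, \<zero>)" if "p \<in> set ps" for p
    using that G ps(1) unfolding deriv_graph_def by (cases p) fastforce
  then have "set ps \<subseteq> {\<zero>\<^bsub>dual R\<^esub>}" by auto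
  then show "snd (horner (dual R) ps (b, \<beta>)) = \<zero>" using D.horner_zeros b by simp
qed (use b in simp)

text \<open>A multiple of a derivation is a derivation; this is how denominators are
  cleared.\<close>

lemma deriv_graph_scale:
  assumes G: "deriv_graph G" and s: "s \<in> carrier R"
  shows "deriv_graph ((\<lambda>(c, \<gamma>). (c, s \<otimes> \<gamma>)) ` G)"
proof -
  interpret D: cring "dual R" by (rule dual_cring)
  note GE = subringE[OF deriv_graph_subring[OF G]]
  have mem: "(c, s \<otimes> \<gamma>) \<in> (\<lambda>(c, \<gamma>). (c, s \<otimes> \<gamma>)) ` G" if "(c, \<gamma>) \<in> G" for c \<gamma>
    using that by force
  have "subring ((\<lambda>(c, \<gamma>). (c, s \<otimes> \<gamma>)) ` G) (dual R)"
  proof (rule D.subringI)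
    show "(\<lambda>(c, \<gamma>). (c, s \<otimes> \<gamma>)) ` G \<subseteq> carrier (dual R)" using GE(1) s by auto
    show "\<one>\<^bsub>dual R\<^esub> \<in> (\<lambda>(c, \<gamma>). (c, s \<otimes> \<gamma>)) ` G" using mem[of \<one> \<zero>] GE(3) s by simp
    fix h assume "h \<in> (\<lambda>(c, \<gamma>). (c, s \<otimes> \<gamma>)) ` G"
    then obtain c \<gamma> where h: "(c, \<gamma>) \<in> G" "h = (c, s \<otimes> \<gamma>)" by auto
    have c: "c \<in> carrier R" "\<gamma> \<in> carrier R" using h GE(1) by auto
    have "(\<ominus> c, \<ominus> \<gamma>) \<in> G" using GE(5)[OF h(1)] c by (simp add: dual_minus)
    then show "\<ominus>\<^bsub>dual R\<^esub> h \<in> (\<lambda>(c, \<gamma>). (c, s \<otimes> \<gamma>)) ` G"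
      using mem[of "\<ominus> c" "\<ominus> \<gamma>"] c s h by (simp add: dual_minus r_minus)
    fix k assume "k \<in> (\<lambda>(c, \<gamma>). (c, s \<otimes> \<gamma>)) ` G"
    then obtain d \<delta> where k: "(d, \<delta>) \<in> G" "k = (d, s \<otimes> \<delta>)" by auto
    have d: "d \<in> carrier R" "\<delta> \<in> carrier R" using k GE(1) by auto
    show "h \<otimes>\<^bsub>dual R\<^esub> k \<in> (\<lambda>(c, \<gamma>). (c, s \<otimes> \<gamma>)) ` G"
      using mem[of "c \<otimes> d" "c \<otimes> \<delta> \<oplus> \<gamma> \<otimes> d"] GE(6)[OF h(1) k(1)] c d s h k
      by (simp add: r_distr m_ac)
    show "h \<oplus>\<^bsub>dual R\<^esub> k \<in> (\<lambda>(c, \<gamma>). (c, s \<otimes> \<gamma>)) ` G"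
      using mem[of "c \<oplus> d" "\<gamma> \<oplus> \<delta>"] GE(7)[OF h(1) k(1)] c d s h k by (simp add: r_distr)
  qed
  then show ?thesis using G s unfolding deriv_graph_def by auto
qed

end

section \<open>Construction of partial derivations on a domain of characteristic 0\<close>

definition partial_derivation ::
  "('q, 'n) ring_scheme \<Rightarrow> 'q set \<Rightarrow> 'q set \<Rightarrow> ('q \<Rightarrow> 'q) \<Rightarrow> bool" where
  "partial_derivation Q K X \<delta> \<longleftrightarrow> \<delta> \<in> carrier Q \<rightarrow> carrier Q \<and>
    (\<forall>x\<in>carrier Q. \<forall>y\<in>carrier Q. \<delta> (x \<oplus>\<^bsub>Q\<^esub> y) = \<delta> x \<oplus>\<^bsub>Q\<^esub> \<delta> y) \<and>
    (\<forall>c\<in>K. \<forall>x\<in>carrier Q. \<delta> (c \<otimes>\<^bsub>Q\<^esub> x) = c \<otimes>\<^bsub>Q\<^esub> \<delta> x) \<and>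
    (\<forall>x\<in>X. \<forall>y\<in>X. \<delta> (x \<otimes>\<^bsub>Q\<^esub> y) = x \<otimes>\<^bsub>Q\<^esub> \<delta> y \<oplus>\<^bsub>Q\<^esub> \<delta> x \<otimes>\<^bsub>Q\<^esub> y)"

lemma partial_derivation_mono: "partial_derivation Q K Y \<delta> \<Longrightarrow> X \<subseteq> Y \<Longrightarrow> partial_derivation Q K X \<delta>"
  unfolding partial_derivation_def by blast

context domain
begin

text \<open>If \<open>p'(b) = 0\<close>, the shorter list of \<open>p'\<close> is zero by
  minimality. Characteristic 0 then kills every coefficient of \<open>p\<close> except the constant
  one, and \<open>p(b) = 0\<close> kills that.\<close>

lemma horner_deriv_nonzero:
  assumes ch: "char_zero R" and B: "subring B R" and b: "b \<in> carrier R"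
    and cs: "set cs \<subseteq> B" "horner R cs b = \<zero>" "\<not> set cs \<subseteq> {\<zero>}"
    and min: "\<And>ds. set ds \<subseteq> B \<Longrightarrow> length ds < length cs \<Longrightarrow> horner R ds b = \<zero> \<Longrightarrow> set ds \<subseteq> {\<zero>}"
  shows "horner_deriv R cs b \<noteq> \<zero>"
proof
  assume 0: "horner_deriv R cs b = \<zero>"
  obtain c cs' where c: "cs = c # cs'" using cs(3) by (cases cs) auto
  note BR = subringE(1)[OF B]
  have cs'R: "set cs' \<subseteq> carrier R" using cs(1) c BR by auto
  have "horner R (poly_deriv R 1 cs') b = \<zero>"
    using 0 horner_deriv_Cons[OF cs'R b] by (simp add: c)
  moreover have "set (poly_deriv R 1 cs') \<subseteq> B"
    using poly_deriv_subset[OF B] cs(1) c by simp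
  ultimately have z: "set (poly_deriv R 1 cs') \<subseteq> {\<zero>}" by (intro min) (simp_all add: c)
  have inj: "x = \<zero>" if "add_pow R m x = \<zero>" "x \<in> carrier R" "m > 0" for m :: nat and x
  proof -
    have "add_pow R m \<one> \<otimes> x = \<zero>" using that by (simp add: add_pow_ldistr)
    moreover have "add_pow R m \<one> \<noteq> \<zero>" using ch that(3) by (simp add: char_zero_def)
    ultimately show ?thesis using that(2) integral[of "add_pow R m \<one>" x] by auto
  qed
  have "set ds \<subseteq> {\<zero>}" if "set (poly_deriv R m ds) \<subseteq> {\<zero>}" "set ds \<subseteq> carrier R" "m > 0" for m ds
    using that by (induction ds arbitrary: m) (auto intro: inj)
  from this[OF z cs'R] have "set cs' \<subseteq> {\<zero>}" by simp
  moreover from this have "c = \<zero>" using cs(1,2) BR b by (simp add: c horner_zeros subset_iff)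
  ultimately show False using cs(3) by (simp add: c)
qed

text \<open>If \<open>b\<close> is algebraic, take \<open>p\<close> of minimal length with \<open>p(b) = 0\<close>.  The derivation extends to
  \<open>b\<close> after multiplying it by \<open>p'(b)\<close>, in place of dividing the value at \<open>b\<close> by \<open>p'(b)\<close>.\<close>

lemma deriv_graph_extend:
  assumes ch: "char_zero R" and G: "deriv_graph G" and b: "b \<in> carrier R"
  obtains s G' where "s \<in> carrier R" "s \<noteq> \<zero>" "deriv_graph G'" "b \<in> fst ` G'"
    "(\<lambda>(c, \<gamma>). (c, s \<otimes> \<gamma>)) ` G \<subseteq> G'"
\<comment> \<open>\<open>b = 0\<close> is set aside because the algebraic case cancels factors
  \<open>b\<close>. In the first branch nothing is scaled: \<open>s = 1\<close>, and a
  transcendental \<open>b\<close> receives the value zero.\<close>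
proof (cases "b = \<zero> \<or> (\<forall>cs. set cs \<subseteq> fst ` G \<longrightarrow> horner R cs b = \<zero> \<longrightarrow> set cs \<subseteq> {\<zero>})")
  case True
  interpret D: cring "dual R" by (rule dual_cring)
  note GE = subringE[OF deriv_graph_subring[OF G]]
  have id: "(\<lambda>(c, \<gamma>). (c, \<one> \<otimes> \<gamma>)) ` G = G" using GE(1) by (force simp: image_iff)
  show ?thesis
  proof (cases "b = \<zero>")
    case True
    then have "b \<in> fst ` G" using GE(2) by force
    then show ?thesis using that[of \<one> G] G id by simp
  next
    case False
    with \<open>b = \<zero> \<or> _\<close> have tr: "\<And>cs. set cs \<subseteq> fst ` G \<Longrightarrow> horner R cs b = \<zero> \<Longrightarrow> set cs \<subseteq> {\<zero>}" by blast
    have w: "(b, \<zero>) \<in> carrier (dual R)" using b by simp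
    have "b \<in> fst ` D.adjoin G (b, \<zero>)"
      using D.adjoin_mem[OF deriv_graph_subring[OF G] w] by force
    then show ?thesis
      using that[of \<one> "D.adjoin G (b, \<zero>)"] id D.adjoin_superset[OF GE(1) w]
        deriv_graph_adjoin_transcendental[OF G b zero_closed tr] by simp
  qed
next
  case False
  interpret D: cring "dual R" by (rule dual_cring)
  note GE = subringE[OF deriv_graph_subring[OF G]]
  define B where "B = fst ` G"
  have B: "subring B R" unfolding B_def by (rule deriv_graph_fst_subring[OF G])
  note BR = subringE(1)[OF B]
  let ?Q = "\<lambda>cs. set cs \<subseteq> B \<and> horner R cs b = \<zero> \<and> \<not> set cs \<subseteq> {\<zero>}"
  have b0: "b \<noteq> \<zero>" and "\<exists>cs. ?Q cs" using False by (auto simp: B_def)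
  then obtain cs where cs: "?Q cs" and min: "\<And>ds. ?Q ds \<Longrightarrow> length cs \<le> length ds"
    using exists_least_iff[of "\<lambda>n. \<exists>cs. ?Q cs \<and> length cs = n"] by (metis not_less)
  have min': "set ds \<subseteq> {\<zero>}" if "set ds \<subseteq> B" "length ds < length cs" "horner R ds b = \<zero>" for ds
    using min[of ds] that by (meson leD)
  define s where "s = horner_deriv R cs b"
  have csR: "set cs \<subseteq> carrier R" using cs BR by blast
  have s: "s \<in> carrier R" "s \<noteq> \<zero>"
    unfolding s_def using horner_deriv_closed[OF csR b] horner_deriv_nonzero[OF ch B b _ _ _ min'] cs
    by blast+
  have "\<exists>ps. set ps \<subseteq> G \<and> map fst ps = cs"
  proof -
    have "set cs \<subseteq> fst ` G" using cs by (simp add: B_def)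
    then show ?thesis
    proof (induction cs)
      case (Cons c cs)
      then obtain ps g where "set ps \<subseteq> G" "map fst ps = cs" "g \<in> G" "fst g = c" by auto
      then show ?case by (intro exI[of _ "g # ps"]) auto
    qed simp
  qed
  then obtain ps0 where ps0: "set ps0 \<subseteq> G" "map fst ps0 = cs" by blast
  let ?\<sigma> = "\<lambda>(c, \<gamma>). (c, s \<otimes> \<gamma>)"
  define H where "H = ?\<sigma> ` G"
  have H: "deriv_graph H" unfolding H_def by (rule deriv_graph_scale[OF G s(1)])
  note HE = subringE[OF deriv_graph_subring[OF H]]
  have HR: "H \<subseteq> carrier R \<times> carrier R" using HE(1) by simp
  have fstH: "fst ` H = B" by (force simp: H_def B_def image_iff)
  \<comment> \<open>\<open>L\<close> is \<open>p\<close> with differentiated coefficients, evaluated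
    at \<open>b\<close>. A derivation D extending the given one must satisfy
    \<open>p'(b) D(b) = - L\<close>; after scaling by \<open>s = p'(b)\<close> the forced value at
    \<open>b\<close> is \<open>- L\<close> itself.\<close>
  define L where "L = horner R (map snd ps0) b"
  have sndR: "set (map snd ps0) \<subseteq> carrier R" using ps0(1) GE(1) by auto
  have L: "L \<in> carrier R" unfolding L_def by (rule horner_closed[OF sndR b])
  define w where "w = (b, \<ominus> L)"
  have w: "w \<in> carrier (dual R)" using b L by (simp add: w_def)
  define ps where "ps = map ?\<sigma> ps0"
  have psH: "set ps \<subseteq> H" using ps0(1) by (auto simp: ps_def H_def)
  have fps: "map fst ps = cs" using ps0(2) by (auto simp: ps_def split_beta)
  have "map snd ps = map ((\<otimes>) s) (map snd ps0)" by (auto simp: ps_def split_beta)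
  then have "horner R (map snd ps) b = s \<otimes> L"
    unfolding L_def by (simp only: horner_smult[OF sndR s(1) b])
  then have "horner (dual R) ps w = (\<zero>, s \<otimes> L \<oplus> s \<otimes> (\<ominus> L))"
    unfolding w_def using psH HR L b cs
    by (subst horner_dual) (auto simp: fps s_def)
  then have ps_w: "horner (dual R) ps w = \<zero>\<^bsub>dual R\<^esub>"
    using s L by (simp add: r_minus r_neg)
  obtain p ps' where p: "ps = p # ps'" using cs fps by (cases ps) auto
  \<comment> \<open>A vanishing constant term would allow a factor \<open>X\<close> to be dropped,
    since \<open>b\<close> is not zero, against minimality.\<close>
  have p0: "fst p \<noteq> \<zero>"
  proof
    assume "fst p = \<zero>"
    have "set (map fst ps) \<subseteq> B" using cs fps by simp
    then have ps'B: "set (map fst ps') \<subseteq> B" by (simp add: p)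
    then have ps'R: "horner R (map fst ps') b \<in> carrier R" using BR b by (intro horner_closed) auto
    have "b \<otimes> horner R (map fst ps') b = \<zero>"
      using cs fps[symmetric] ps'R b by (simp add: p \<open>fst p = \<zero>\<close>)
    then have "horner R (map fst ps') b = \<zero>" using b0 b ps'R integral by blast
    then have "set (map fst ps') \<subseteq> {\<zero>}" using fps by (intro min' ps'B) (auto simp: p)
    then show False using cs fps[symmetric] \<open>fst p = \<zero>\<close> by (simp add: p)
  qed
  \<comment> \<open>Single-valuedness, by induction on the length of \<open>qs\<close>. A list
    shorter than \<open>cs\<close> is zero by minimality. Otherwise eliminating with
    \<open>ps\<close> leaves a shorter list \<open>r\<close>; cancelling \<open>b\<close> shows that
    \<open>r\<close> satisfies the same hypothesis, and cancelling the nonzero constant term of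
    \<open>ps\<close> returns the claim to \<open>qs\<close>.\<close>
  have key: "horner (dual R) qs w = \<zero>\<^bsub>dual R\<^esub>"
    if "set qs \<subseteq> H" "horner R (map fst qs) b = \<zero>" for qs
    using that
  proof (induction qs rule: length_induct)
    case (1 qs)
    show ?case
    proof (cases "length qs < length cs")
      case True
      have "set (map fst qs) \<subseteq> B" using 1 fstH by auto
      then have "set (map fst qs) \<subseteq> {\<zero>}" using True 1 by (intro min') auto
      then have "q = (\<zero>, \<zero>)" if "q \<in> set qs" for q
        using that H 1(2) unfolding deriv_graph_def by (cases q) fastforce
      then have "set qs \<subseteq> {\<zero>\<^bsub>dual R\<^esub>}" by auto
      then show ?thesis using D.horner_zeros w by simp
    next
      case False
      have "length cs = Suc (length ps')" using fps p by auto
      then obtain q qs' where q: "qs = q # qs'" and len: "length ps' \<le> length qs'"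
        using False by (cases qs) auto
      define r where "r = poly_add (dual R) (map ((\<otimes>\<^bsub>dual R\<^esub>) p) qs')
          (map ((\<otimes>\<^bsub>dual R\<^esub>) (\<ominus>\<^bsub>dual R\<^esub> q)) ps')"
      have mem: "p \<in> H" "q \<in> H" "set qs' \<subseteq> H" "set ps' \<subseteq> H" using psH 1(2) p q by auto
      have rH: "set r \<subseteq> H" unfolding r_def
      proof (rule poly_add_subset[OF HE(7)])
        show "set (map ((\<otimes>\<^bsub>dual R\<^esub>) p) qs') \<subseteq> H"
          unfolding set_map using HE(6)[OF mem(1)] mem(3) by blast
        show "set (map ((\<otimes>\<^bsub>dual R\<^esub>) (\<ominus>\<^bsub>dual R\<^esub> q)) ps') \<subseteq> H"
          unfolding set_map using HE(6)[OF HE(5)[OF mem(2)]] mem(4) by blast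
      qed
      have elim: "p \<otimes>\<^bsub>dual R\<^esub> horner (dual R) qs w = w \<otimes>\<^bsub>dual R\<^esub> horner (dual R) r w"
        unfolding q r_def using psH 1(2) HE(1) w ps_w
        by (intro D.horner_eliminate) (auto simp only: p q)
      have rR: "horner (dual R) r w \<in> carrier (dual R)" and qR: "horner (dual R) qs w \<in> carrier (dual R)"
        using rH 1(2) HE(1) w by (auto intro!: D.horner_closed simp del: dual_simps(1))
      have fst_eq: "fst (horner (dual R) us w) = horner R (map fst us) b" if "set us \<subseteq> H" for us
        unfolding w_def using that HR b L by (subst horner_dual) auto
      obtain V where V: "horner (dual R) qs w = (\<zero>, V)" "V \<in> carrier R"
        using fst_eq[OF 1(2)] 1(3) qR by (cases "horner (dual R) qs w") auto
      obtain p1 p2 where pp: "p = (p1, p2)" "p1 \<in> carrier R" "p2 \<in> carrier R" using mem(1) HR by auto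
      obtain r1 r2 where rr: "horner (dual R) r w = (r1, r2)" "r1 \<in> carrier R" "r2 \<in> carrier R"
        using rR by auto
      have "b \<otimes> r1 = \<zero>" using elim V pp rr by (simp add: w_def)
      then have "r1 = \<zero>" using b b0 rr integral by blast
      then have "horner R (map fst r) b = \<zero>" using fst_eq[OF rH] rr by simp
      moreover have "length r < length qs" using len by (simp add: r_def length_poly_add q)
      ultimately have "horner (dual R) r w = \<zero>\<^bsub>dual R\<^esub>" using 1(1) rH by blast
      then have "p1 \<otimes> V = \<zero>" using elim V pp b L by (simp add: w_def)
      then have "V = \<zero>" using p0 pp V(2) integral by auto
      then show ?thesis using V by simp
    qed
  qed
  have "deriv_graph (D.adjoin H w)"
  proof (rule deriv_graph_adjoin[OF H w])
    fix qs assume qs: "set qs \<subseteq> H" "fst (horner (dual R) qs w) = \<zero>"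
    then have "horner R (map fst qs) b = \<zero>"
      unfolding w_def using HR b L by (subst (asm) horner_dual) auto
    then show "snd (horner (dual R) qs w) = \<zero>" using key[OF qs(1)] by simp
  qed
  moreover have "b \<in> fst ` D.adjoin H w"
    using D.adjoin_mem[OF deriv_graph_subring[OF H] w] by (force simp: w_def)
  moreover have "H \<subseteq> D.adjoin H w" by (rule D.adjoin_superset[OF HE(1) w])
  ultimately show ?thesis using that[of s "D.adjoin H w"] s by (simp add: H_def)
qed

text \<open>\<open>a\<close> is adjoined first, with value one, then the elements of
  \<open>X\<close> one at a time. Each step rescales by a nonzero \<open>s\<close>, so in a domain
  the value at \<open>a\<close> stays nonzero, and the zero values on \<open>K\<close> are
  unaffected.\<close>

lemma deriv_graph_finite:
  assumes ch: "char_zero R" and K: "subring K R" and a: "a \<in> carrier R"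
    and tr: "\<And>cs. set cs \<subseteq> K \<Longrightarrow> horner R cs a = \<zero> \<Longrightarrow> set cs \<subseteq> {\<zero>}"
    and X: "finite X" "X \<subseteq> carrier R"
  shows "\<exists>G \<alpha>. deriv_graph G \<and> K \<times> {\<zero>} \<subseteq> G \<and> (a, \<alpha>) \<in> G \<and> \<alpha> \<noteq> \<zero> \<and> X \<subseteq> fst ` G"
  using X
proof (induction X)
  case empty
  interpret D: cring "dual R" by (rule dual_cring)
  note KE = subringE[OF K]
  have "subring (K \<times> {\<zero>}) (dual R)"
    by (rule D.subringI) (use KE in \<open>auto simp: dual_minus subset_iff\<close>)
  then have K0: "deriv_graph (K \<times> {\<zero>})" by (simp add: deriv_graph_def)
  have w: "(a, \<one>) \<in> carrier (dual R)" using a by simp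
  have "deriv_graph (D.adjoin (K \<times> {\<zero>}) (a, \<one>))"
    by (rule deriv_graph_adjoin_transcendental[OF K0 a one_closed]) (use tr in \<open>simp add: fst_image_times\<close>)
  moreover have "K \<times> {\<zero>} \<subseteq> D.adjoin (K \<times> {\<zero>}) (a, \<one>)"
    by (rule D.adjoin_superset[OF _ w]) (use KE in auto)
  moreover have "(a, \<one>) \<in> D.adjoin (K \<times> {\<zero>}) (a, \<one>)"
    by (rule D.adjoin_mem[OF deriv_graph_subring[OF K0] w])
  ultimately show ?case by (intro exI[of _ "D.adjoin (K \<times> {\<zero>}) (a, \<one>)"] exI[of _ \<one>]) auto
next
  case (insert b X)
  then obtain G \<alpha> where G: "deriv_graph G" "K \<times> {\<zero>} \<subseteq> G" "(a, \<alpha>) \<in> G" "\<alpha> \<noteq> \<zero>" "X \<subseteq> fst ` G" by auto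
  have b: "b \<in> carrier R" using insert.prems by simp
  obtain s G' where s: "s \<in> carrier R" "s \<noteq> \<zero>" "deriv_graph G'" "b \<in> fst ` G'"
    "(\<lambda>(c, \<gamma>). (c, s \<otimes> \<gamma>)) ` G \<subseteq> G'" by (rule deriv_graph_extend[OF ch G(1) b])
  have mem: "(c, s \<otimes> \<gamma>) \<in> G'" if "(c, \<gamma>) \<in> G" for c \<gamma> using s(5) that by auto
  have "K \<times> {\<zero>} \<subseteq> G'" using mem[of _ \<zero>] G(2) s(1) by auto
  moreover have "s \<otimes> \<alpha> \<noteq> \<zero>"
    using s G(3,4) subringE(1)[OF deriv_graph_subring[OF G(1)]] integral[of s \<alpha>] by auto
  moreover have "fst ` G \<subseteq> fst ` G'" using mem by force
  ultimately show ?case using s mem[OF G(3)] G(5) by (intro exI[of _ G'] exI[of _ "s \<otimes> \<alpha>"]) auto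
qed

text \<open>Zorn's lemma on graphs of \<open>K\<close>-linear partial maps that contain
  \<open>G\<close>. The Leibniz rule on the domain of \<open>G\<close> survives, because products
  formed there have their values in \<open>G\<close> as well.\<close>

lemma deriv_graph_linear_extension:
  assumes G: "deriv_graph G" and K: "subring K R" "K \<times> {\<zero>} \<subseteq> G"
    and inv: "\<And>c. c \<in> K \<Longrightarrow> c \<noteq> \<zero> \<Longrightarrow> \<exists>d\<in>K. d \<otimes> c = \<one>"
  obtains \<delta> where "\<delta> \<in> carrier R \<rightarrow> carrier R"
    "\<And>x y. x \<in> carrier R \<Longrightarrow> y \<in> carrier R \<Longrightarrow> \<delta> (x \<oplus> y) = \<delta> x \<oplus> \<delta> y"
    "\<And>c x. c \<in> K \<Longrightarrow> x \<in> carrier R \<Longrightarrow> \<delta> (c \<otimes> x) = c \<otimes> \<delta> x"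
    "\<And>x \<gamma>. (x, \<gamma>) \<in> G \<Longrightarrow> \<delta> x = \<gamma>"
proof -
  note GE = subringE[OF deriv_graph_subring[OF G]] and KE = subringE[OF K(1)]
  define good where "good M \<longleftrightarrow> G \<subseteq> M \<and> M \<subseteq> carrier R \<times> carrier R \<and>
      (\<forall>x x' y y'. (x, x') \<in> M \<longrightarrow> (y, y') \<in> M \<longrightarrow> (x \<oplus> y, x' \<oplus> y') \<in> M) \<and>
      (\<forall>c x x'. c \<in> K \<longrightarrow> (x, x') \<in> M \<longrightarrow> (c \<otimes> x, c \<otimes> x') \<in> M) \<and>
      (\<forall>y. (\<zero>, y) \<in> M \<longrightarrow> y = \<zero>)" for M
  have "\<exists>M\<in>{M. good M}. \<forall>M'\<in>{M. good M}. M \<subseteq> M' \<longrightarrow> M' = M"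
  proof (rule subset_Zorn_nonempty)
    have "(c \<otimes> x, c \<otimes> x') \<in> G" if "c \<in> K" "(x, x') \<in> G" for c x x'
    proof -
      have "(c, \<zero>) \<otimes>\<^bsub>dual R\<^esub> (x, x') \<in> G" using GE(6) K(2) that by blast
      moreover have "c \<in> carrier R" "x \<in> carrier R" "x' \<in> carrier R" using that KE(1) GE(1) by auto
      ultimately show ?thesis by simp
    qed
    moreover have "(x \<oplus> y, x' \<oplus> y') \<in> G" if "(x, x') \<in> G" "(y, y') \<in> G" for x x' y y'
      using GE(7)[OF that] by simp
    ultimately have "good G" using G GE(1) by (simp add: good_def deriv_graph_def)
    then show "{M. good M} \<noteq> {}" by blast
    fix C assume C: "C \<noteq> {}" "subset.chain {M. good M} C"
    then have goodC: "\<And>M. M \<in> C \<Longrightarrow> good M" and ch: "\<And>M N. M \<in> C \<Longrightarrow> N \<in> C \<Longrightarrow> M \<subseteq> N \<or> N \<subseteq> M"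
      unfolding pred_on.chain_def by auto
    have "good (\<Union>C)"
      unfolding good_def
    proof (intro conjI allI impI)
      show "G \<subseteq> \<Union>C" using C(1) goodC unfolding good_def by blast
      show "\<Union>C \<subseteq> carrier R \<times> carrier R" using goodC unfolding good_def by blast
      fix x x' y y' assume "(x, x') \<in> \<Union>C" "(y, y') \<in> \<Union>C"
      then obtain M where "M \<in> C" "(x, x') \<in> M" "(y, y') \<in> M" using ch by blast
      then show "(x \<oplus> y, x' \<oplus> y') \<in> \<Union>C" using goodC[of M] unfolding good_def by blast
    next
      fix c x x' assume "c \<in> K" "(x, x') \<in> \<Union>C"
      then show "(c \<otimes> x, c \<otimes> x') \<in> \<Union>C" using goodC unfolding good_def by blast
    next
      fix y assume "(\<zero>, y) \<in> \<Union>C"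
      then show "y = \<zero>" using goodC unfolding good_def by blast
    qed
    then show "\<Union>C \<in> {M. good M}" by simp
  qed
  then obtain M where M: "good M" and max: "\<And>M'. good M' \<Longrightarrow> M \<subseteq> M' \<Longrightarrow> M' = M" by auto
  have GM: "G \<subseteq> M" and MR: "M \<subseteq> carrier R \<times> carrier R"
    and Madd: "\<And>x x' y y'. (x, x') \<in> M \<Longrightarrow> (y, y') \<in> M \<Longrightarrow> (x \<oplus> y, x' \<oplus> y') \<in> M"
    and Msm: "\<And>c x x'. c \<in> K \<Longrightarrow> (x, x') \<in> M \<Longrightarrow> (c \<otimes> x, c \<otimes> x') \<in> M"
    and M0: "\<And>y. (\<zero>, y) \<in> M \<Longrightarrow> y = \<zero>"
    using M unfolding good_def by blast+
  have K1: "\<ominus> \<one> \<in> K" using KE by blast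
  have K0: "(\<zero>, \<zero>) \<in> M" using KE(2) K(2) GM by blast
  have dom: "b \<in> fst ` M" if b: "b \<in> carrier R" for b
  proof (rule ccontr)
    assume nb: "b \<notin> fst ` M"
    \<comment> \<open>\<open>b\<close> receives the value zero. This is consistent because
      \<open>K\<close> is a field: a relation \<open>u + c b = 0\<close> with nonzero
      \<open>c\<close> would place \<open>b\<close> in the domain of \<open>M\<close>.\<close>
    define M' where "M' = {(x \<oplus> c \<otimes> b, x') | x x' c. (x, x') \<in> M \<and> c \<in> K}"
    have "good M'"
      unfolding good_def
    proof (intro conjI allI impI)
      have "M \<subseteq> M'"
      proof
        fix z assume z: "z \<in> M"
        obtain x x' where xx: "z = (x, x')" by force
        have "x = x \<oplus> \<zero> \<otimes> b" using z xx MR b by auto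
        then show "z \<in> M'" unfolding M'_def using z xx KE(2) by blast
      qed
      then show "G \<subseteq> M'" using GM by blast
      show "M' \<subseteq> carrier R \<times> carrier R" using MR b KE(1) by (auto simp: M'_def)
      fix x x' y y' assume "(x, x') \<in> M'" "(y, y') \<in> M'"
      then obtain u c v d where uv: "(u, x') \<in> M" "c \<in> K" "x = u \<oplus> c \<otimes> b"
        "(v, y') \<in> M" "d \<in> K" "y = v \<oplus> d \<otimes> b" by (auto simp: M'_def)
      have "x \<oplus> y = (u \<oplus> v) \<oplus> (c \<oplus> d) \<otimes> b"
      proof -
        have "u \<in> carrier R" "v \<in> carrier R" "c \<in> carrier R" "d \<in> carrier R" using uv MR KE(1) by auto
        then show ?thesis using b uv by (simp add: l_distr a_ac)
      qed
      then show "(x \<oplus> y, x' \<oplus> y') \<in> M'" unfolding M'_def using Madd[OF uv(1,4)] KE(7)[OF uv(2,5)] by blast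
    next
      fix c x x' assume c: "c \<in> K" and "(x, x') \<in> M'"
      then obtain u d where u: "(u, x') \<in> M" "d \<in> K" "x = u \<oplus> d \<otimes> b" by (auto simp: M'_def)
      have "c \<otimes> x = c \<otimes> u \<oplus> (c \<otimes> d) \<otimes> b"
      proof -
        have "u \<in> carrier R" "c \<in> carrier R" "d \<in> carrier R" using u c MR KE(1) by auto
        then show ?thesis using b u by (simp add: r_distr m_assoc)
      qed
      then show "(c \<otimes> x, c \<otimes> x') \<in> M'" unfolding M'_def using Msm[OF c u(1)] KE(6)[OF c u(2)] by blast
    next
      fix y assume "(\<zero>, y) \<in> M'"
      then obtain u c where u: "(u, y) \<in> M" "c \<in> K" "\<zero> = u \<oplus> c \<otimes> b" by (auto simp: M'_def)
      have car: "u \<in> carrier R" "c \<in> carrier R" using u MR KE(1) by auto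
      have "c = \<zero>"
      proof (rule ccontr)
        assume "c \<noteq> \<zero>"
        then obtain d where d: "d \<in> K" "d \<otimes> c = \<one>" using inv u(2) by blast
        have dR: "d \<in> carrier R" using d KE(1) by blast
        have "\<zero> = d \<otimes> (u \<oplus> c \<otimes> b)" using u(3)[symmetric] dR by simp
        also have "\<dots> = d \<otimes> u \<oplus> (d \<otimes> c) \<otimes> b" using car dR b by (simp add: r_distr m_assoc)
        finally have "b \<oplus> d \<otimes> u = \<zero>" using car dR b d(2) by (simp add: a_comm)
        then have "b = \<ominus> (d \<otimes> u)" using car dR b by (simp add: minus_equality)
        then have "b = (\<ominus> \<one>) \<otimes> (d \<otimes> u)" using car dR by (simp add: l_minus)
        then have "(b, (\<ominus> \<one>) \<otimes> (d \<otimes> y)) \<in> M" using Msm[OF K1 Msm[OF d(1) u(1)]] by simp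
        then show False using nb by force
      qed
      then have "u = \<zero>" using u(3)[symmetric] car b by simp
      then show "y = \<zero>" using M0 u(1) by simp
    qed
    moreover have "M \<subseteq> M'"
    proof
      fix z assume z: "z \<in> M"
      obtain x x' where xx: "z = (x, x')" by force
      have "x = x \<oplus> \<zero> \<otimes> b" using z xx MR b by auto
      then show "z \<in> M'" unfolding M'_def using z xx KE(2) by blast
    qed
    ultimately have "M' = M" by (rule max)
    moreover have "(b, \<zero>) \<in> M'"
    proof -
      have "b = \<zero> \<oplus> \<one> \<otimes> b" using b by simp
      then show ?thesis unfolding M'_def using K0 KE(3) by blast
    qed
    ultimately show False using nb by force
  qed
  have uniq: "y = y'" if "(x, y) \<in> M" "(x, y') \<in> M" for x y y'
  proof -
    have car: "x \<in> carrier R" "y \<in> carrier R" "y' \<in> carrier R" using that MR by auto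
    have "(x \<oplus> (\<ominus> \<one>) \<otimes> x, y \<oplus> (\<ominus> \<one>) \<otimes> y') \<in> M"
      using Madd[OF that(1) Msm[OF K1 that(2)]] .
    then have "y \<oplus> \<ominus> y' = \<zero>" using car M0 by (simp add: l_minus r_neg)
    then show ?thesis using car by (metis a_minus_def r_right_minus_eq)
  qed
  define \<delta> where "\<delta> x = (SOME y. (x, y) \<in> M)" for x
  have d: "(x, \<delta> x) \<in> M" if x: "x \<in> carrier R" for x
  proof -
    have "\<exists>y. (x, y) \<in> M" using dom[OF x] by auto
    then show ?thesis unfolding \<delta>_def by (rule someI_ex)
  qed
  show ?thesis
  proof (rule that)
    show "\<delta> \<in> carrier R \<rightarrow> carrier R" using d MR by auto
    show "\<delta> (x \<oplus> y) = \<delta> x \<oplus> \<delta> y" if "x \<in> carrier R" "y \<in> carrier R" for x y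
      using uniq[OF d Madd[OF d d]] that by simp
    show "\<delta> (c \<otimes> x) = c \<otimes> \<delta> x" if "c \<in> K" "x \<in> carrier R" for c x
      using uniq[OF d Msm[OF that(1) d]] that KE(1) by blast
    show "\<delta> x = \<gamma>" if "(x, \<gamma>) \<in> G" for x \<gamma>
      using uniq[OF d, of x \<gamma>] that GM MR by auto
  qed
qed

lemma exists_partial_derivation:
  assumes ch: "char_zero R" and K: "subring K R" and a: "a \<in> carrier R"
    and inv: "\<And>c. c \<in> K \<Longrightarrow> c \<noteq> \<zero> \<Longrightarrow> \<exists>d\<in>K. d \<otimes> c = \<one>"
    and tr: "\<And>cs. set cs \<subseteq> K \<Longrightarrow> horner R cs a = \<zero> \<Longrightarrow> set cs \<subseteq> {\<zero>}"
    and X: "finite X" "X \<subseteq> carrier R"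
  shows "\<exists>\<delta>. partial_derivation R K X \<delta> \<and> \<delta> a \<noteq> \<zero> \<and> \<delta> \<one> = \<zero>"
proof -
  obtain G \<alpha> where G: "deriv_graph G" "K \<times> {\<zero>} \<subseteq> G" "(a, \<alpha>) \<in> G" "\<alpha> \<noteq> \<zero>" "X \<subseteq> fst ` G"
    using deriv_graph_finite[OF ch K a tr X] by auto
  obtain \<delta> where d: "\<delta> \<in> carrier R \<rightarrow> carrier R"
    "\<And>x y. x \<in> carrier R \<Longrightarrow> y \<in> carrier R \<Longrightarrow> \<delta> (x \<oplus> y) = \<delta> x \<oplus> \<delta> y"
    "\<And>c x. c \<in> K \<Longrightarrow> x \<in> carrier R \<Longrightarrow> \<delta> (c \<otimes> x) = c \<otimes> \<delta> x"
    "\<And>x \<gamma>. (x, \<gamma>) \<in> G \<Longrightarrow> \<delta> x = \<gamma>"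
    using deriv_graph_linear_extension[OF G(1) K G(2) inv] by blast
  have dG: "(x, \<delta> x) \<in> G" if x: "x \<in> fst ` G" for x
  proof -
    obtain \<gamma> where "(x, \<gamma>) \<in> G" using x by auto
    with d(4)[OF this] show ?thesis by simp
  qed
  have leib: "\<delta> (x \<otimes> y) = x \<otimes> \<delta> y \<oplus> \<delta> x \<otimes> y" if "x \<in> X" "y \<in> X" for x y
  proof (rule d(4))
    have "(x, \<delta> x) \<otimes>\<^bsub>dual R\<^esub> (y, \<delta> y) \<in> G"
      using that G(5) by (intro subringE(6)[OF deriv_graph_subring[OF G(1)]] dG) auto
    then show "(x \<otimes> y, x \<otimes> \<delta> y \<oplus> \<delta> x \<otimes> y) \<in> G" by simp
  qed
  have "\<delta> \<one> = \<zero>" using d(4) G(2) subringE(3)[OF K] by blast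
  moreover have "\<delta> a \<noteq> \<zero>" using d(4) G(3,4) by simp
  moreover have "partial_derivation R K X \<delta>"
    unfolding partial_derivation_def by (intro conjI ballI d(1-3) leib)
  ultimately show ?thesis by blast
qed

end

section \<open>Purity of the diagonal ideal\<close>

fun diff_quot :: "('a, 'm) ring_scheme \<Rightarrow> 'a list \<Rightarrow> 'a \<Rightarrow> 'a \<Rightarrow> 'a" where
  "diff_quot R [] s t = \<zero>\<^bsub>R\<^esub>"
| "diff_quot R (c # cs) s t = horner R cs s \<oplus>\<^bsub>R\<^esub> t \<otimes>\<^bsub>R\<^esub> diff_quot R cs s t"

lemma horner_hom:
  assumes "ring_hom_ring R S h" "set cs \<subseteq> carrier R" "x \<in> carrier R"
  shows "h (horner R cs x) = horner S (map h cs) (h x)"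
proof -
  interpret h: ring_hom_ring R S h by fact
  have "horner R cs x \<in> carrier R" if "set cs \<subseteq> carrier R" for cs
    using that assms(3) by (induction cs) auto
  then show ?thesis using assms(2,3) by (induction cs) auto
qed

context cring
begin

lemma diff_quot_closed:
  assumes "set cs \<subseteq> carrier R" "s \<in> carrier R" "t \<in> carrier R"
  shows "diff_quot R cs s t \<in> carrier R"
  using assms by (induction cs) (auto simp: horner_closed)

text \<open>The quotient is a polynomial expression, so the factorization holds even where
  \<open>s - t\<close> is a zero divisor, as in a tensor square.\<close>

lemma diff_quot_eq:
  assumes "set cs \<subseteq> carrier R" "s \<in> carrier R" "t \<in> carrier R"
  shows "horner R cs s \<ominus> horner R cs t = (s \<ominus> t) \<otimes> diff_quot R cs s t"
  using assms
proof (induction cs)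
  case (Cons c cs)
  let ?f = "horner R cs s" and ?g = "horner R cs t" and ?q = "diff_quot R cs s t"
  have c: "?f \<in> carrier R" "?g \<in> carrier R" "?q \<in> carrier R" "c \<in> carrier R" "s \<in> carrier R" "t \<in> carrier R"
    using Cons.prems by (auto simp: horner_closed diff_quot_closed)
  have "(c \<oplus> s \<otimes> ?f) \<ominus> (c \<oplus> t \<otimes> ?g) = (s \<ominus> t) \<otimes> ?f \<oplus> t \<otimes> (?f \<ominus> ?g)"
    using c by algebra
  also have "\<dots> = (s \<ominus> t) \<otimes> ?f \<oplus> t \<otimes> ((s \<ominus> t) \<otimes> ?q)" using Cons by simp
  also have "\<dots> = (s \<ominus> t) \<otimes> (?f \<oplus> t \<otimes> ?q)" using c by algebra
  finally show ?case by simp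
qed (simp add: a_minus_def)

text \<open>If \<open>b g(b) = 0\<close> with \<open>g(0) = 0\<close>, then \<open>g(b)\<close> is nilpotent, so one factor \<open>X\<close> of \<open>g\<close> can be
  removed.\<close>

lemma regular_of_algebraic:
  assumes red: "reduced_ring R" and K: "K \<subseteq> carrier R"
    and inv: "\<And>c. c \<in> K \<Longrightarrow> c \<noteq> \<zero> \<Longrightarrow> \<exists>d\<in>K. d \<otimes> c = \<one>"
    and cs: "set cs \<subseteq> K" "\<not> set cs \<subseteq> {\<zero>}" and b: "b \<in> carrier R" "b \<otimes> horner R cs b = \<zero>"
  shows "\<exists>c\<in>carrier R. b \<otimes> (b \<otimes> c) = b"
  using cs b(2)
proof (induction cs)
  case (Cons c cs)
  let ?h = "horner R cs b"
  have c: "c \<in> carrier R" "?h \<in> carrier R"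
    using Cons.prems(1) K b by (auto intro!: horner_closed)
  show ?case
  proof (cases "c = \<zero>")
    case True
    then have "(b \<otimes> ?h) \<otimes> (b \<otimes> ?h) = (b \<otimes> horner R (c # cs) b) \<otimes> ?h" using b c by (simp add: m_ac)
    also have "\<dots> = \<zero>" using Cons.prems(3) c by simp
    finally have "(b \<otimes> ?h) [^] (2::nat) = \<zero>" using b c by (simp add: numeral_2_eq_2)
    then have "b \<otimes> ?h = \<zero>" using red b c unfolding reduced_ring_def by blast
    then show ?thesis using Cons True by auto
  next
    \<comment> \<open>Normalising the constant term to one turns the relation into
      \<open>b (1 + b d h) = 0\<close>, which exhibits \<open>b\<close> as a multiple of
      \<open>b b\<close>.\<close>
    case False
    then obtain d where d: "d \<in> K" "d \<otimes> c = \<one>" using inv Cons.prems(1) by auto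
    have dR: "d \<in> carrier R" using d K by blast
    have "d \<otimes> (b \<otimes> (c \<oplus> b \<otimes> ?h)) = (d \<otimes> c) \<otimes> b \<oplus> b \<otimes> (b \<otimes> (d \<otimes> ?h))"
      using b(1) c dR by algebra
    then have "b \<oplus> b \<otimes> (b \<otimes> (d \<otimes> ?h)) = \<zero>" using Cons.prems(3) d(2) dR b(1) by simp
    moreover have "b \<oplus> b \<otimes> (b \<otimes> (d \<otimes> ?h)) = b \<ominus> b \<otimes> (b \<otimes> (\<ominus> (d \<otimes> ?h)))"
      using b(1) c dR by algebra
    ultimately have "b \<otimes> (b \<otimes> (\<ominus> (d \<otimes> ?h))) = b" using b(1) c dR by (metis a_inv_closed m_closed r_right_minus_eq)
    then show ?thesis using c dR by blast
  qed
qed simp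

lemma add_minus_cancel_left: "x \<in> carrier R \<Longrightarrow> y \<in> carrier R \<Longrightarrow> x \<oplus> (y \<ominus> x) = y"
  by algebra

lemma idem_annihilator: "u \<in> carrier R \<Longrightarrow> u \<otimes> u = u \<Longrightarrow> (\<one> \<ominus> u) \<otimes> u = \<zero>"
  by (simp add: l_distr a_minus_def l_minus r_neg)

text \<open>Here \<open>g\<close> will be the difference quotient of \<open>f\<close> and
  \<open>c\<close> a quasi-inverse of \<open>f'(a)\<close> on the idempotent \<open>p\<close>.
  Idempotency of \<open>p\<close> cancels the first two terms of the expansion and the relation
  kills the one with \<open>g\<close>.\<close>

lemma annihilator_of_relation:
  assumes c: "c \<in> carrier R" "g \<in> carrier R" "p \<in> carrier R" "q \<in> carrier R" "x \<in> carrier R"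
    and p: "p \<otimes> p = p" and rel: "p \<otimes> (q \<otimes> (x \<otimes> g)) = \<zero>"
  shows "(\<one> \<ominus> (p \<ominus> c \<otimes> (g \<otimes> p))) \<otimes> (p \<otimes> (q \<otimes> x)) = \<zero>"
proof -
  have "(\<one> \<ominus> (p \<ominus> c \<otimes> (g \<otimes> p))) \<otimes> (p \<otimes> (q \<otimes> x)) =
      p \<otimes> (q \<otimes> x) \<ominus> (p \<otimes> p) \<otimes> (q \<otimes> x) \<oplus> c \<otimes> ((p \<otimes> p) \<otimes> (q \<otimes> (x \<otimes> g)))"
    using c by algebra
  then show ?thesis using p rel c by (simp add: a_minus_def r_neg)
qed

text \<open>In the corner cut out by \<open>e\<close>, the idempotent \<open>b c\<close> generates
  the same ideal as \<open>b\<close>, and the complementary part \<open>e - b c\<close> annihilates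
  \<open>b\<close>.\<close>

lemma idem_split:
  assumes "e \<in> carrier R" "b \<in> carrier R" "c \<in> carrier R" "e \<otimes> e = e" "e \<otimes> b = b" "b \<otimes> (b \<otimes> c) = b"
  shows "(b \<otimes> c) \<otimes> (b \<otimes> c) = b \<otimes> c" "e \<otimes> (b \<otimes> c) = b \<otimes> c"
    "(e \<ominus> b \<otimes> c) \<otimes> (e \<ominus> b \<otimes> c) = e \<ominus> b \<otimes> c" "(e \<ominus> b \<otimes> c) \<otimes> b = \<zero>"
    "(e \<ominus> b \<otimes> c) \<otimes> e = e \<ominus> b \<otimes> c"
proof -
  have "(b \<otimes> c) \<otimes> (b \<otimes> c) = (b \<otimes> (b \<otimes> c)) \<otimes> c" using assms(1-3) by algebra
  then show 1: "(b \<otimes> c) \<otimes> (b \<otimes> c) = b \<otimes> c" using assms by simp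
  have "e \<otimes> (b \<otimes> c) = (e \<otimes> b) \<otimes> c" using assms(1-3) by algebra
  then show 2: "e \<otimes> (b \<otimes> c) = b \<otimes> c" using assms by simp
  have "(e \<ominus> b \<otimes> c) \<otimes> (e \<ominus> b \<otimes> c) =
      e \<otimes> e \<ominus> e \<otimes> (b \<otimes> c) \<ominus> e \<otimes> (b \<otimes> c) \<oplus> (b \<otimes> c) \<otimes> (b \<otimes> c)"
    using assms(1-3) by algebra
  also have "\<dots> = e \<ominus> b \<otimes> c \<ominus> b \<otimes> c \<oplus> b \<otimes> c" by (simp add: 1 2 assms(4))
  also have "\<dots> = e \<ominus> b \<otimes> c" using assms(1-3) by algebra
  finally show "(e \<ominus> b \<otimes> c) \<otimes> (e \<ominus> b \<otimes> c) = e \<ominus> b \<otimes> c" .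
  have "(e \<ominus> b \<otimes> c) \<otimes> b = e \<otimes> b \<ominus> b \<otimes> (b \<otimes> c)" using assms(1-3) by algebra
  then show "(e \<ominus> b \<otimes> c) \<otimes> b = \<zero>" using assms by (simp add: a_minus_def r_neg)
  have "(e \<ominus> b \<otimes> c) \<otimes> e = e \<otimes> e \<ominus> e \<otimes> (b \<otimes> c)" using assms(1-3) by algebra
  then show "(e \<ominus> b \<otimes> c) \<otimes> e = e \<ominus> b \<otimes> c" by (simp add: 2 assms(4))
qed

text \<open>For \<open>p = l e\<close> and \<open>q = r e\<close> with \<open>e\<close> idempotent,
  \<open>p - p q\<close> is an idempotent of the kernel and thus fixed by itself. Only the summand
  \<open>p (q x)\<close> needs an argument.\<close>

lemma split_by_idem:
  "p \<in> carrier R \<Longrightarrow> q \<in> carrier R \<Longrightarrow> x \<in> carrier R \<Longrightarrow>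
    p \<otimes> x = p \<otimes> (q \<otimes> x) \<oplus> x \<otimes> (p \<ominus> p \<otimes> q)"
  by algebra

lemma idem_complement:
  assumes "p \<in> carrier R" "q \<in> carrier R" "p \<otimes> p = p" "q \<otimes> q = q"
  shows "(p \<ominus> p \<otimes> q) \<otimes> (p \<ominus> p \<otimes> q) = p \<ominus> p \<otimes> q"
proof -
  have "(p \<ominus> p \<otimes> q) \<otimes> (p \<ominus> p \<otimes> q) =
      p \<otimes> p \<ominus> (p \<otimes> p) \<otimes> q \<ominus> (p \<otimes> p) \<otimes> q \<oplus> (p \<otimes> p) \<otimes> (q \<otimes> q)"
    using assms(1,2) by algebra
  also have "\<dots> = p \<ominus> p \<otimes> q \<ominus> p \<otimes> q \<oplus> p \<otimes> q" by (simp add: assms(3,4))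
  also have "\<dots> = p \<ominus> p \<otimes> q" using assms(1,2) by algebra
  finally show ?thesis .
qed

end

section \<open>Purity for an algebraic diagonal\<close>

context surj_hom
begin

text \<open>The case \<open>P = R\<close> of \<open>fixed_submodule\<close>; purity of
  \<open>I\<close> means that \<open>I\<close> is contained in it.\<close>

definition fixed :: "'a set" where
  "fixed = {u \<in> carrier R. \<exists>y\<in>I. (\<one> \<ominus> y) \<otimes> u = \<zero>}"

lemma fixedI: "u \<in> carrier R \<Longrightarrow> y \<in> I \<Longrightarrow> (\<one> \<ominus> y) \<otimes> u = \<zero> \<Longrightarrow> u \<in> fixed"
  unfolding fixed_def by blast

lemma fixed_closed:
  "fixed \<subseteq> carrier R" "\<zero> \<in> fixed"
  "r \<in> carrier R \<Longrightarrow> u \<in> fixed \<Longrightarrow> r \<otimes> u \<in> fixed"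
  "u \<in> fixed \<Longrightarrow> v \<in> fixed \<Longrightarrow> u \<oplus> v \<in> fixed"
proof -
  have idR: "id \<in> ring_hom R R" by (rule ring_hom_memI) auto
  interpret W: module R "module_via id R" by (rule module_via_module[OF R.is_cring R.is_cring idR])
  have "submodule fixed R (module_via id R)"
    using fixed_submodule[OF W.module_axioms] by (simp add: fixed_def module_via_def)
  note E = W.submoduleE[OF this]
  show "fixed \<subseteq> carrier R" by (auto simp: fixed_def)
  show "r \<in> carrier R \<Longrightarrow> u \<in> fixed \<Longrightarrow> r \<otimes> u \<in> fixed"
    using E(4)[of r u] by (simp add: module_via_def)
  show "u \<in> fixed \<Longrightarrow> v \<in> fixed \<Longrightarrow> u \<oplus> v \<in> fixed"
    using E(5)[of u v] by (simp add: module_via_def)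
  show "\<zero> \<in> fixed" by (rule fixedI[OF _ I.zero_closed]) simp_all
qed

lemma fixed_idem: "u \<in> I \<Longrightarrow> u \<otimes> u = u \<Longrightarrow> u \<in> fixed"
  by (rule fixedI[OF I.Icarr _ R.idem_annihilator[OF I.Icarr]])

end

text \<open>Isolates what purity uses of the tensor square: two sections \<open>l\<close> and
  \<open>r\<close> of the multiplication map that agree on the scalars \<open>K\<close>.\<close>

locale diagonal = surj_hom +
  fixes l r :: "'c \<Rightarrow> 'a" and K :: "'c set"
  assumes l_hom: "l \<in> ring_hom B R" and r_hom: "r \<in> ring_hom B R"
    and hl: "b \<in> carrier B \<Longrightarrow> h (l b) = b" and hr: "b \<in> carrier B \<Longrightarrow> h (r b) = b"
    and K: "subring K B" and lr: "c \<in> K \<Longrightarrow> l c = r c"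
    and K_inv: "c \<in> K \<Longrightarrow> c \<noteq> \<zero>\<^bsub>B\<^esub> \<Longrightarrow> \<exists>d\<in>K. d \<otimes>\<^bsub>B\<^esub> c = \<one>\<^bsub>B\<^esub>"
begin

sublocale l: ring_hom_ring B R l
  by (intro ring_hom_ringI2 R.ring_axioms B.ring_axioms l_hom)

sublocale r: ring_hom_ring B R r
  by (intro ring_hom_ringI2 R.ring_axioms B.ring_axioms r_hom)

text \<open>\<open>h\<close> merges \<open>l a\<close> and \<open>r a\<close> into \<open>a\<close>,
  and on the diagonal the recursion of the difference quotient becomes that of the
  derivative.\<close>

lemma h_diff_quot:
  assumes "set cs \<subseteq> K" "a \<in> carrier B"
  shows "h (diff_quot R (map l cs) (l a) (r a)) = horner_deriv B cs a"
  using assms(1)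
proof (induction cs)
  case (Cons c cs)
  have csB: "set cs \<subseteq> carrier B" using Cons.prems subringE(1)[OF K] by auto
  have lcs: "set (map l cs) \<subseteq> carrier R" using csB by auto
  have hh: "horner R (map l cs) (l a) = l (horner B cs a)"
    by (rule horner_hom[symmetric, OF l.ring_hom_ring_axioms csB assms(2)])
  have c: "horner B cs a \<in> carrier B" "l a \<in> carrier R" "r a \<in> carrier R"
      "diff_quot R (map l cs) (l a) (r a) \<in> carrier R"
    using csB lcs assms(2) by (auto simp: B.horner_closed intro!: R.diff_quot_closed)
  show ?case using Cons c assms(2) by (simp add: hh hl hr)
qed simp

lemma fixed_of_algebraic:
  assumes red: "reduced_ring B" and ch: "char_zero B"
    and alg: "\<And>b. b \<in> carrier B \<Longrightarrow> \<exists>cs. set cs \<subseteq> K \<and> \<not> set cs \<subseteq> {\<zero>\<^bsub>B\<^esub>} \<and> horner B cs b = \<zero>\<^bsub>B\<^esub>"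
    and a: "a \<in> carrier B"
  shows "l a \<ominus> r a \<in> fixed"
proof -
  define x where "x = l a \<ominus> r a"
  have x: "x \<in> carrier R" using a by (simp add: x_def)
  note KE = subringE[OF K]
  have KB: "K \<subseteq> carrier B" using KE(1) .
  have comp: "y \<otimes> (l e \<ominus> l e \<otimes> r e) \<in> fixed"
    if e: "e \<in> carrier B" "e \<otimes>\<^bsub>B\<^esub> e = e" and y: "y \<in> carrier R" for e y
  proof -
    have le: "l e \<in> carrier R" "r e \<in> carrier R" using e by auto
    have "l e \<otimes> l e = l e" "r e \<otimes> r e = r e"
      using e by (metis l.hom_mult, metis r.hom_mult)
    note i = R.idem_complement[OF le this]
    have "h (l e \<ominus> l e \<otimes> r e) = \<zero>\<^bsub>B\<^esub>"
      using e le by (simp add: a_minus_def hl hr B.r_neg)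
    then have "l e \<ominus> l e \<otimes> r e \<in> I" using le by (simp add: I_iff)
    then show ?thesis using fixed_idem i fixed_closed(3) y by blast
  qed
  \<comment> \<open>The idempotent \<open>e\<close> is carried through the induction so that it
    applies to the part where \<open>f'(a)\<close> vanishes, with \<open>f'\<close> in place of
    \<open>f\<close>. The lemma itself is the case \<open>e = 1\<close>.\<close>
  have "l e \<otimes> x \<in> fixed"
    if "set cs \<subseteq> K" "\<not> set cs \<subseteq> {\<zero>\<^bsub>B\<^esub>}" "e \<in> carrier B" "e \<otimes>\<^bsub>B\<^esub> e = e"
      "e \<otimes>\<^bsub>B\<^esub> horner B cs a = \<zero>\<^bsub>B\<^esub>" for cs e
    using that
  proof (induction "length cs" arbitrary: cs e)
    case (Suc n)
    obtain c0 cs' where cs: "cs = c0 # cs'" using Suc.prems(2) by (cases cs) auto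
    have cs'B: "set cs' \<subseteq> carrier B" using Suc.prems(1) KB cs by auto
    define ds where "ds = poly_deriv B 1 cs'"
    have dsK: "set ds \<subseteq> K" unfolding ds_def using B.poly_deriv_subset[OF K] Suc.prems(1) cs by simp
    have ds: "horner_deriv B cs a = horner B ds a"
      unfolding cs ds_def by (rule B.horner_deriv_Cons[OF cs'B a])
    note e = Suc.prems(3,4)
    show ?case
    proof (cases "set ds \<subseteq> {\<zero>\<^bsub>B\<^esub>}")
      \<comment> \<open>With \<open>f' = 0\<close>, characteristic 0 leaves only a nonzero constant
        of \<open>f\<close>, which is invertible; hence \<open>e = 0\<close>.\<close>
      case True
      have "c = \<zero>\<^bsub>B\<^esub>" if m: "add_pow B m c = \<zero>\<^bsub>B\<^esub>" "m > 0" and c: "c \<in> K" for m :: nat and c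
      proof (rule ccontr)
        assume "c \<noteq> \<zero>\<^bsub>B\<^esub>"
        then obtain d where d: "d \<in> K" "d \<otimes>\<^bsub>B\<^esub> c = \<one>\<^bsub>B\<^esub>" using K_inv c by blast
        have "add_pow B m \<one>\<^bsub>B\<^esub> = d \<otimes>\<^bsub>B\<^esub> add_pow B m c"
          using d c KB by (simp add: B.add_pow_rdistr subset_iff)
        then have "add_pow B m \<one>\<^bsub>B\<^esub> = \<zero>\<^bsub>B\<^esub>" using m(1) d(1) KB by (simp add: subset_iff)
        then show False using ch m(2) by (simp add: char_zero_def)
      qed
      then have "set es \<subseteq> {\<zero>\<^bsub>B\<^esub>}" if "set (poly_deriv B m es) \<subseteq> {\<zero>\<^bsub>B\<^esub>}" "m > 0" "set es \<subseteq> K" for m es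
        using that by (induction es arbitrary: m) auto
      from this[of 1 cs'] have z: "set cs' \<subseteq> {\<zero>\<^bsub>B\<^esub>}"
        using True Suc.prems(1) cs by (simp add: ds_def)
      have c0: "c0 \<in> K" "c0 \<noteq> \<zero>\<^bsub>B\<^esub>" using Suc.prems(1,2) cs z by auto
      then obtain d where d: "d \<in> K" "d \<otimes>\<^bsub>B\<^esub> c0 = \<one>\<^bsub>B\<^esub>" using K_inv by blast
      have dB: "d \<in> carrier B" "c0 \<in> carrier B" using d(1) c0(1) KB by auto
      have "horner B cs a = c0" using B.horner_zeros[OF z a] a dB by (simp add: cs)
      then have "e \<otimes>\<^bsub>B\<^esub> c0 = \<zero>\<^bsub>B\<^esub>" using Suc.prems(5) by simp
      then have "d \<otimes>\<^bsub>B\<^esub> (e \<otimes>\<^bsub>B\<^esub> c0) = \<zero>\<^bsub>B\<^esub>" using dB by simp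
      then have "e = \<zero>\<^bsub>B\<^esub>" using dB e(1) d(2) by (metis B.m_lcomm B.r_one)
      then show ?thesis using x fixed_closed(2) by simp
    next
      case False
      let ?f' = "horner B ds a"
      have f'B: "?f' \<in> carrier B" using dsK KB a by (intro B.horner_closed) auto
      \<comment> \<open>The derivative restricted to the corner of \<open>e\<close>. Algebraicity is
        applied to \<open>b\<close>, not to \<open>a\<close>, so that \<open>b\<close> is von
        Neumann regular; \<open>e'\<close> carries the part where \<open>f'(a)\<close> is invertible
        and \<open>e1\<close> the part where it vanishes.\<close>
      define b where "b = e \<otimes>\<^bsub>B\<^esub> ?f'"
      have b: "b \<in> carrier B" using e f'B by (simp add: b_def)
      have eb: "e \<otimes>\<^bsub>B\<^esub> b = b" using e f'B by (simp add: b_def B.m_assoc[symmetric])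
      obtain fs where fs: "set fs \<subseteq> K" "\<not> set fs \<subseteq> {\<zero>\<^bsub>B\<^esub>}" "horner B fs b = \<zero>\<^bsub>B\<^esub>" using alg[OF b] by blast
      obtain c where c: "c \<in> carrier B" "b \<otimes>\<^bsub>B\<^esub> (b \<otimes>\<^bsub>B\<^esub> c) = b"
        using B.regular_of_algebraic[OF red KB K_inv fs(1,2) b] fs(3) b by auto
      define e' where "e' = b \<otimes>\<^bsub>B\<^esub> c"
      define e1 where "e1 = e \<ominus>\<^bsub>B\<^esub> e'"
      note sp = B.idem_split[OF e(1) b c(1) e(2) eb c(2), folded e'_def, folded e1_def]
      have e': "e' \<in> carrier B" "e1 \<in> carrier B" using e b c by (simp_all add: e'_def e1_def)
      have "e1 \<otimes>\<^bsub>B\<^esub> ?f' = (e1 \<otimes>\<^bsub>B\<^esub> e) \<otimes>\<^bsub>B\<^esub> ?f'" by (simp add: sp(5))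
      also have "\<dots> = e1 \<otimes>\<^bsub>B\<^esub> b" using e' e f'B by (simp add: b_def B.m_assoc)
      finally have "e1 \<otimes>\<^bsub>B\<^esub> ?f' = \<zero>\<^bsub>B\<^esub>" by (simp add: sp(4))
      moreover have "n = length ds" using Suc(2) by (simp add: ds_def cs)
      ultimately have 1: "l e1 \<otimes> x \<in> fixed" using Suc(1)[of ds e1] dsK False e' sp(3) by blast

      let ?g = "diff_quot R (map l cs) (l a) (r a)"
      have csB: "set cs \<subseteq> carrier B" using Suc.prems(1) KB by blast
      have lcs: "set (map l cs) \<subseteq> carrier R" using csB by auto
      have lar: "l a \<in> carrier R" "r a \<in> carrier R" using a by auto
      have g: "?g \<in> carrier R" by (rule R.diff_quot_closed[OF lcs lar])
      have fa: "horner B cs a \<in> carrier B" using csB a by (rule B.horner_closed)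
      have hl': "horner R (map l cs) (l a) = l (horner B cs a)"
        by (rule horner_hom[symmetric, OF l.ring_hom_ring_axioms csB a])
      have map_lr: "map l cs = map r cs" using Suc.prems(1) lr by (auto intro!: map_cong)
      have hr': "horner R (map l cs) (r a) = r (horner B cs a)"
        unfolding map_lr by (rule horner_hom[symmetric, OF r.ring_hom_ring_axioms csB a])
      have xg: "x \<otimes> ?g = l (horner B cs a) \<ominus> r (horner B cs a)"
        using R.diff_quot_eq[OF lcs lar] by (simp add: x_def hl' hr')
      \<comment> \<open>\<open>x g\<close> is \<open>l (f(a)) - r (f(a))\<close>. The factor
        \<open>l e'\<close> kills only the first term and \<open>r e'\<close> only the second, so
        both are needed.\<close>
      define p where "p = l e'"
      define q where "q = r e'"
      have pq: "p \<in> carrier R" "q \<in> carrier R" using e' by (auto simp: p_def q_def)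
      have e'f: "e' \<otimes>\<^bsub>B\<^esub> horner B cs a = \<zero>\<^bsub>B\<^esub>"
      proof -
        have "e' \<otimes>\<^bsub>B\<^esub> horner B cs a = e' \<otimes>\<^bsub>B\<^esub> (e \<otimes>\<^bsub>B\<^esub> horner B cs a)"
          using e e' fa sp(2) by (metis B.m_assoc B.m_comm)
        then show ?thesis using Suc.prems(5) e' by simp
      qed
      have pf: "p \<otimes> l (horner B cs a) = \<zero>" "q \<otimes> r (horner B cs a) = \<zero>"
        using e'f e' fa by (simp_all add: p_def q_def l.hom_mult[symmetric] r.hom_mult[symmetric]
          del: l.hom_mult r.hom_mult)
      have "p \<otimes> (q \<otimes> (u \<ominus> v)) = q \<otimes> (p \<otimes> u) \<ominus> p \<otimes> (q \<otimes> v)"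
        if "u \<in> carrier R" "v \<in> carrier R" for u v
        using that pq R.ring_simprules by (simp add: a_minus_def R.r_distr R.r_minus R.m_lcomm)
      then have rel: "p \<otimes> (q \<otimes> (x \<otimes> ?g)) = \<zero>"
        using pf pq fa by (simp add: xg a_minus_def)
      have pp: "p \<otimes> p = p" using sp(1) e' by (metis p_def l.hom_mult e'_def)
      \<comment> \<open>Modulo the kernel, \<open>g\<close> is \<open>f'(a)\<close> and
        \<open>c f'(a) e' = e'\<close>, so the two parts of \<open>y\<close> cancel under
        \<open>h\<close>.\<close>
      define y where "y = p \<ominus> l c \<otimes> (?g \<otimes> p)"
      have lc: "l c \<in> carrier R" using c by simp
      have "h y = e' \<ominus>\<^bsub>B\<^esub> c \<otimes>\<^bsub>B\<^esub> (?f' \<otimes>\<^bsub>B\<^esub> e')"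
        using pq g lc e' c f'B
        by (simp add: y_def a_minus_def h_diff_quot[OF Suc.prems(1) a] ds hl p_def)
      also have "c \<otimes>\<^bsub>B\<^esub> (?f' \<otimes>\<^bsub>B\<^esub> e') = e'"
      proof -
        have "c \<otimes>\<^bsub>B\<^esub> (?f' \<otimes>\<^bsub>B\<^esub> e') = c \<otimes>\<^bsub>B\<^esub> (?f' \<otimes>\<^bsub>B\<^esub> (e \<otimes>\<^bsub>B\<^esub> e'))" by (simp add: sp(2))
        also have "\<dots> = (b \<otimes>\<^bsub>B\<^esub> c) \<otimes>\<^bsub>B\<^esub> e'" using c f'B e e' by (simp add: b_def B.m_ac)
        finally show ?thesis by (simp add: e'_def[symmetric] sp(1))
      qed
      finally have "h y = \<zero>\<^bsub>B\<^esub>" using e'(1) by (simp add: a_minus_def B.r_neg)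
      moreover have "y \<in> carrier R" unfolding y_def using pq g lc by (intro R.minus_closed R.m_closed)
      ultimately have "y \<in> I" by (simp only: I_iff)
      moreover have "(\<one> \<ominus> y) \<otimes> (p \<otimes> (q \<otimes> x)) = \<zero>"
        unfolding y_def by (rule R.annihilator_of_relation[OF lc g pq x pp rel])
      moreover have "p \<otimes> (q \<otimes> x) \<in> carrier R" using pq x by (intro R.m_closed)
      ultimately have "p \<otimes> (q \<otimes> x) \<in> fixed" by (intro fixedI)
      moreover have "x \<otimes> (p \<ominus> p \<otimes> q) \<in> fixed"
        unfolding p_def q_def by (rule comp[OF e'(1) sp(1) x])
      ultimately have 2: "p \<otimes> x \<in> fixed"
        unfolding R.split_by_idem[OF pq x] by (rule fixed_closed(4))
      have "e = e' \<oplus>\<^bsub>B\<^esub> e1"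
        using e(1) e'(1) by (simp add: e1_def B.add_minus_cancel_left)
      then have "l e \<otimes> x = p \<otimes> x \<oplus> l e1 \<otimes> x"
        using e' x pq by (simp add: p_def R.l_distr)
      then show ?thesis using fixed_closed(4)[OF 2 1] by simp
    qed
  qed simp
  note main = this
  obtain cs where cs: "set cs \<subseteq> K" "\<not> set cs \<subseteq> {\<zero>\<^bsub>B\<^esub>}" "horner B cs a = \<zero>\<^bsub>B\<^esub>"
    using alg[OF a] by blast
  have "l \<one>\<^bsub>B\<^esub> \<otimes> x \<in> fixed" by (rule main[OF cs(1,2)]) (simp_all add: cs(3))
  then show ?thesis using x by (simp add: x_def)
qed

end

section \<open>Algebraicity and the theorem\<close>

lemma horner_replicate_zero:
  assumes "cring R" "set cs \<subseteq> carrier R" "x \<in> carrier R"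
  shows "horner R (replicate m \<zero>\<^bsub>R\<^esub> @ cs) x = x [^]\<^bsub>R\<^esub> m \<otimes>\<^bsub>R\<^esub> horner R cs x"
proof -
  interpret cring R by fact
  show ?thesis using assms(2,3)
    by (induction m) (simp_all add: horner_closed m_assoc m_lcomm)
qed

context cring
begin

lemma mult_diff_decomp:
  "t \<in> carrier R \<Longrightarrow> p \<in> carrier R \<Longrightarrow> q \<in> carrier R \<Longrightarrow> t \<otimes> q = (\<ominus> t) \<otimes> (p \<ominus> q) \<oplus> t \<otimes> p"
  by algebra

text \<open>The values at \<open>a\<close> of the nonzero polynomials over \<open>K\<close>; pulling out a power of \<open>X\<close>
  gives a nonzero constant term, which makes closure under products visible.\<close>

definition poly_values :: "'a set \<Rightarrow> 'a \<Rightarrow> 'a set" where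
  "poly_values K a = {a [^] m \<otimes> horner R (c # cs) a | (m::nat) c cs. set (c # cs) \<subseteq> K \<and> c \<noteq> \<zero>}"

lemma horner_in_poly_values:
  assumes K: "K \<subseteq> carrier R" and a: "a \<in> carrier R"
    and "set cs \<subseteq> K" "\<not> set cs \<subseteq> {\<zero>}"
  shows "horner R cs a \<in> poly_values K a"
  using assms(3,4)
proof (induction cs)
  case (Cons c cs)
  have car: "horner R ds a \<in> carrier R" if "set ds \<subseteq> K" for ds
    using that K a by (intro horner_closed) auto
  show ?case
  proof (cases "c = \<zero>")
    case True
    then have "horner R cs a \<in> poly_values K a" using Cons by auto
    then obtain m :: nat and d ds
      where d: "horner R cs a = a [^] m \<otimes> horner R (d # ds) a" "set (d # ds) \<subseteq> K" "d \<noteq> \<zero>"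
      unfolding poly_values_def by blast
    have "horner R (c # cs) a = a \<otimes> horner R cs a" using True car[of cs] Cons.prems(1) a by simp
    also have "\<dots> = a [^] (Suc m) \<otimes> horner R (d # ds) a"
      unfolding d(1) using car[OF d(2)] a by (simp add: m_assoc m_lcomm del: horner.simps)
    finally show ?thesis unfolding poly_values_def using d(2,3) by blast
  next
    case False
    have "horner R (c # cs) a = a [^] (0::nat) \<otimes> horner R (c # cs) a"
      using car[OF Cons.prems(1)] by (simp del: horner.simps)
    then show ?thesis unfolding poly_values_def using Cons.prems(1) False by blast
  qed
qed simp

lemma poly_values_mult:
  assumes K: "subring K R" and inv: "\<And>c. c \<in> K \<Longrightarrow> c \<noteq> \<zero> \<Longrightarrow> \<exists>d\<in>K. d \<otimes> c = \<one>"
    and a: "a \<in> carrier R" and s: "s \<in> poly_values K a" and t: "t \<in> poly_values K a"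
  shows "s \<otimes> t \<in> poly_values K a"
proof -
  note KE = subringE[OF K] and AE = subringE[OF adjoin_subring[OF K a]]
  obtain m c cs where s': "s = a [^] (m::nat) \<otimes> (c \<oplus> a \<otimes> horner R cs a)" "c \<in> K" "set cs \<subseteq> K" "c \<noteq> \<zero>"
    using s by (auto simp: poly_values_def)
  obtain n d ds where t': "t = a [^] (n::nat) \<otimes> (d \<oplus> a \<otimes> horner R ds a)" "d \<in> K" "set ds \<subseteq> K" "d \<noteq> \<zero>"
    using t by (auto simp: poly_values_def)
  define f where "f = horner R cs a"
  define g where "g = horner R ds a"
  have fg: "f \<in> adjoin K a" "g \<in> adjoin K a" using s' t' by (auto simp: f_def g_def adjoin_def)
  have cd: "c \<in> adjoin K a" "d \<in> adjoin K a" using adjoin_superset[OF KE(1) a] s' t' by auto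
  have aa: "a \<in> adjoin K a" by (rule adjoin_mem[OF K a])
  have "c \<otimes> g \<oplus> f \<otimes> (d \<oplus> a \<otimes> g) \<in> adjoin K a" using fg cd aa by (intro AE(6,7))
  then obtain es where es: "set es \<subseteq> K" "c \<otimes> g \<oplus> f \<otimes> (d \<oplus> a \<otimes> g) = horner R es a"
    by (auto simp: adjoin_def)
  have car: "f \<in> carrier R" "g \<in> carrier R" "c \<in> carrier R" "d \<in> carrier R"
    using fg cd AE(1) by auto
  have "(u \<otimes> (c \<oplus> a \<otimes> f)) \<otimes> (v \<otimes> (d \<oplus> a \<otimes> g)) =
      (u \<otimes> v) \<otimes> (c \<otimes> d \<oplus> a \<otimes> (c \<otimes> g \<oplus> f \<otimes> (d \<oplus> a \<otimes> g)))"
    if "u \<in> carrier R" "v \<in> carrier R" for u v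
    using that car a by algebra
  then have "s \<otimes> t = a [^] (m + n) \<otimes> horner R ((c \<otimes> d) # es) a"
    using a by (simp add: s'(1) t'(1) f_def[symmetric] g_def[symmetric] nat_pow_mult es(2))
  moreover have "c \<otimes> d \<noteq> \<zero>"
  proof
    assume 0: "c \<otimes> d = \<zero>"
    obtain c' where c': "c' \<in> K" "c' \<otimes> c = \<one>" using inv s' by blast
    have "c' \<in> carrier R" using c' KE(1) by blast
    then have "d = c' \<otimes> (c \<otimes> d)" using c'(2) car by (simp add: m_assoc[symmetric])
    then show False using 0 t'(4) \<open>c' \<in> carrier R\<close> by simp
  qed
  moreover have "set ((c \<otimes> d) # es) \<subseteq> K" using KE(6) s'(2) t'(2) es(1) by simp
  ultimately show ?thesis unfolding poly_values_def by blast
qed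

end

lemma (in surj_hom) fixed_pure:
  assumes "x \<in> fixed"
  shows "\<exists>y\<in>I. y \<otimes> x = x"
proof -
  obtain y where y: "x \<in> carrier R" "y \<in> I" "(\<one> \<ominus> y) \<otimes> x = \<zero>" using assms unfolding fixed_def by blast
  note yR = I.Icarr[OF y(2)]
  have "x \<ominus> y \<otimes> x = \<zero>" using R.one_minus_mult[OF y(1) yR] y(3) by simp
  then have "y \<otimes> x = x" using y(1) yR by (metis R.m_closed R.r_right_minus_eq)
  then show ?thesis using y(2) by blast
qed

section \<open>Scalars and the tensor square of an algebra\<close>

context algebra
begin

definition scalars :: "'c set" where
  "scalars = (\<lambda>c. c \<odot>\<^bsub>M\<^esub> \<one>\<^bsub>M\<^esub>) ` carrier R"

lemma scalar_hom: "(\<lambda>c. c \<odot>\<^bsub>M\<^esub> \<one>\<^bsub>M\<^esub>) \<in> ring_hom R M"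
  by (rule ring_hom_memI)
    (auto simp: smult_l_distr smult_assoc1 smult_assoc2)

lemma scalar_ring_hom: "ring_hom_ring R M (\<lambda>c. c \<odot>\<^bsub>M\<^esub> \<one>\<^bsub>M\<^esub>)"
  by (intro ring_hom_ringI2 R.ring_axioms scalar_hom cring.axioms(1)[OF M_cring])

lemma scalars_subring: "subring scalars M"
  unfolding scalars_def by (rule ring_hom_ring.img_is_subring[OF scalar_ring_hom R.carrier_is_subring])

lemma scalars_inverse:
  assumes "field R" "c \<in> scalars" "c \<noteq> \<zero>\<^bsub>M\<^esub>"
  shows "\<exists>d\<in>scalars. d \<otimes>\<^bsub>M\<^esub> c = \<one>\<^bsub>M\<^esub>"
proof -
  interpret F: field R by fact
  obtain r where r: "r \<in> carrier R" "c = r \<odot>\<^bsub>M\<^esub> \<one>\<^bsub>M\<^esub>" using assms(2) by (auto simp: scalars_def)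
  then have "r \<noteq> \<zero>\<^bsub>R\<^esub>" using assms(3) by auto
  then have u: "r \<in> Units R" using r by (simp add: F.field_Units)
  have "(inv\<^bsub>R\<^esub> r \<odot>\<^bsub>M\<^esub> \<one>\<^bsub>M\<^esub>) \<otimes>\<^bsub>M\<^esub> c = (inv\<^bsub>R\<^esub> r \<otimes>\<^bsub>R\<^esub> r) \<odot>\<^bsub>M\<^esub> \<one>\<^bsub>M\<^esub>"
    unfolding r(2) using r(1) R.Units_inv_closed[OF u] ring_hom_mult[OF scalar_hom] by simp
  then show ?thesis using R.Units_inv_closed[OF u] R.Units_l_inv[OF u] by (auto simp: scalars_def)
qed

end

context algebra
begin

interpretation AA: two_alg R M M
  by (intro two_alg.intro algebra_axioms)

interpretation b: bilin R M M M "\<lambda>a b. a \<otimes>\<^bsub>M\<^esub> b" by (rule mult_bilin)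

lemma mult_map_lin: "lin_map R (tensor R M M) M (mult_map R M)"
  unfolding mult_map_def by (rule b.tensor_lift_lin)

lemma mult_map_pure:
  "a \<in> carrier M \<Longrightarrow> b \<in> carrier M \<Longrightarrow> mult_map R M (pure_tensor R M M a b) = a \<otimes>\<^bsub>M\<^esub> b"
  unfolding mult_map_def by (rule b.tensor_lift_pure)

lemma mult_map_surj_hom: "surj_hom (tensor_algebra R M M) M (mult_map R M)"
proof (intro surj_hom.intro surj_hom_axioms.intro M_cring mult_map_hom HH_base_module)
  have "a \<in> mult_map R M ` carrier (tensor_algebra R M M)" if "a \<in> carrier M" for a
    using that mult_map_pure[of a "\<one>\<^bsub>M\<^esub>"] AA.p.closed[of a "\<one>\<^bsub>M\<^esub>"]
    by (intro image_eqI[of _ _ "pure_tensor R M M a \<one>\<^bsub>M\<^esub>"]) (auto simp: AA.TA_simps)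
  then show "mult_map R M ` carrier (tensor_algebra R M M) = carrier M"
    using lin_map.closed[OF mult_map_lin] by (auto simp: AA.TA_simps)
qed

lemma diagonal_tensor:
  assumes "field R"
  shows "diagonal (tensor_algebra R M M) M (mult_map R M)
    (\<lambda>a. pure_tensor R M M a \<one>\<^bsub>M\<^esub>) (\<lambda>a. pure_tensor R M M \<one>\<^bsub>M\<^esub> a) scalars"
proof (intro diagonal.intro diagonal_axioms.intro mult_map_surj_hom scalars_subring)
  show "(\<lambda>a. pure_tensor R M M a \<one>\<^bsub>M\<^esub>) \<in> ring_hom M (tensor_algebra R M M)"
    "(\<lambda>a. pure_tensor R M M \<one>\<^bsub>M\<^esub> a) \<in> ring_hom M (tensor_algebra R M M)"
    by (auto intro!: ring_hom_memI simp: AA.TA_simps AA.p.closed AA.tm_pure AA.p.add1 AA.p.add2)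
  show "pure_tensor R M M c \<one>\<^bsub>M\<^esub> = pure_tensor R M M \<one>\<^bsub>M\<^esub> c" if "c \<in> scalars" for c
    using that by (auto simp: scalars_def AA.p.smult1 AA.p.smult2)
qed (use scalars_inverse[OF assms] in \<open>auto simp: mult_map_pure\<close>)

end

section \<open>Pairing the tensor square with a partial derivation\<close>

lemma (in cring) leibniz_combine:
  assumes "c \<in> carrier R" "mi \<in> carrier R" "mi' \<in> carrier R" "mj \<in> carrier R"
    "li \<in> carrier R" "li' \<in> carrier R" "lj \<in> carrier R"
  shows "c \<otimes> (mi \<otimes> lj \<oplus> li \<otimes> mj) \<oplus> (mi' \<otimes> lj \<oplus> li' \<otimes> mj) =
    (c \<otimes> mi \<oplus> mi') \<otimes> lj \<oplus> (c \<otimes> li \<oplus> li') \<otimes> mj"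
  using assms by algebra

lemma (in cring) leibniz_pure:
  assumes "u \<in> carrier R" "u' \<in> carrier R" "v \<in> carrier R" "v' \<in> carrier R" "d \<in> carrier R" "d' \<in> carrier R"
  shows "(u \<otimes> u') \<otimes> (v \<otimes> d' \<oplus> d \<otimes> v') = (u \<otimes> v) \<otimes> (u' \<otimes> d') \<oplus> (u \<otimes> d) \<otimes> (u' \<otimes> v')"
  using assms by algebra

locale algebra_quotient = algebra R M + Q: cring Q for R (structure) and M and Q +
  fixes \<phi>
  assumes \<phi>: "\<phi> \<in> ring_hom M Q"
begin

text \<open>The structure map of \<open>Q\<close> over the base ring; it makes \<open>Q\<close> a
  target for linear maps out of the tensor square.\<close>

definition \<iota> where "\<iota> c = \<phi> (c \<odot>\<^bsub>M\<^esub> \<one>\<^bsub>M\<^esub>)"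

lemma \<iota>_hom: "\<iota> \<in> ring_hom R Q"
  using ring_hom_trans[OF scalar_hom \<phi>] by (simp add: \<iota>_def[abs_def] comp_def)

abbreviation "N \<equiv> module_via \<iota> Q"

lemma N_module: "module R N"
  by (rule module_via_module[OF R.is_cring Q.is_cring \<iota>_hom])

interpretation AA: two_alg R M M
  by (intro two_alg.intro algebra_axioms)

lemma N_simps: "carrier N = carrier Q" "\<zero>\<^bsub>N\<^esub> = \<zero>\<^bsub>Q\<^esub>" "x \<oplus>\<^bsub>N\<^esub> y = x \<oplus>\<^bsub>Q\<^esub> y" "c \<odot>\<^bsub>N\<^esub> x = \<iota> c \<otimes>\<^bsub>Q\<^esub> x"
  by (simp_all add: module_via_def)

lemma \<phi>_smult: "c \<in> carrier R \<Longrightarrow> x \<in> carrier M \<Longrightarrow> \<phi> (c \<odot>\<^bsub>M\<^esub> x) = \<iota> c \<otimes>\<^bsub>Q\<^esub> \<phi> x"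
  using ring_hom_mult[OF \<phi>, of "c \<odot>\<^bsub>M\<^esub> \<one>\<^bsub>M\<^esub>" x] by (simp add: \<iota>_def smult_assoc2)

lemma \<iota>_scalar: "c \<in> carrier R \<Longrightarrow> \<iota> c \<in> \<phi> ` scalars"
  by (simp add: \<iota>_def scalars_def)

text \<open>The pairing of differentials with a derivation, written on the tensor square: if
  \<open>\<delta> 1 = 0\<close>, it sends \<open>a \<otimes> 1 - 1 \<otimes> a\<close> to
  \<open>- \<delta> (\<phi> a)\<close>.\<close>

definition form :: "('e \<Rightarrow> 'e) \<Rightarrow> ('c \<times> 'c \<Rightarrow> 'a) set \<Rightarrow> 'e" where
  "form \<delta> = tensor_lift R N (\<lambda>u v. \<phi> u \<otimes>\<^bsub>Q\<^esub> \<delta> (\<phi> v))"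

lemma
  assumes "partial_derivation Q (\<phi> ` scalars) X \<delta>"
  shows form_lin: "lin_map R (tensor R M M) N (form \<delta>)"
    and form_pure: "u \<in> carrier M \<Longrightarrow> v \<in> carrier M \<Longrightarrow>
      form \<delta> (pure_tensor R M M u v) = \<phi> u \<otimes>\<^bsub>Q\<^esub> \<delta> (\<phi> v)"
proof -
  note d = assms[unfolded partial_derivation_def]
  have dc: "\<delta> x \<in> carrier Q" if "x \<in> carrier Q" for x using d that by blast
  note pc = ring_hom_closed[OF \<phi>] and ic = ring_hom_closed[OF \<iota>_hom]
  have b: "bilin R M M N (\<lambda>u v. \<phi> u \<otimes>\<^bsub>Q\<^esub> \<delta> (\<phi> v))"
  proof (intro bilin.intro bilin_axioms.intro module_axioms N_module)
    fix x y assume x: "x \<in> carrier M" and y: "y \<in> carrier M"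
    show "\<phi> x \<otimes>\<^bsub>Q\<^esub> \<delta> (\<phi> y) \<in> carrier N" using x y pc dc by (simp add: N_simps)
    show "\<phi> (x \<oplus>\<^bsub>M\<^esub> x') \<otimes>\<^bsub>Q\<^esub> \<delta> (\<phi> y) = \<phi> x \<otimes>\<^bsub>Q\<^esub> \<delta> (\<phi> y) \<oplus>\<^bsub>N\<^esub> \<phi> x' \<otimes>\<^bsub>Q\<^esub> \<delta> (\<phi> y)"
      if "x' \<in> carrier M" for x'
      using x y that pc dc by (simp add: N_simps ring_hom_add[OF \<phi>] Q.l_distr)
    show "\<phi> x \<otimes>\<^bsub>Q\<^esub> \<delta> (\<phi> (y \<oplus>\<^bsub>M\<^esub> y')) = \<phi> x \<otimes>\<^bsub>Q\<^esub> \<delta> (\<phi> y) \<oplus>\<^bsub>N\<^esub> \<phi> x \<otimes>\<^bsub>Q\<^esub> \<delta> (\<phi> y')"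
      if "y' \<in> carrier M" for y'
      using x y that pc dc d by (simp add: N_simps ring_hom_add[OF \<phi>] Q.r_distr)
    fix c assume c: "c \<in> carrier R"
    show "\<phi> (c \<odot>\<^bsub>M\<^esub> x) \<otimes>\<^bsub>Q\<^esub> \<delta> (\<phi> y) = c \<odot>\<^bsub>N\<^esub> (\<phi> x \<otimes>\<^bsub>Q\<^esub> \<delta> (\<phi> y))"
      using x y c pc dc ic by (simp add: N_simps \<phi>_smult Q.m_assoc)
    have "\<delta> (\<iota> c \<otimes>\<^bsub>Q\<^esub> \<phi> y) = \<iota> c \<otimes>\<^bsub>Q\<^esub> \<delta> (\<phi> y)" using d \<iota>_scalar[OF c] pc[OF y] by blast
    then show "\<phi> x \<otimes>\<^bsub>Q\<^esub> \<delta> (\<phi> (c \<odot>\<^bsub>M\<^esub> y)) = c \<odot>\<^bsub>N\<^esub> (\<phi> x \<otimes>\<^bsub>Q\<^esub> \<delta> (\<phi> y))"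
      using x y c pc dc ic by (simp add: N_simps \<phi>_smult Q.m_lcomm)
  qed
  show "lin_map R (tensor R M M) N (form \<delta>)" unfolding form_def by (rule bilin.tensor_lift_lin[OF b])
  show "u \<in> carrier M \<Longrightarrow> v \<in> carrier M \<Longrightarrow> form \<delta> (pure_tensor R M M u v) = \<phi> u \<otimes>\<^bsub>Q\<^esub> \<delta> (\<phi> v)"
    unfolding form_def by (rule bilin.tensor_lift_pure[OF b])
qed

text \<open>The quantifier over \<delta> is inside because \<open>X\<close> must be fixed by
  \<open>i\<close> and \<open>j\<close> alone, before \<delta> is constructed from
  \<open>X\<close>.\<close>

definition leibniz_on :: "'e set \<Rightarrow> ('c \<times> 'c \<Rightarrow> 'a) set \<Rightarrow> ('c \<times> 'c \<Rightarrow> 'a) set \<Rightarrow> bool" where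
  "leibniz_on X i j \<longleftrightarrow> (\<forall>\<delta>. partial_derivation Q (\<phi> ` scalars) X \<delta> \<longrightarrow>
    form \<delta> (i \<otimes>\<^bsub>tensor_algebra R M M\<^esub> j) =
      \<phi> (mult_map R M i) \<otimes>\<^bsub>Q\<^esub> form \<delta> j \<oplus>\<^bsub>Q\<^esub> form \<delta> i \<otimes>\<^bsub>Q\<^esub> \<phi> (mult_map R M j))"

lemma form_closed:
  "partial_derivation Q (\<phi> ` scalars) X \<delta> \<Longrightarrow> i \<in> carrier (tensor R M M) \<Longrightarrow> form \<delta> i \<in> carrier Q"
  using lin_map.closed[OF form_lin] by (simp add: N_simps)

lemma \<mu>_closed: "i \<in> carrier (tensor R M M) \<Longrightarrow> \<phi> (mult_map R M i) \<in> carrier Q"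
  using lin_map.closed[OF mult_map_lin] ring_hom_closed[OF \<phi>] by blast

lemma leibniz_on_comm:
  assumes "leibniz_on X i j" "i \<in> carrier (tensor R M M)" "j \<in> carrier (tensor R M M)"
  shows "leibniz_on X j i"
  unfolding leibniz_on_def
proof (intro allI impI)
  fix \<delta> assume d: "partial_derivation Q (\<phi> ` scalars) X \<delta>"
  have "j \<otimes>\<^bsub>tensor_algebra R M M\<^esub> i = i \<otimes>\<^bsub>tensor_algebra R M M\<^esub> j"
    using assms(2,3) AA.tm_comm by (simp add: AA.TA_simps)
  then show "form \<delta> (j \<otimes>\<^bsub>tensor_algebra R M M\<^esub> i) =
      \<phi> (mult_map R M j) \<otimes>\<^bsub>Q\<^esub> form \<delta> i \<oplus>\<^bsub>Q\<^esub> form \<delta> j \<otimes>\<^bsub>Q\<^esub> \<phi> (mult_map R M i)"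
    using assms d form_closed[OF d] \<mu>_closed
    by (simp add: leibniz_on_def Q.m_comm Q.a_comm)
qed

text \<open>Enlarging the set only restricts the admissible \<delta>, so the sets of two summands
  can be united.\<close>

lemma leibniz_on_combine:
  assumes ij: "leibniz_on X i j" "leibniz_on Y i' j" and c: "c \<in> carrier R"
    and car: "i \<in> carrier (tensor R M M)" "i' \<in> carrier (tensor R M M)" "j \<in> carrier (tensor R M M)"
  shows "leibniz_on (X \<union> Y) (c \<odot>\<^bsub>tensor R M M\<^esub> i \<oplus>\<^bsub>tensor R M M\<^esub> i') j"
  unfolding leibniz_on_def
proof (intro allI impI)
  fix \<delta> assume d: "partial_derivation Q (\<phi> ` scalars) (X \<union> Y) \<delta>"
  note d1 = partial_derivation_mono[OF d Un_upper1] and d2 = partial_derivation_mono[OF d Un_upper2]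
  interpret f: lin_map R "tensor R M M" N "form \<delta>" by (rule form_lin[OF d])
  interpret m: lin_map R "tensor R M M" M "mult_map R M" by (rule mult_map_lin)
  interpret t: lin_map R "tensor R M M" "tensor R M M" "\<lambda>X. X \<otimes>\<^bsub>tensor_algebra R M M\<^esub> j"
    using AA.tm_lin1[OF car(3)] by (simp add: AA.TA_simps)
  let ?z = "c \<odot>\<^bsub>tensor R M M\<^esub> i \<oplus>\<^bsub>tensor R M M\<^esub> i'"
  have "form \<delta> (?z \<otimes>\<^bsub>tensor_algebra R M M\<^esub> j) =
    \<iota> c \<otimes>\<^bsub>Q\<^esub> form \<delta> (i \<otimes>\<^bsub>tensor_algebra R M M\<^esub> j) \<oplus>\<^bsub>Q\<^esub> form \<delta> (i' \<otimes>\<^bsub>tensor_algebra R M M\<^esub> j)"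
    using c car t.closed by (simp add: t.add t.smult f.add f.smult N_simps)
  also have "\<dots> = (\<iota> c \<otimes>\<^bsub>Q\<^esub> \<phi> (mult_map R M i) \<oplus>\<^bsub>Q\<^esub> \<phi> (mult_map R M i')) \<otimes>\<^bsub>Q\<^esub> form \<delta> j \<oplus>\<^bsub>Q\<^esub>
      (\<iota> c \<otimes>\<^bsub>Q\<^esub> form \<delta> i \<oplus>\<^bsub>Q\<^esub> form \<delta> i') \<otimes>\<^bsub>Q\<^esub> \<phi> (mult_map R M j)"
    using ij d1 d2 unfolding leibniz_on_def
    using Q.leibniz_combine[OF ring_hom_closed[OF \<iota>_hom c] \<mu>_closed[OF car(1)] \<mu>_closed[OF car(2)]
      \<mu>_closed[OF car(3)] form_closed[OF d car(1)] form_closed[OF d car(2)] form_closed[OF d car(3)]]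
    by simp
  also have "\<iota> c \<otimes>\<^bsub>Q\<^esub> form \<delta> i \<oplus>\<^bsub>Q\<^esub> form \<delta> i' = form \<delta> ?z"
    using c car by (simp add: f.add f.smult N_simps)
  also have "\<iota> c \<otimes>\<^bsub>Q\<^esub> \<phi> (mult_map R M i) \<oplus>\<^bsub>Q\<^esub> \<phi> (mult_map R M i') = \<phi> (mult_map R M ?z)"
    using c car m.closed by (simp add: m.add m.smult ring_hom_add[OF \<phi>] \<phi>_smult)
  finally show "form \<delta> (?z \<otimes>\<^bsub>tensor_algebra R M M\<^esub> j) =
     \<phi> (mult_map R M ?z) \<otimes>\<^bsub>Q\<^esub> form \<delta> j \<oplus>\<^bsub>Q\<^esub> form \<delta> ?z \<otimes>\<^bsub>Q\<^esub> \<phi> (mult_map R M j)" .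
qed

lemma leibniz_on_zero:
  assumes "j \<in> carrier (tensor R M M)"
  shows "leibniz_on X \<zero>\<^bsub>tensor R M M\<^esub> j"
  unfolding leibniz_on_def
proof (intro allI impI)
  fix \<delta> assume d: "partial_derivation Q (\<phi> ` scalars) X \<delta>"
  have "\<zero>\<^bsub>tensor R M M\<^esub> \<otimes>\<^bsub>tensor_algebra R M M\<^esub> j = \<zero>\<^bsub>tensor R M M\<^esub>"
    using lin_map.zero[OF AA.tm_lin1[OF assms]] by (simp add: AA.TA_simps)
  moreover have "form \<delta> \<zero>\<^bsub>tensor R M M\<^esub> = \<zero>\<^bsub>Q\<^esub>" using lin_map.zero[OF form_lin[OF d]] by (simp add: N_simps)
  moreover have "\<phi> (mult_map R M \<zero>\<^bsub>tensor R M M\<^esub>) = \<zero>\<^bsub>Q\<^esub>"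
    using lin_map.zero[OF mult_map_lin] ring_hom_zero[OF \<phi>] cring.axioms(1)[OF M_cring] Q.ring_axioms by simp
  ultimately show "form \<delta> (\<zero>\<^bsub>tensor R M M\<^esub> \<otimes>\<^bsub>tensor_algebra R M M\<^esub> j) =
      \<phi> (mult_map R M \<zero>\<^bsub>tensor R M M\<^esub>) \<otimes>\<^bsub>Q\<^esub> form \<delta> j \<oplus>\<^bsub>Q\<^esub>
      form \<delta> \<zero>\<^bsub>tensor R M M\<^esub> \<otimes>\<^bsub>Q\<^esub> \<phi> (mult_map R M j)"
    using form_closed[OF d assms] \<mu>_closed[OF assms] by simp
qed

lemma leibniz_on_pure:
  assumes "u \<in> carrier M" "v \<in> carrier M" "u' \<in> carrier M" "v' \<in> carrier M"
  shows "leibniz_on {\<phi> v, \<phi> v'} (pure_tensor R M M u v) (pure_tensor R M M u' v')"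
  unfolding leibniz_on_def
proof (intro allI impI)
  fix \<delta> assume d: "partial_derivation Q (\<phi> ` scalars) {\<phi> v, \<phi> v'} \<delta>"
  note pc = ring_hom_closed[OF \<phi>] and pm = ring_hom_mult[OF \<phi>]
  have dc: "\<delta> x \<in> carrier Q" if "x \<in> carrier Q" for x using d that unfolding partial_derivation_def by blast
  have "\<delta> (\<phi> v \<otimes>\<^bsub>Q\<^esub> \<phi> v') = \<phi> v \<otimes>\<^bsub>Q\<^esub> \<delta> (\<phi> v') \<oplus>\<^bsub>Q\<^esub> \<delta> (\<phi> v) \<otimes>\<^bsub>Q\<^esub> \<phi> v'"
    using d unfolding partial_derivation_def by blast
  then show "form \<delta> (pure_tensor R M M u v \<otimes>\<^bsub>tensor_algebra R M M\<^esub> pure_tensor R M M u' v') =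
      \<phi> (mult_map R M (pure_tensor R M M u v)) \<otimes>\<^bsub>Q\<^esub> form \<delta> (pure_tensor R M M u' v') \<oplus>\<^bsub>Q\<^esub>
      form \<delta> (pure_tensor R M M u v) \<otimes>\<^bsub>Q\<^esub> \<phi> (mult_map R M (pure_tensor R M M u' v'))"
    using assms Q.leibniz_pure[of "\<phi> u" "\<phi> u'" "\<phi> v" "\<phi> v'" "\<delta> (\<phi> v)" "\<delta> (\<phi> v')"]
    by (simp add: AA.TA_simps AA.tm_pure form_pure[OF d] mult_map_pure pm pc dc)
qed

text \<open>\<open>form\<close> differentiates second tensor factors only, so the images of those
  occurring in expressions of \<open>i\<close> and \<open>j\<close> suffice; induction on each
  argument collects them.\<close>

lemma leibniz_exists:
  assumes i: "i \<in> carrier (tensor R M M)" and j: "j \<in> carrier (tensor R M M)"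
  shows "\<exists>X. finite X \<and> X \<subseteq> carrier Q \<and> leibniz_on X i j"
proof -
  note pc = ring_hom_closed[OF \<phi>]
  have pure: "\<exists>X. finite X \<and> X \<subseteq> carrier Q \<and> leibniz_on X (pure_tensor R M M u v) j"
    if uv: "u \<in> carrier M" "v \<in> carrier M" for u v
    using module_axioms j
  proof (induction rule: tensor_induct)
    case zero
    have "leibniz_on {} (pure_tensor R M M u v) \<zero>\<^bsub>tensor R M M\<^esub>"
      by (rule leibniz_on_comm[OF leibniz_on_zero]) (use AA.p.closed[OF uv] in simp_all)
    then show ?case by blast
  next
    case (add c m n w)
    then obtain X where X: "finite X" "X \<subseteq> carrier Q" "leibniz_on X (pure_tensor R M M u v) w" by blast
    note p = AA.p.closed[OF uv] AA.p.closed[OF add(2,3)]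
    have "leibniz_on ({\<phi> n, \<phi> v} \<union> X) (c \<odot>\<^bsub>tensor R M M\<^esub> pure_tensor R M M m n \<oplus>\<^bsub>tensor R M M\<^esub> w)
        (pure_tensor R M M u v)"
      by (rule leibniz_on_combine[OF leibniz_on_pure[OF add(2,3) uv] leibniz_on_comm[OF X(3) p(1) add(4)]
        add(1) p(2) add(4) p(1)])
    then have "leibniz_on ({\<phi> n, \<phi> v} \<union> X) (pure_tensor R M M u v)
        (c \<odot>\<^bsub>tensor R M M\<^esub> pure_tensor R M M m n \<oplus>\<^bsub>tensor R M M\<^esub> w)"
      by (rule leibniz_on_comm) (use p add in simp_all)
    moreover have "finite ({\<phi> n, \<phi> v} \<union> X)" "{\<phi> n, \<phi> v} \<union> X \<subseteq> carrier Q"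
      using X pc uv add(3) by auto
    ultimately show ?case by blast
  qed
  from module_axioms i show ?thesis
  proof (induction rule: tensor_induct)
    case zero
    show ?case using leibniz_on_zero[OF j] by blast
  next
    case (add c m n w)
    then obtain X where X: "finite X" "X \<subseteq> carrier Q" "leibniz_on X w j" by blast
    obtain Y where Y: "finite Y" "Y \<subseteq> carrier Q" "leibniz_on Y (pure_tensor R M M m n) j"
      using pure[OF add(2,3)] by blast
    have "leibniz_on (Y \<union> X) (c \<odot>\<^bsub>tensor R M M\<^esub> pure_tensor R M M m n \<oplus>\<^bsub>tensor R M M\<^esub> w) j"
      by (rule leibniz_on_combine[OF Y(3) X(3) add(1) AA.p.closed[OF add(2,3)] add(4) j])
    moreover have "finite (Y \<union> X)" "Y \<union> X \<subseteq> carrier Q" using X Y by auto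
    ultimately show ?case by blast
  qed
qed

text \<open>For an honest derivation \<open>\<delta>\<close> this says that \<open>u \<otimes> v \<mapsto> u \<delta>(v)\<close> kills \<open>I\<^sup>2\<close>; each
  element of \<open>I\<^sup>2\<close> involves only finitely many instances of the Leibniz rule.\<close>

lemma form_kills_square:
  assumes "z \<in> ideal_prod (tensor_algebra R M M) J J"
    and J: "J = a_kernel (tensor_algebra R M M) M (mult_map R M)"
  shows "z \<in> carrier (tensor R M M) \<and> (\<exists>X. finite X \<and> X \<subseteq> carrier Q \<and>
    (\<forall>\<delta>. partial_derivation Q (\<phi> ` scalars) X \<delta> \<longrightarrow> form \<delta> z = \<zero>\<^bsub>Q\<^esub>))"
  using assms(1)
proof (induction z rule: ideal_prod.induct)
  case (prod i j)
  then have i: "i \<in> carrier (tensor R M M)" "mult_map R M i = \<zero>\<^bsub>M\<^esub>"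
    and j: "j \<in> carrier (tensor R M M)" "mult_map R M j = \<zero>\<^bsub>M\<^esub>"
    unfolding J a_kernel_def' by (simp_all add: AA.TA_simps)
  obtain X where X: "finite X" "X \<subseteq> carrier Q" "leibniz_on X i j" using leibniz_exists[OF i(1) j(1)] by blast
  have z: "\<phi> \<zero>\<^bsub>M\<^esub> = \<zero>\<^bsub>Q\<^esub>"
    using ring_hom_zero[OF \<phi>] cring.axioms(1)[OF M_cring] Q.ring_axioms by simp
  have "form \<delta> (i \<otimes>\<^bsub>tensor_algebra R M M\<^esub> j) = \<zero>\<^bsub>Q\<^esub>"
    if d: "partial_derivation Q (\<phi> ` scalars) X \<delta>" for \<delta>
    using X(3) d form_closed[OF d i(1)] form_closed[OF d j(1)] by (simp add: leibniz_on_def i j z)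
  moreover have "i \<otimes>\<^bsub>tensor_algebra R M M\<^esub> j \<in> carrier (tensor R M M)"
    using AA.tm_closed[OF i(1) j(1)] by (simp add: AA.TA_simps)
  ultimately show ?case using X by blast
next
  case (sum s t)
  then obtain X Y where X: "finite X" "X \<subseteq> carrier Q"
      "\<And>\<delta>. partial_derivation Q (\<phi> ` scalars) X \<delta> \<Longrightarrow> form \<delta> s = \<zero>\<^bsub>Q\<^esub>"
    and Y: "finite Y" "Y \<subseteq> carrier Q"
      "\<And>\<delta>. partial_derivation Q (\<phi> ` scalars) Y \<delta> \<Longrightarrow> form \<delta> t = \<zero>\<^bsub>Q\<^esub>"
    and st: "s \<in> carrier (tensor R M M)" "t \<in> carrier (tensor R M M)" by blast
  have "form \<delta> (s \<oplus>\<^bsub>tensor_algebra R M M\<^esub> t) = \<zero>\<^bsub>Q\<^esub>"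
    if d: "partial_derivation Q (\<phi> ` scalars) (X \<union> Y) \<delta>" for \<delta>
    using X(3)[OF partial_derivation_mono[OF d Un_upper1]] Y(3)[OF partial_derivation_mono[OF d Un_upper2]]
      lin_map.add[OF form_lin[OF d] st]
    by (simp add: AA.TA_simps N_simps)
  moreover have "s \<oplus>\<^bsub>tensor_algebra R M M\<^esub> t \<in> carrier (tensor R M M)"
    using st AA.p.P.M.a_closed by (simp add: AA.TA_simps)
  ultimately show ?case using X(1,2) Y(1,2) by (intro conjI exI[of _ "X \<union> Y"]) auto
qed

end

section \<open>Transcendental elements modulo a prime, and algebraicity\<close>

lemma (in cring) exists_prime_transcendental:
  assumes K: "subring K R" and inv: "\<And>c. c \<in> K \<Longrightarrow> c \<noteq> \<zero> \<Longrightarrow> \<exists>d\<in>K. d \<otimes> c = \<one>"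
    and a: "a \<in> carrier R" and nontriv: "\<one> \<noteq> \<zero>"
    and tr: "\<And>cs. set cs \<subseteq> K \<Longrightarrow> horner R cs a = \<zero> \<Longrightarrow> set cs \<subseteq> {\<zero>}"
  obtains P where "primeideal P R" "\<And>cs. set cs \<subseteq> K \<Longrightarrow> horner R cs a \<in> P \<Longrightarrow> set cs \<subseteq> {\<zero>}"
proof -
  note KE = subringE[OF K]
  \<comment> \<open>Transcendence of \<open>a\<close> says exactly that this multiplicative set
    misses zero. A prime disjoint from it contains no value of a nonzero polynomial at
    \<open>a\<close>.\<close>
  define S where "S = poly_values K a"
  have SR: "S \<subseteq> carrier R"
    using KE(1) a unfolding S_def poly_values_def
    by (auto simp: subset_iff simp del: horner.simps intro!: m_closed horner_closed)
  have "horner R [\<one>] a \<in> S"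
    unfolding S_def by (rule horner_in_poly_values[OF KE(1) a]) (use KE(3) nontriv in auto)
  then have S1: "\<one> \<in> S" using a by simp
  have S0: "\<zero> \<notin> S"
  proof
    assume "\<zero> \<in> S"
    then obtain m c cs where c: "\<zero> = a [^] (m::nat) \<otimes> horner R (c # cs) a"
      "set (c # cs) \<subseteq> K" "c \<noteq> \<zero>" unfolding S_def poly_values_def by blast
    \<comment> \<open>Padding with \<open>m\<close> zeros turns the factor \<open>a [^] m\<close>
      back into part of a polynomial, to which transcendence applies.\<close>
    have "horner R (replicate m \<zero> @ c # cs) a = \<zero>"
      using horner_replicate_zero[OF is_cring subset_trans[OF c(2) KE(1)] a, of m]
      unfolding c(1)[symmetric] .
    moreover have "set (replicate m \<zero> @ c # cs) \<subseteq> K" using c(2) KE(2) by auto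
    ultimately show False using tr[of "replicate m \<zero> @ c # cs"] c(3) by simp
  qed
  obtain P where P: "primeideal P R" "P \<inter> S = {}"
    by (rule exists_prime_ideal_disjoint[OF SR S1 S0])
      (auto simp: S_def intro: poly_values_mult[OF K inv a])
  have "set cs \<subseteq> {\<zero>}" if "set cs \<subseteq> K" "horner R cs a \<in> P" for cs
    using P(2) horner_in_poly_values[OF KE(1) a that(1)] that(2) unfolding S_def by blast
  with P(1) show ?thesis by (rule that)
qed

lemma list_image_lift:
  assumes "set cs \<subseteq> f ` K"
  obtains ds where "set ds \<subseteq> K" "cs = map f ds"
proof -
  have "\<exists>ds. set ds \<subseteq> K \<and> cs = map f ds" using assms
  proof (induction cs)
    case (Cons c cs)
    then obtain ds d where "set ds \<subseteq> K" "cs = map f ds" "d \<in> K" "c = f d" by auto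
    then show ?case by (intro exI[of _ "d # ds"]) auto
  qed simp
  then show ?thesis using that by blast
qed

lemma hom_inverse_image:
  assumes "ring_hom_ring R S f" "K \<subseteq> carrier R"
    and inv: "\<And>c. c \<in> K \<Longrightarrow> c \<noteq> \<zero>\<^bsub>R\<^esub> \<Longrightarrow> \<exists>d\<in>K. d \<otimes>\<^bsub>R\<^esub> c = \<one>\<^bsub>R\<^esub>"
    and c: "c \<in> f ` K" "c \<noteq> \<zero>\<^bsub>S\<^esub>"
  shows "\<exists>d\<in>f ` K. d \<otimes>\<^bsub>S\<^esub> c = \<one>\<^bsub>S\<^esub>"
proof -
  interpret f: ring_hom_ring R S f by fact
  obtain c0 where c0: "c0 \<in> K" "c = f c0" using c(1) by blast
  then have "c0 \<noteq> \<zero>\<^bsub>R\<^esub>" using c(2) f.hom_zero by metis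
  then obtain d where d: "d \<in> K" "d \<otimes>\<^bsub>R\<^esub> c0 = \<one>\<^bsub>R\<^esub>" using inv c0(1) by blast
  have dc: "d \<in> carrier R" "c0 \<in> carrier R" using d(1) c0(1) assms(2) by auto
  have "f d \<otimes>\<^bsub>S\<^esub> c = \<one>\<^bsub>S\<^esub>" unfolding c0(2) f.hom_mult[OF dc, symmetric] d(2) by (rule f.hom_one)
  then show ?thesis using d(1) by blast
qed

lemma hom_add_pow_one:
  assumes "ring_hom_ring R S f"
  shows "f (add_pow R (n::nat) \<one>\<^bsub>R\<^esub>) = add_pow S n \<one>\<^bsub>S\<^esub>"
proof -
  interpret f: ring_hom_ring R S f by fact
  show ?thesis by (induction n) (simp_all add: f.R.add.nat_pow_Suc f.S.add.nat_pow_Suc)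
qed

context algebra
begin

interpretation AA: two_alg R M M
  by (intro two_alg.intro algebra_axioms)

lemma char_zero_algebra:
  assumes "field R" "char_zero R" and nontriv: "\<one>\<^bsub>M\<^esub> \<noteq> \<zero>\<^bsub>M\<^esub>" and n: "n > 0"
  shows "add_pow M (n::nat) \<one>\<^bsub>M\<^esub> \<in> scalars" "add_pow M n \<one>\<^bsub>M\<^esub> \<noteq> \<zero>\<^bsub>M\<^esub>"
proof -
  interpret F: field R by fact
  have "add_pow M n \<one>\<^bsub>M\<^esub> = add_pow R n \<one>\<^bsub>R\<^esub> \<odot>\<^bsub>M\<^esub> \<one>\<^bsub>M\<^esub>" for n :: nat
    by (induction n) (simp_all add: smult_l_distr M.add.nat_pow_Suc R.add.nat_pow_Suc)
  note eq = this[of n]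
  show "add_pow M n \<one>\<^bsub>M\<^esub> \<in> scalars" by (simp add: eq scalars_def)
  show "add_pow M n \<one>\<^bsub>M\<^esub> \<noteq> \<zero>\<^bsub>M\<^esub>"
  proof
    let ?r = "add_pow R n \<one>\<^bsub>R\<^esub>"
    assume 0: "add_pow M n \<one>\<^bsub>M\<^esub> = \<zero>\<^bsub>M\<^esub>"
    have u: "?r \<in> Units R" using assms(2) n by (simp add: char_zero_def F.field_Units)
    have "\<one>\<^bsub>M\<^esub> = (inv\<^bsub>R\<^esub> ?r \<otimes>\<^bsub>R\<^esub> ?r) \<odot>\<^bsub>M\<^esub> \<one>\<^bsub>M\<^esub>" by (simp add: R.Units_l_inv[OF u])
    also have "\<dots> = inv\<^bsub>R\<^esub> ?r \<odot>\<^bsub>M\<^esub> (?r \<odot>\<^bsub>M\<^esub> \<one>\<^bsub>M\<^esub>)"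
      by (rule smult_assoc1) (use R.Units_inv_closed[OF u] in simp_all)
    also have "\<dots> = \<zero>\<^bsub>M\<^esub>" using 0 R.Units_inv_closed[OF u] by (simp add: eq)
    finally show False using nontriv by simp
  qed
qed

text \<open>A transcendental \<open>a\<close> stays transcendental modulo some prime, and the domain \<open>M / P\<close> then
  carries a derivation, up to finitely many instances of the Leibniz rule, that does not vanish at
  \<open>a\<close>; but it has to kill \<open>a \<otimes> 1 - 1 \<otimes> a\<close>.\<close>

lemma algebraic_of_idempotent_kernel:
  assumes F: "field R" and ch: "char_zero R" and nontriv: "\<one>\<^bsub>M\<^esub> \<noteq> \<zero>\<^bsub>M\<^esub>"
    and J: "J = a_kernel (tensor_algebra R M M) M (mult_map R M)"
    and idem: "J \<subseteq> ideal_prod (tensor_algebra R M M) J J"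
    and a: "a \<in> carrier M"
  shows "\<exists>cs. set cs \<subseteq> scalars \<and> \<not> set cs \<subseteq> {\<zero>\<^bsub>M\<^esub>} \<and> horner M cs a = \<zero>\<^bsub>M\<^esub>"
proof (rule ccontr)
  assume "\<not> ?thesis"
  then have tr: "set cs \<subseteq> {\<zero>\<^bsub>M\<^esub>}" if "set cs \<subseteq> scalars" "horner M cs a = \<zero>\<^bsub>M\<^esub>" for cs
    using that by blast
  note K = scalars_subring and KE = subringE[OF scalars_subring] and K_inv = scalars_inverse[OF F]
  obtain P where P: "primeideal P M"
    "\<And>cs. set cs \<subseteq> scalars \<Longrightarrow> horner M cs a \<in> P \<Longrightarrow> set cs \<subseteq> {\<zero>\<^bsub>M\<^esub>}"
    using exists_prime_transcendental[OF K K_inv a nontriv tr] by blast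
  interpret P': ideal P M by (rule primeideal.axioms(1)[OF P(1)])
  define Q where "Q = M Quot P"
  define \<phi> where "\<phi> = (\<lambda>x. P +>\<^bsub>M\<^esub> x)"
  have Qdom: "domain Q" unfolding Q_def by (rule primeideal.quotient_is_domain[OF P(1)])
  then have Qcring: "cring Q" by (rule domain.axioms(1))
  have hom: "\<phi> \<in> ring_hom M Q"
    unfolding \<phi>_def Q_def by (rule ideal.rcos_ring_hom[OF primeideal.axioms(1)[OF P(1)]])
  have hom_ring: "ring_hom_ring M Q \<phi>"
    by (intro ring_hom_ringI2 hom ring_axioms cring.axioms(1)[OF Qcring])
  interpret AQ: algebra_quotient R M Q \<phi>
    by (intro algebra_quotient.intro algebra_axioms algebra_quotient_axioms.intro Qcring hom)
  let ?K = "\<phi> ` scalars"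
  have K': "subring ?K Q" by (rule ring_hom_ring.img_is_subring[OF hom_ring K])
  have inv': "\<exists>d\<in>?K. d \<otimes>\<^bsub>Q\<^esub> c = \<one>\<^bsub>Q\<^esub>" if "c \<in> ?K" "c \<noteq> \<zero>\<^bsub>Q\<^esub>" for c
    by (rule hom_inverse_image[OF hom_ring KE(1) _ that]) (rule K_inv)
  \<comment> \<open>Positive integers are already invertible in \<open>M\<close>, hence nonzero in
    the nonzero ring \<open>Q\<close>.\<close>
  have chQ: "char_zero Q"
    unfolding char_zero_def
  proof (intro allI impI notI)
    fix n :: nat assume n: "n > 0" and 0: "add_pow Q n \<one>\<^bsub>Q\<^esub> = \<zero>\<^bsub>Q\<^esub>"
    note c = char_zero_algebra[OF F ch nontriv n]
    obtain d where d: "d \<in> scalars" "d \<otimes>\<^bsub>M\<^esub> add_pow M n \<one>\<^bsub>M\<^esub> = \<one>\<^bsub>M\<^esub>" using K_inv[OF c] by blast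
    have dM: "d \<in> carrier M" "add_pow M n \<one>\<^bsub>M\<^esub> \<in> carrier M" using d(1) c(1) KE(1) by auto
    have "\<one>\<^bsub>Q\<^esub> = \<phi> d \<otimes>\<^bsub>Q\<^esub> add_pow Q n \<one>\<^bsub>Q\<^esub>"
      unfolding hom_add_pow_one[OF hom_ring, symmetric] ring_hom_mult[OF hom dM, symmetric] d(2)
      by (rule ring_hom_one[OF hom, symmetric])
    also have "\<dots> = \<zero>\<^bsub>Q\<^esub>" unfolding 0 by (rule AQ.Q.r_null) (rule ring_hom_closed[OF hom dM(1)])
    finally show False using domain.one_not_zero[OF Qdom] by simp
  qed
  have trQ: "set cs \<subseteq> {\<zero>\<^bsub>Q\<^esub>}" if cs: "set cs \<subseteq> ?K" "horner Q cs (\<phi> a) = \<zero>\<^bsub>Q\<^esub>" for cs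
  proof -
    obtain ds where ds: "set ds \<subseteq> scalars" "cs = map \<phi> ds" by (rule list_image_lift[OF cs(1)])
    have dsM: "set ds \<subseteq> carrier M" using ds(1) KE(1) by blast
    have "\<phi> (horner M ds a) = \<zero>\<^bsub>Q\<^esub>"
      unfolding horner_hom[OF hom_ring dsM a] ds(2)[symmetric] by (rule cs(2))
    then have "P +>\<^bsub>M\<^esub> horner M ds a = P" by (simp add: \<phi>_def Q_def FactRing_def)
    then have "horner M ds a \<in> P" using P'.a_rcos_self[OF horner_closed[OF dsM a]] by blast
    then have "set ds \<subseteq> {\<zero>\<^bsub>M\<^esub>}" by (rule P(2)[OF ds(1)])
    then show ?thesis unfolding ds(2) using ring_hom_zero[OF hom ring_axioms AQ.Q.ring_axioms] by auto
  qed
  define x where "x = pure_tensor R M M a \<one>\<^bsub>M\<^esub> \<ominus>\<^bsub>tensor R M M\<^esub> pure_tensor R M M \<one>\<^bsub>M\<^esub> a"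
  have pa: "pure_tensor R M M a \<one>\<^bsub>M\<^esub> \<in> carrier (tensor R M M)"
    "pure_tensor R M M \<one>\<^bsub>M\<^esub> a \<in> carrier (tensor R M M)"
    using AA.p.closed[OF a one_closed] AA.p.closed[OF one_closed a] .
  have "mult_map R M x = \<zero>\<^bsub>M\<^esub>"
    unfolding x_def using lin_map.diff[OF mult_map_lin pa] a
    by (simp add: mult_map_pure a_minus_def r_neg)
  moreover have "x \<in> carrier (tensor R M M)" unfolding x_def by (rule AA.p.P.M.minus_closed[OF pa])
  ultimately have "x \<in> J" unfolding J a_kernel_def' AA.TA_simps by blast
  then have "x \<in> ideal_prod (tensor_algebra R M M) J J" using idem by blast
  from AQ.form_kills_square[OF this J] obtain X where X: "finite X" "X \<subseteq> carrier Q"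
    "\<And>\<delta>. partial_derivation Q ?K X \<delta> \<Longrightarrow> AQ.form \<delta> x = \<zero>\<^bsub>Q\<^esub>" by blast
  have aQ: "\<phi> a \<in> carrier Q" by (rule ring_hom_closed[OF hom a])
  have "\<exists>\<delta>. partial_derivation Q ?K X \<delta> \<and> \<delta> (\<phi> a) \<noteq> \<zero>\<^bsub>Q\<^esub> \<and> \<delta> \<one>\<^bsub>Q\<^esub> = \<zero>\<^bsub>Q\<^esub>"
    by (rule domain.exists_partial_derivation[OF Qdom chQ K' aQ _ _ X(1,2)])
      (erule (1) inv', erule (1) trQ)
  then obtain \<delta> where pd: "partial_derivation Q ?K X \<delta>"
    and d: "\<delta> (\<phi> a) \<noteq> \<zero>\<^bsub>Q\<^esub>" "\<delta> \<one>\<^bsub>Q\<^esub> = \<zero>\<^bsub>Q\<^esub>" by (elim exE conjE)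
  have da: "\<delta> (\<phi> a) \<in> carrier Q" using pd aQ unfolding partial_derivation_def by blast
  \<comment> \<open>The form vanishes at \<open>x\<close> and at \<open>a \<otimes> 1\<close>, the
    latter since \<delta> kills one, but at \<open>1 \<otimes> a\<close> it is
    \<open>\<delta> (\<phi> a)\<close>, which is not zero.\<close>
  have f1: "AQ.form \<delta> (pure_tensor R M M a \<one>\<^bsub>M\<^esub>) = \<zero>\<^bsub>Q\<^esub>"
    unfolding AQ.form_pure[OF pd a one_closed] ring_hom_one[OF hom] d(2) by (rule AQ.Q.r_null[OF aQ])
  have f2: "AQ.form \<delta> (pure_tensor R M M \<one>\<^bsub>M\<^esub> a) = \<delta> (\<phi> a)"
    unfolding AQ.form_pure[OF pd one_closed a] ring_hom_one[OF hom] by (rule AQ.Q.l_one[OF da])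
  have px: "pure_tensor R M M a \<one>\<^bsub>M\<^esub> = x \<oplus>\<^bsub>tensor R M M\<^esub> pure_tensor R M M \<one>\<^bsub>M\<^esub> a"
    unfolding x_def a_minus_def
    using pa by (simp add: AA.p.P.M.a_assoc AA.p.P.M.l_neg)
  have "AQ.form \<delta> (pure_tensor R M M a \<one>\<^bsub>M\<^esub>) =
      AQ.form \<delta> x \<oplus>\<^bsub>AQ.N\<^esub> AQ.form \<delta> (pure_tensor R M M \<one>\<^bsub>M\<^esub> a)"
    unfolding px by (rule lin_map.add[OF AQ.form_lin[OF pd] \<open>x \<in> carrier _\<close> pa(2)])
  then have "\<zero>\<^bsub>Q\<^esub> = \<zero>\<^bsub>Q\<^esub> \<oplus>\<^bsub>Q\<^esub> \<delta> (\<phi> a)" unfolding f1 f2 X(3)[OF pd] AQ.N_simps .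
  then show False using d(1) AQ.Q.l_zero[OF da] by simp
qed

text \<open>Modulo the ideal \<open>fixed\<close>, each \<open>u \<otimes> n\<close> is congruent to
  \<open>u n \<otimes> 1\<close>, so every tensor is congruent to its product placed in the first
  factor. For an element of the kernel that is zero.\<close>

lemma kernel_fixed:
  assumes x: "\<And>a. a \<in> carrier M \<Longrightarrow>
    pure_tensor R M M a \<one>\<^bsub>M\<^esub> \<ominus>\<^bsub>tensor_algebra R M M\<^esub> pure_tensor R M M \<one>\<^bsub>M\<^esub> a
      \<in> surj_hom.fixed (tensor_algebra R M M) M (mult_map R M)"
    and z: "z \<in> a_kernel (tensor_algebra R M M) M (mult_map R M)"
  shows "z \<in> surj_hom.fixed (tensor_algebra R M M) M (mult_map R M)"
proof -
  interpret SH: surj_hom "tensor_algebra R M M" M "mult_map R M" by (rule mult_map_surj_hom)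
  interpret m: lin_map R "tensor R M M" M "mult_map R M" by (rule mult_map_lin)
  let ?T = "tensor R M M" and ?TA = "tensor_algebra R M M" and ?p = "pure_tensor R M M"
  let ?l = "\<lambda>a. ?p a \<one>\<^bsub>M\<^esub>"
  interpret TA: algebra R ?TA by (rule AA.tensor_algebra_algebra)
  note pc = AA.p.closed
  have zT: "z \<in> carrier ?T" "mult_map R M z = \<zero>\<^bsub>M\<^esub>" using z by (simp_all add: SH.I_iff AA.TA_simps)
  have "\<exists>w\<in>SH.fixed. v = w \<oplus>\<^bsub>?T\<^esub> ?l (mult_map R M v)" if "v \<in> carrier ?T" for v
    using module_axioms that
  proof (induction rule: tensor_induct)
    case zero
    have "?l \<zero>\<^bsub>M\<^esub> = \<zero>\<^bsub>?T\<^esub>"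
      using AA.p.smult1[of "\<zero>\<^bsub>R\<^esub>" "\<zero>\<^bsub>M\<^esub>" "\<one>\<^bsub>M\<^esub>"] pc by simp
    then show ?case using SH.fixed_closed(2) by (intro bexI[of _ "\<zero>\<^bsub>?T\<^esub>"]) (simp_all add: m.zero AA.TA_simps)
  next
    case (add c u n v)
    then obtain w where w: "w \<in> SH.fixed" "v = w \<oplus>\<^bsub>?T\<^esub> ?l (mult_map R M v)" by blast
    have wT: "w \<in> carrier ?T" using w(1) SH.fixed_closed(1) by (auto simp: AA.TA_simps)
    define y where "y = ?l n \<ominus>\<^bsub>?TA\<^esub> ?p \<one>\<^bsub>M\<^esub> n"
    have nT: "?l n \<in> carrier ?TA" "?p \<one>\<^bsub>M\<^esub> n \<in> carrier ?TA" "?l u \<in> carrier ?TA"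
      using add(2,3) pc by (simp_all add: AA.TA_simps)
    have y: "y \<in> SH.fixed" unfolding y_def by (rule x[OF add(3)])
    \<comment> \<open>From \<open>u \<otimes> n = u n \<otimes> 1 - (u \<otimes> 1) (n \<otimes> 1 -
      1 \<otimes> n)\<close>, multiplied by \<open>c\<close>.\<close>
    define y' where "y' = (\<ominus>\<^bsub>?TA\<^esub> (c \<odot>\<^bsub>?TA\<^esub> ?l u)) \<otimes>\<^bsub>?TA\<^esub> y"
    have y': "y' \<in> SH.fixed"
      unfolding y'_def using add(1) nT by (intro SH.fixed_closed(3)[OF _ y]) simp
    have "c \<odot>\<^bsub>?TA\<^esub> ?p u n = y' \<oplus>\<^bsub>?TA\<^esub> c \<odot>\<^bsub>?TA\<^esub> ?l (u \<otimes>\<^bsub>M\<^esub> n)"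
    proof -
      have 1: "?p u n = ?l u \<otimes>\<^bsub>?TA\<^esub> ?p \<one>\<^bsub>M\<^esub> n" "?l (u \<otimes>\<^bsub>M\<^esub> n) = ?l u \<otimes>\<^bsub>?TA\<^esub> ?l n"
        using add(2,3) by (simp_all add: AA.TA_simps AA.tm_pure)
      have 2: "c \<odot>\<^bsub>?TA\<^esub> (?l u \<otimes>\<^bsub>?TA\<^esub> t) = (c \<odot>\<^bsub>?TA\<^esub> ?l u) \<otimes>\<^bsub>?TA\<^esub> t" if "t \<in> carrier ?TA" for t
        using add(1) nT(3) that by (simp add: TA.smult_assoc2)
      show ?thesis
        unfolding 1 2[OF nT(1)] 2[OF nT(2)] y'_def y_def
        by (rule SH.R.mult_diff_decomp) (use add(1) nT in simp_all)
    qed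
    then have cp: "c \<odot>\<^bsub>?T\<^esub> ?p u n = y' \<oplus>\<^bsub>?T\<^esub> ?l (c \<odot>\<^bsub>M\<^esub> (u \<otimes>\<^bsub>M\<^esub> n))"
      using add(1-3) by (simp add: AA.TA_simps AA.p.smult1)
    have y'T: "y' \<in> carrier ?T" using y' SH.fixed_closed(1) by (auto simp: AA.TA_simps)
    have "mult_map R M (c \<odot>\<^bsub>?T\<^esub> ?p u n \<oplus>\<^bsub>?T\<^esub> v) = c \<odot>\<^bsub>M\<^esub> (u \<otimes>\<^bsub>M\<^esub> n) \<oplus>\<^bsub>M\<^esub> mult_map R M v"
      using add pc by (simp add: m.add m.smult mult_map_pure)
    then have "?l (mult_map R M (c \<odot>\<^bsub>?T\<^esub> ?p u n \<oplus>\<^bsub>?T\<^esub> v)) =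
        ?l (c \<odot>\<^bsub>M\<^esub> (u \<otimes>\<^bsub>M\<^esub> n)) \<oplus>\<^bsub>?T\<^esub> ?l (mult_map R M v)"
      using add m.closed by (simp add: AA.p.add1)
    moreover have "c \<odot>\<^bsub>?T\<^esub> ?p u n \<oplus>\<^bsub>?T\<^esub> v =
        (y' \<oplus>\<^bsub>?T\<^esub> w) \<oplus>\<^bsub>?T\<^esub> (?l (c \<odot>\<^bsub>M\<^esub> (u \<otimes>\<^bsub>M\<^esub> n)) \<oplus>\<^bsub>?T\<^esub> ?l (mult_map R M v))"
    proof -
      have "?l (c \<odot>\<^bsub>M\<^esub> (u \<otimes>\<^bsub>M\<^esub> n)) \<in> carrier ?T" "?l (mult_map R M v) \<in> carrier ?T"
        using add m.closed pc by simp_all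
      then show ?thesis
        unfolding cp by (subst w(2)) (use y'T wT in \<open>simp add: AA.p.P.M.a_ac\<close>)
    qed
    moreover have "y' \<oplus>\<^bsub>?T\<^esub> w \<in> SH.fixed" using SH.fixed_closed(4)[OF y' w(1)] by (simp add: AA.TA_simps)
    ultimately show ?case by auto
  qed
  from this[OF zT(1)] obtain w where w: "w \<in> SH.fixed" "z = w \<oplus>\<^bsub>?T\<^esub> ?l \<zero>\<^bsub>M\<^esub>" using zT(2) by auto
  moreover have "?l \<zero>\<^bsub>M\<^esub> = \<zero>\<^bsub>?T\<^esub>"
    using AA.p.smult1[of "\<zero>\<^bsub>R\<^esub>" "\<zero>\<^bsub>M\<^esub>" "\<one>\<^bsub>M\<^esub>"] pc by simp
  moreover have "w \<in> carrier ?T" using w(1) SH.fixed_closed(1) by (auto simp: AA.TA_simps)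
  ultimately show ?thesis by simp
qed

end

theorem proposition1p8:
  fixes k :: "('k, 'p) ring_scheme" and A :: "('k, 'a, 'q) module_scheme"
  assumes "field k" and "char_zero k"
    and "algebra k A" and "reduced_ring A"
    and "carrier (HH k A 1) = {\<zero>\<^bsub>HH k A 1\<^esub>}"
  shows "\<forall>i\<ge>1. carrier (HH k A i) = {\<zero>\<^bsub>HH k A i\<^esub>}"
proof -
  interpret algebra k A by fact
  interpret D: diagonal "tensor_algebra k A A" A "mult_map k A"
    "\<lambda>a. pure_tensor k A A a \<one>\<^bsub>A\<^esub>" "\<lambda>a. pure_tensor k A A \<one>\<^bsub>A\<^esub> a" scalars
    by (rule diagonal_tensor[OF assms(1)])
  have idem: "D.I \<subseteq> ideal_prod (tensor_algebra k A A) D.I D.I"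
    using assms(5) by (intro D.kernel_idempotent_of_Tor) (simp add: HH_def)
  have "pure_tensor k A A a \<one>\<^bsub>A\<^esub> \<ominus>\<^bsub>tensor_algebra k A A\<^esub> pure_tensor k A A \<one>\<^bsub>A\<^esub> a \<in> D.fixed"
    if a: "a \<in> carrier A" for a
  \<comment> \<open>The zero algebra satisfies \<open>HH_1 = 0\<close> but is not of characteristic
    0; there \<open>a = 1\<close>, and the difference in question is zero.\<close>
  proof (cases "\<one>\<^bsub>A\<^esub> = \<zero>\<^bsub>A\<^esub>")
    case True
    have "a = \<one>\<^bsub>A\<^esub> \<otimes>\<^bsub>A\<^esub> a" using a by simp
    also have "\<dots> = \<zero>\<^bsub>A\<^esub>" using a unfolding True by simp
    finally have "a = \<one>\<^bsub>A\<^esub>" by (simp add: True)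
    then show ?thesis
      using D.fixed_closed(2) D.l.hom_closed[of "\<one>\<^bsub>A\<^esub>"] by (simp add: D.R.r_neg a_minus_def)
  next
    case False
    show ?thesis
    proof (rule D.fixed_of_algebraic[OF assms(4) _ _ a])
      show "char_zero A"
        using char_zero_algebra(2)[OF assms(1,2) False] by (simp add: char_zero_def)
    qed (rule algebraic_of_idempotent_kernel[OF assms(1,2) False refl idem])
  qed
  then have "x \<in> D.fixed" if "x \<in> D.I" for x using kernel_fixed that by blast
  then have pure: "\<exists>y\<in>D.I. y \<otimes>\<^bsub>tensor_algebra k A A\<^esub> x = x" if "x \<in> D.I" for x
    using that D.fixed_pure by blast
  show ?thesis
  proof (intro allI impI)
    fix i :: nat assume "i \<ge> 1"
    then obtain n where "i = Suc n" by (cases i) auto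
    then show "carrier (HH k A i) = {\<zero>\<^bsub>HH k A i\<^esub>}"
      unfolding HH_def using D.Tor_trivial_of_pure[OF D.N.module_axioms pure] by blast
  qed
qed

end
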